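(* Let $T>0$, $\alpha\in(0,1)$, $s\in(0,1)$, $H\in(0,1)$, let $D$ be a bounded domain with Lipschitz boundary, and let $h\in L^{\infty}([0,T])$ satisfy $h(t)\ge C_{h}>0$ for $t\in(0,T)$, with $C_h$ a constant. Let $f,g\in L^{2}(D)$ with $\|g\|_{L^{2}(D)}\neq0$, and let $u$ be the (mild) solution of $$\partial_{t}u(x,t)+\partial^{1-\alpha}_{t}A^{s}u(x,t)=f(x)h(t)+g(x)\dot{W}^{H}(t)\ \text{ in } D\times(0,T],\qquad u(x,0)=0\ \text{ in } D,\qquad u=0\ \text{ on }\partial D\times(0,T].$$ Write $u_{k}(t)=(u(t),\phi_{k})$. Then the source terms $f$ and $|g|$ are uniquely determined by the data set $$\{(\mathbb{E}u_{k}(T),\ \mathrm{Cov}(u_{k}(T),u_{l}(T))):\ k,l\in\mathbb{N}^{*}\}.$$ That is, with $D,T,\alpha,s,H,h$ fixed, if two pairs $(f,g)$ and $(\tilde f,\tilde g)$ of functions in $L^{2}(D)$ with $g,\tilde g\ne0$ produce the same data set (as families indexed by $k,l$), then $f=\tilde f$ and $|g|=|\tilde g|$ almost everywhere in $D$.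
   Context: $\{\lambda_{k},\phi_{k}\}_{k\ge1}$ are the nondecreasing eigenvalues and $L^{2}(D)$-normalized (orthonormal, real-valued) eigenfunctions of $A=-\Delta$ on $D$ with zero Dirichlet boundary condition; $A^{s}v=\sum_{k\ge1}\lambda_{k}^{s}(v,\phi_{k})\phi_{k}$, with $(\cdot,\cdot)$ the $L^2(D)$ inner product. Functions are real-valued. The Riemann–Liouville derivative is $\partial^{1-\alpha}_{t}u(t)=\frac{1}{\Gamma(\alpha)}\frac{\partial}{\partial t}\int_{0}^{t}(t-r)^{\alpha-1}u(r)\,dr$. $\mathbb{N}^{*}$ is the set of positive integers; $\mathbb{E}$ is expectation and $\mathrm{Cov}(X,Y)=\mathbb{E}[(X-\mathbb{E}X)(Y-\mathbb{E}Y)]$. $W^{H}$ is a one-dimensional fractional Brownian motion with Hurst index $H$ on a complete probability space (centered Gaussian, $\mathbb{E}[W^{H}(t)W^{H}(r)]=\frac12(t^{2H}+r^{2H}-|t-r|^{2H})$); integrals of deterministic functions against $W^{H}$ are Wiener integrals. With the Mittag-Leffler function $E_{\alpha,\beta}(z)=\sum_{k=0}^{\infty}\frac{z^{k}}{\Gamma(k\alpha+\beta)}$, the mild solution $u$ is given by its coefficients $$u_k(t)=(f,\phi_k)\int_0^tE_{\alpha,1}(-\lambda_k^s(t-r)^\alpha)h(r)\,dr+(g,\phi_k)\int_0^tE_{\alpha,1}(-\lambda_k^s(t-r)^\alpha)\,dW^H(r),\qquad k\ge1.$$ *)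

theory Defs
  imports "HOL-Probability.Probability"
begin

section \<open>Square-integrable functions\<close>

text \<open>
  Square-integrable functions are not identified up to null sets. The space \<open>L\<^sup>2(D)\<close>
  is obtained with the measure \<open>lebesgue_on D\<close>; values outside \<open>D\<close> play no role.
  The codomain is either \<open>real\<close> or, for gradients, the ambient Euclidean space.
\<close>

definition square_integrable :: "'m measure \<Rightarrow> ('m \<Rightarrow> 'b::euclidean_space) \<Rightarrow> bool" where
  "square_integrable M f \<longleftrightarrow> f \<in> borel_measurable M \<and> integrable M (\<lambda>x. (norm (f x))\<^sup>2)"

definition L2_inner :: "'m measure \<Rightarrow> ('m \<Rightarrow> 'b::euclidean_space) \<Rightarrow> ('m \<Rightarrow> 'b) \<Rightarrow> real" where
  "L2_inner M f g = (\<integral>x. f x \<bullet> g x \<partial>M)"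

definition L2_norm :: "'m measure \<Rightarrow> ('m \<Rightarrow> 'b::euclidean_space) \<Rightarrow> real" where
  "L2_norm M f = sqrt (L2_inner M f f)"

definition L2_tendsto ::
  "'m measure \<Rightarrow> (nat \<Rightarrow> 'm \<Rightarrow> 'b::euclidean_space) \<Rightarrow> ('m \<Rightarrow> 'b) \<Rightarrow> bool" where
  "L2_tendsto M F f \<longleftrightarrow>
     square_integrable M f \<and> (\<forall>n. square_integrable M (F n)) \<and>
     (\<lambda>n. L2_norm M (\<lambda>x. F n x - f x)) \<longlonglongrightarrow> 0"


section \<open>Bounded Lipschitz domains and the Dirichlet Laplacian\<close>

text \<open>
  Near each boundary point, \<open>D\<close> is the strict epigraph, in some direction \<open>e\<close>, of a
  Lipschitz function on the hyperplane orthogonal to \<open>e\<close>.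
\<close>

definition lipschitz_boundary :: "'a::euclidean_space set \<Rightarrow> bool" where
  "lipschitz_boundary D \<longleftrightarrow>
     (\<forall>p \<in> frontier D. \<exists>U e \<gamma> L.
        open U \<and> p \<in> U \<and> norm e = 1 \<and> L-lipschitz_on {y. y \<bullet> e = 0} \<gamma> \<and>
        D \<inter> U = {x \<in> U. x \<bullet> e > \<gamma> (x - (x \<bullet> e) *\<^sub>R e)})"

definition bounded_lipschitz_domain :: "'a::euclidean_space set \<Rightarrow> bool" where
  "bounded_lipschitz_domain D \<longleftrightarrow>
     D \<noteq> {} \<and> open D \<and> connected D \<and> bounded D \<and> lipschitz_boundary D"

text \<open>\<open>C1c D \<psi> d\<psi>\<close>: \<open>\<psi>\<close> belongs to \<open>C\<^sub>c\<^sup>1(D)\<close>, extended by zero, and has gradient \<open>d\<psi>\<close>.\<close>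

definition C1c :: "'a::euclidean_space set \<Rightarrow> ('a \<Rightarrow> real) \<Rightarrow> ('a \<Rightarrow> 'a) \<Rightarrow> bool" where
  "C1c D \<psi> d\<psi> \<longleftrightarrow>
     (\<forall>x. GDERIV \<psi> x :> d\<psi> x) \<and> continuous_on UNIV d\<psi> \<and>
     compact (closure {x. \<psi> x \<noteq> 0}) \<and> closure {x. \<psi> x \<noteq> 0} \<subseteq> D"

text \<open>
  \<open>H10 D v dv\<close>: \<open>v\<close> belongs to \<open>H\<^sub>0\<^sup>1(D)\<close>, the closure of \<open>C\<^sub>c\<^sup>1(D)\<close> in the \<open>H\<^sup>1\<close> norm,
  and has weak gradient \<open>dv\<close>.
\<close>

definition H10 :: "'a::euclidean_space set \<Rightarrow> ('a \<Rightarrow> real) \<Rightarrow> ('a \<Rightarrow> 'a) \<Rightarrow> bool" where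
  "H10 D v dv \<longleftrightarrow>
     (\<exists>\<psi> d\<psi>. (\<forall>n. C1c D (\<psi> n) (d\<psi> n)) \<and>
        L2_tendsto (lebesgue_on D) \<psi> v \<and> L2_tendsto (lebesgue_on D) d\<psi> dv)"

text \<open>
  \<open>-\<Delta> v = \<mu> v\<close> in \<open>D\<close> and \<open>v = 0\<close> on the boundary, in the usual weak sense. The zero
  function is not excluded here.
\<close>

definition dirichlet_eigenfunction ::
  "'a::euclidean_space set \<Rightarrow> real \<Rightarrow> ('a \<Rightarrow> real) \<Rightarrow> bool" where
  "dirichlet_eigenfunction D \<mu> v \<longleftrightarrow>
     (\<exists>dv. H10 D v dv \<and>
        (\<forall>\<psi> d\<psi>. C1c D \<psi> d\<psi> \<longrightarrow>
           L2_inner (lebesgue_on D) dv d\<psi> = \<mu> * L2_inner (lebesgue_on D) v \<psi>))"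

text \<open>
  Indices start at 1. The last clause says that the sequence lists all eigenvalues with
  their full multiplicities: no nonzero eigenfunction is orthogonal to all the \<open>\<phi> k\<close>.
\<close>

definition dirichlet_eigensystem ::
  "'a::euclidean_space set \<Rightarrow> (nat \<Rightarrow> real) \<Rightarrow> (nat \<Rightarrow> 'a \<Rightarrow> real) \<Rightarrow> bool" where
  "dirichlet_eigensystem D lam \<phi> \<longleftrightarrow>
     (\<forall>k\<ge>1. dirichlet_eigenfunction D (lam k) (\<phi> k)) \<and>
     (\<forall>j\<ge>1. \<forall>k\<ge>1. L2_inner (lebesgue_on D) (\<phi> j) (\<phi> k) = (if j = k then 1 else 0)) \<and>
     (\<forall>j\<ge>1. \<forall>k\<ge>j. lam j \<le> lam k) \<and>
     (\<forall>\<mu> v. dirichlet_eigenfunction D \<mu> v \<and>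
         (\<forall>k\<ge>1. L2_inner (lebesgue_on D) v (\<phi> k) = 0) \<longrightarrow>
         (AE x in lebesgue_on D. v x = 0))"


section \<open>Fractional Brownian motion and Wiener integrals\<close>

definition covariance :: "'w measure \<Rightarrow> ('w \<Rightarrow> real) \<Rightarrow> ('w \<Rightarrow> real) \<Rightarrow> real" where
  "covariance M X Y =
     (\<integral>\<omega>. (X \<omega> - (\<integral>\<omega>'. X \<omega>' \<partial>M)) * (Y \<omega> - (\<integral>\<omega>'. Y \<omega>' \<partial>M)) \<partial>M)"

text \<open>Constants are (degenerate) Gaussian random variables.\<close>

definition gaussian_rv :: "'w measure \<Rightarrow> ('w \<Rightarrow> real) \<Rightarrow> bool" where
  "gaussian_rv M X \<longleftrightarrow>
     X \<in> borel_measurable M \<and>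
     (\<exists>m \<sigma>. (\<sigma> = 0 \<and> (AE \<omega> in M. X \<omega> = m)) \<or>
            (\<sigma> > 0 \<and> distributed M lborel X (\<lambda>x. ennreal (normal_density m \<sigma> x))))"

text \<open>Joint Gaussianity is expressed through finite linear combinations.\<close>

definition fractional_brownian_motion ::
  "'w measure \<Rightarrow> real \<Rightarrow> (real \<Rightarrow> 'w \<Rightarrow> real) \<Rightarrow> bool" where
  "fractional_brownian_motion M H W \<longleftrightarrow>
     (\<forall>S c. finite S \<and> S \<subseteq> {0..} \<longrightarrow> gaussian_rv M (\<lambda>\<omega>. \<Sum>t\<in>S. c t * W t \<omega>)) \<and>
     (\<forall>t\<ge>0. (\<integral>\<omega>. W t \<omega> \<partial>M) = 0) \<and>
     (\<forall>t\<ge>0. \<forall>r\<ge>0. (\<integral>\<omega>. W t \<omega> * W r \<omega> \<partial>M) =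
        (t powr (2 * H) + r powr (2 * H) - \<bar>t - r\<bar> powr (2 * H)) / 2)"

text \<open>
  A step function \<open>\<Sum> c \<cdot> 1\<^bsub>(a,b]\<^esub>\<close> is represented by the list of its triples \<open>(c, a, b)\<close>;
  its Wiener integral is \<open>\<Sum> c \<cdot> (W b - W a)\<close>.
\<close>

type_synonym step = "(real \<times> real \<times> real) list"

definition step_on :: "real \<Rightarrow> step \<Rightarrow> bool" where
  "step_on t p \<longleftrightarrow> (\<forall>(c, a, b) \<in> set p. 0 \<le> a \<and> a \<le> b \<and> b \<le> t)"

definition step_fun :: "step \<Rightarrow> real \<Rightarrow> real" where
  "step_fun p r = (\<Sum>(c, a, b) \<leftarrow> p. c * indicat_real {a<..b} r)"

definition step_integral :: "(real \<Rightarrow> 'w \<Rightarrow> real) \<Rightarrow> step \<Rightarrow> 'w \<Rightarrow> real" where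
  "step_integral W p \<omega> = (\<Sum>(c, a, b) \<leftarrow> p. c * (W b \<omega> - W a \<omega>))"

text \<open>
  \<open>X\<close> is (a version of) the Wiener integral of \<open>v\<close> over \<open>[0,t]\<close>: the extension of
  \<open>step_integral\<close> by mean-square limits, i.e. its closure as an operator from
  \<open>L\<^sup>2(0,t)\<close> to \<open>L\<^sup>2(\<Omega>)\<close>. Taking the limit of the integrands in \<open>L\<^sup>2(0,t)\<close> serves all
  Hurst indices at once. For \<open>H \<ge> 1/2\<close>, convergence in \<open>L\<^sup>2(0,t)\<close> implies convergence in
  the reproducing norm \<open>1\<^bsub>[0,a]\<^esub> \<cdot> 1\<^bsub>[0,b]\<^esub> = \<bbbE>[W a W b]\<close>, so every \<open>v\<close> in
  \<open>L\<^sup>2(0,t)\<close> is integrable. For \<open>H < 1/2\<close> the completion of the step functions under the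
  reproducing norm embeds into \<open>L\<^sup>2(0,t)\<close>, and it is exactly the class of integrable \<open>v\<close>.
\<close>

definition has_wiener_integral ::
  "'w measure \<Rightarrow> (real \<Rightarrow> 'w \<Rightarrow> real) \<Rightarrow> real \<Rightarrow> (real \<Rightarrow> real) \<Rightarrow> ('w \<Rightarrow> real) \<Rightarrow> bool" where
  "has_wiener_integral M W t v X \<longleftrightarrow>
     (\<exists>p. (\<forall>n. step_on t (p n)) \<and>
        L2_tendsto (lebesgue_on {0..t}) (\<lambda>n. step_fun (p n)) v \<and>
        L2_tendsto M (\<lambda>n. step_integral W (p n)) X)"


section \<open>The mild solution\<close>

definition mittag_leffler :: "real \<Rightarrow> real \<Rightarrow> real \<Rightarrow> real" where
  "mittag_leffler \<alpha> \<beta> z = (\<Sum>k. z ^ k / Gamma (real k * \<alpha> + \<beta>))"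

definition ess_bounded_on :: "real set \<Rightarrow> (real \<Rightarrow> real) \<Rightarrow> bool" where
  "ess_bounded_on S h \<longleftrightarrow>
     h \<in> borel_measurable (lebesgue_on S) \<and> (\<exists>B. AE t in lebesgue_on S. \<bar>h t\<bar> \<le> B)"

definition eig_coeff ::
  "'a::euclidean_space set \<Rightarrow> (nat \<Rightarrow> 'a \<Rightarrow> real) \<Rightarrow> (real \<Rightarrow> 'w \<Rightarrow> 'a \<Rightarrow> real) \<Rightarrow>
   nat \<Rightarrow> real \<Rightarrow> 'w \<Rightarrow> real" where
  "eig_coeff D \<phi> u k t \<omega> = L2_inner (lebesgue_on D) (u t \<omega>) (\<phi> k)"

text \<open>
  Mild solution on \<open>[0,T]\<close> of
  \<open>\<partial>\<^sub>t u + \<partial>\<^sub>t\<^bsup>1-\<alpha>\<^esup> A\<^sup>s u = f h + g W'\<close>, \<open>u(0) = 0\<close>, with zero Dirichlet condition, where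
  \<open>A\<^sup>s v = \<Sum>\<^sub>k lam k\<^sup>s (v, \<phi> k) \<phi> k\<close>. It takes values in \<open>L\<^sup>2(D)\<close> and is specified by its
  coefficients in the eigenbasis; \<open>u t \<omega> x\<close> is the value at time \<open>t\<close>, outcome \<open>\<omega>\<close>, point \<open>x\<close>.
\<close>

definition mild_solution ::
  "'w measure \<Rightarrow> (real \<Rightarrow> 'w \<Rightarrow> real) \<Rightarrow> 'a::euclidean_space set \<Rightarrow>
   (nat \<Rightarrow> real) \<Rightarrow> (nat \<Rightarrow> 'a \<Rightarrow> real) \<Rightarrow> real \<Rightarrow> real \<Rightarrow> real \<Rightarrow> (real \<Rightarrow> real) \<Rightarrow>
   ('a \<Rightarrow> real) \<Rightarrow> ('a \<Rightarrow> real) \<Rightarrow> (real \<Rightarrow> 'w \<Rightarrow> 'a \<Rightarrow> real) \<Rightarrow> bool" where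
  "mild_solution M W D lam \<phi> T \<alpha> s h f g u \<longleftrightarrow>
     (\<forall>t\<in>{0..T}.
        (AE \<omega> in M. square_integrable (lebesgue_on D) (u t \<omega>)) \<and>
        (\<forall>k\<ge>1. \<exists>I.
           has_wiener_integral M W t
             (\<lambda>r. mittag_leffler \<alpha> 1 (- (lam k powr s) * (t - r) powr \<alpha>)) I \<and>
           (AE \<omega> in M.
              eig_coeff D \<phi> u k t \<omega> =
              L2_inner (lebesgue_on D) f (\<phi> k) *
                (\<integral>r. mittag_leffler \<alpha> 1 (- (lam k powr s) * (t - r) powr \<alpha>) * h r
                   \<partial>lebesgue_on {0..t}) +
              L2_inner (lebesgue_on D) g (\<phi> k) * I \<omega>)))"

end

theory Submission
  imports Defs "HOL-Real_Asymp.Real_Asymp" "HOL-Library.Diagonal_Subsequence"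
begin

text \<open>
  Write \<open>v\<^sub>k r = E\<^bsub>\<alpha>,1\<^esub>(- \<lambda>\<^sub>k\<^sup>s (T - r)\<^sup>\<alpha>)\<close>, let \<open>f\<^sub>k\<close> and \<open>g\<^sub>k\<close> be the coefficients of \<open>f\<close> and \<open>g\<close>, put
  \<open>m\<^sub>k = \<integral> v\<^sub>k h\<close>,
    and let \<open>I\<^sub>k\<close> be the Wiener integral of \<open>v\<^sub>k\<close>. Then \<open>u\<^sub>k(T) = f\<^sub>k m\<^sub>k + g\<^sub>k I\<^sub>k\<close> with \<open>I\<^sub>k\<close>
  centred, so the data are the numbers \<open>f\<^sub>k m\<^sub>k\<close>
    and \<open>g\<^sub>k g\<^sub>l E[I\<^sub>k I\<^sub>l]\<close>. If \<open>m\<^sub>k > 0\<close> and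
  \<open>E[I\<^sub>k I\<^sub>l] > 0\<close> for all \<open>k, l\<close>, the data determine every \<open>f\<^sub>k\<close>
    and every product \<open>g\<^sub>k g\<^sub>l\<close>; the latter
  determine the sequence \<open>(g\<^sub>k)\<close> up to one global sign. Completeness of the eigenfunctions then gives
  \<open>f\<close> and \<open>\<plusminus>g\<close>. Three facts have to be supplied.

  First, \<open>v\<^sub>k\<close> is positive (whence \<open>m\<^sub>k > 0\<close>)
    and nondecreasing, that is, \<open>x \<mapsto> E\<^bsub>\<alpha>,1\<^esub>(-x)\<close> is positive and nonincreasing on
  the half-line (\<open>mittag_leffler_pos\<close>, \<open>mittag_leffler_antimono\<close>). The function is a limit of the
  probabilities that a discrete renewal process, killed at each jump with a small probability, survives
  until a given time; a renewal equation with nonnegative weights shows everything by induction.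

  Second, \<open>E[I\<^sub>k I\<^sub>l] > 0\<close>
    for every Hurst index (\<open>wiener_inner_pos\<close>). A nonnegative nondecreasing
  integrand is a nonnegative combination of the indicators of \<open>(a,T]\<close>, and the increments \<open>W\<^sub>T - W\<^sub>a\<close>,
  \<open>W\<^sub>T - W\<^sub>b\<close> are nonnegatively correlated whatever \<open>H\<close> is: twice their covariance is
  \<open>(T-a)\<^bsup>2H\<^esup> + (T-b)\<^bsup>2H\<^esup> - |a-b|\<^bsup>2H\<^esup>\<close>,
    and \<open>|a-b|\<close> is at most the larger of \<open>T-a\<close> and \<open>T-b\<close>. The Wiener integral
  is a closure, so one must know that it does not depend on the approximating step functions; this
  is \<open>weak_null_W\<close>, whose idea is to average the covariance function over short intervals.

  Third, the eigenfunctions are complete (\<open>eigenfunctions_complete\<close>). The hypothesis says only that no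
  eigenfunction is missing from the list. If \<open>w \<noteq> 0\<close> were orthogonal to all of them, the inverse
  Laplacian, which is compact by a Rellich estimate (\<open>finite_rank_estimate\<close>), would have an eigenvector
  inside their orthogonal complement (\<open>eigenvector_orthogonal\<close>), a contradiction.
\<close>


section \<open>The Mittag-Leffler function on the negative half-line\<close>

text \<open>
  The coefficient of \<open>z\<^sup>n\<close> in \<open>(1 - z)\<^bsup>-a\<^esup>\<close>.
\<close>

definition nbc :: "real \<Rightarrow> nat \<Rightarrow> real" where
  "nbc a n = pochhammer a n / fact n"

lemma nbc_0 [simp]: "nbc a 0 = 1" by (simp add: nbc_def)

lemma nbc_one [simp]: "nbc 1 n = 1" by (simp add: nbc_def pochhammer_fact[symmetric])

lemma nbc_nonneg: "a \<ge> 0 \<Longrightarrow> nbc a n \<ge> 0"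
  by (auto simp: nbc_def pochhammer_prod intro!: divide_nonneg_pos prod_nonneg)

lemma nbc_add: "nbc (a + b) n = (\<Sum>j\<le>n. nbc a j * nbc b (n - j))"
proof -
  have "nbc (a + b) n = (\<Sum>j\<le>n. of_nat (n choose j) * pochhammer a j * pochhammer b (n - j) / fact n)"
    unfolding nbc_def pochhammer_binomial_sum by (simp add: sum_divide_distrib)
  also have "\<dots> = (\<Sum>j\<le>n. nbc a j * nbc b (n - j))"
    by (intro sum.cong refl) (simp add: nbc_def binomial_fact field_simps)
  finally show ?thesis .
qed

lemma nbc_sums:
  assumes "0 \<le> \<rho>" "\<rho> < 1"
  shows "(\<lambda>n. nbc a n * \<rho> ^ n) sums (1 - \<rho>) powr (- a)"
proof -
  have "(\<lambda>n. (- a gchoose n) * (- \<rho>) ^ n) sums (1 + - \<rho>) powr (- a)"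
    by (rule gen_binomial_real) (use assms in simp)
  moreover have "(- a gchoose n) * (- \<rho>) ^ n = nbc a n * \<rho> ^ n" for n
  proof -
    have sq: "(- 1) ^ n * (- 1) ^ n = (1::real)" by (simp flip: power_mult_distrib)
    have "(- a gchoose n) * (- \<rho>) ^ n = ((- 1) ^ n * (- 1) ^ n) * (nbc a n * \<rho> ^ n)"
      unfolding gbinomial_pochhammer nbc_def power_minus[of \<rho>] by simp
    then show ?thesis unfolding sq by simp
  qed
  ultimately show ?thesis by simp
qed

text \<open>
  A Cauchy estimate for a series with nonnegative coefficients. The coefficients of
  \<open>(1 - z)\<^bsup>-(a+1)\<^esup>\<close> are the partial sums of those of \<open>(1 - z)\<^bsup>-a\<^esup>\<close>; this saves the factor
  \<open>(1 - \<rho>)\<^sup>-\<^sup>1\<close> that the direct estimate would lose and that would spoil the uniform bound in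
  \<open>dml_limit\<close>.
\<close>

lemma nbc_bound:
  assumes a: "a \<ge> 0" and \<rho>: "0 < \<rho>" "\<rho> < 1"
  shows "nbc (a + 1) n \<le> (1 / \<rho>) ^ n * (1 - \<rho>) powr (- a)"
proof -
  have "nbc (a + 1) n = (\<Sum>j\<le>n. nbc a j)" by (simp add: nbc_add)
  also have "\<dots> \<le> (\<Sum>j\<le>n. (1 / \<rho>) ^ n * (nbc a j * \<rho> ^ j))"
  proof (rule sum_mono)
    fix j assume "j \<in> {..n}"
    then have "1 \<le> (1 / \<rho>) ^ (n - j)" using \<rho> by (intro one_le_power) simp
    also have "\<dots> = (1 / \<rho>) ^ n * \<rho> ^ j"
      using \<open>j \<in> {..n}\<close> \<rho> by (simp add: power_diff power_one_over field_simps)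
    finally have "nbc a j * 1 \<le> nbc a j * ((1 / \<rho>) ^ n * \<rho> ^ j)"
      using nbc_nonneg[OF a] by (intro mult_left_mono) auto
    then show "nbc a j \<le> (1 / \<rho>) ^ n * (nbc a j * \<rho> ^ j)" by (simp add: mult_ac)
  qed
  also have "\<dots> = (1 / \<rho>) ^ n * (\<Sum>j\<le>n. nbc a j * \<rho> ^ j)" by (simp add: sum_distrib_left)
  also have "\<dots> \<le> (1 / \<rho>) ^ n * (1 - \<rho>) powr (- a)"
  proof (rule mult_left_mono)
    have "(\<Sum>j\<le>n. nbc a j * \<rho> ^ j) \<le> (\<Sum>j. nbc a j * \<rho> ^ j)"
      using \<rho> nbc_sums[of \<rho> a] nbc_nonneg[OF a]
      by (intro sum_le_suminf) (auto simp: sums_iff)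
    then show "(\<Sum>j\<le>n. nbc a j * \<rho> ^ j) \<le> (1 - \<rho>) powr (- a)"
      using \<rho> nbc_sums[of \<rho> a] by (simp add: sums_iff)
  qed (use \<rho> in simp)
  finally show ?thesis .
qed

lemma nbc_limit:
  assumes "K \<ge> 0"
  shows "(\<lambda>n. nbc (K + 1) n / real n powr K) \<longlonglongrightarrow> 1 / Gamma (K + 1)"
proof -
  have "rGamma_series (K + 1) \<longlonglongrightarrow> rGamma (K + 1)" by (rule rGamma_series_LIMSEQ)
  moreover have "(\<lambda>n. real n / (real n + (K + 1))) \<longlonglongrightarrow> 1" by real_asymp
  ultimately have "(\<lambda>n. rGamma_series (K + 1) n * (real n / (real n + (K + 1)))) \<longlonglongrightarrow> rGamma (K + 1) * 1"
    by (rule tendsto_mult)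
  moreover have "\<forall>\<^sub>F n in sequentially. rGamma_series (K + 1) n * (real n / (real n + (K + 1))) = nbc (K + 1) n / real n powr K"
    using eventually_gt_at_top[of 0]
  proof eventually_elim
    case (elim n)
    have "exp ((K + 1) * ln (real n)) = real n powr K * real n"
      using elim by (simp add: powr_def distrib_right exp_add)
    moreover have "real n + (K + 1) \<noteq> 0" using assms by linarith
    moreover have "p * D / (f * (q * r)) * (r / D) = p / f / q" if "r \<noteq> 0" "D \<noteq> 0" for p D f q r :: real
      using that by (simp add: field_simps)
    ultimately show ?case using elim
      by (simp add: rGamma_series_def nbc_def pochhammer_Suc add.commute[of "real n"])
  qed
  ultimately show ?thesis by (simp add: Gamma_def tendsto_cong inverse_eq_divide)
qed

text \<open>
  Logarithmic convexity is preserved by sums. Here \<open>c\<close> and \<open>f\<close> stand for midpoint values, the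
  other letters for the values at the two end points.
\<close>

lemma log_convex_add:
  fixes a b c d e f :: real
  assumes "0 \<le> a" "0 \<le> b" "0 \<le> d" "0 \<le> e" "c\<^sup>2 \<le> a * b" "f\<^sup>2 \<le> d * e"
  shows "(c + f)\<^sup>2 \<le> (a + d) * (b + e)"
proof -
  have "(c * f)\<^sup>2 \<le> (a * b) * (d * e)"
    unfolding power_mult_distrib by (rule mult_mono) (simp_all add: assms)
  also have "\<dots> = (a * e) * (b * d)" by (simp add: mult_ac)
  also have "\<dots> \<le> ((a * e + b * d) / 2)\<^sup>2"
    using zero_le_power2[of "a * e - b * d"] by (simp add: power2_eq_square field_simps)
  finally have "\<bar>c * f\<bar> \<le> \<bar>(a * e + b * d) / 2\<bar>" by (simp only: abs_le_square_iff)
  then have "c * f \<le> \<bar>(a * e + b * d) / 2\<bar>" by (rule order_trans[OF abs_ge_self])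
  also have "\<dots> = (a * e + b * d) / 2" by (rule abs_of_nonneg) (simp add: assms)
  finally have "2 * (c * f) \<le> a * e + b * d" by simp
  then show ?thesis using assms(5,6) by (simp add: power2_eq_square algebra_simps)
qed

lemma log_convex_sum:
  fixes A B C w :: "'i \<Rightarrow> real"
  assumes "finite J"
    and "\<And>j. j \<in> J \<Longrightarrow> 0 \<le> w j" "\<And>j. j \<in> J \<Longrightarrow> 0 \<le> A j" "\<And>j. j \<in> J \<Longrightarrow> 0 \<le> B j"
    and "\<And>j. j \<in> J \<Longrightarrow> (C j)\<^sup>2 \<le> A j * B j"
  shows "(\<Sum>j\<in>J. w j * C j)\<^sup>2 \<le> (\<Sum>j\<in>J. w j * A j) * (\<Sum>j\<in>J. w j * B j)"
  using assms
proof (induction J)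
  case (insert j J)
  have "(w j)\<^sup>2 * (C j)\<^sup>2 \<le> (w j)\<^sup>2 * (A j * B j)" using insert.prems by (intro mult_left_mono) auto
  then have "(w j * C j)\<^sup>2 \<le> (w j * A j) * (w j * B j)"
    by (simp add: power_mult_distrib power2_eq_square mult_ac)
  moreover have "0 \<le> w j * A j" "0 \<le> w j * B j" "0 \<le> (\<Sum>j\<in>J. w j * A j)" "0 \<le> (\<Sum>j\<in>J. w j * B j)"
    using insert.prems by (auto intro!: sum_nonneg)
  ultimately show ?case using insert log_convex_add by simp
qed simp

text \<open>
  A discrete analogue of the Mittag-Leffler function. For \<open>0 \<le> \<mu> < 1\<close>, \<open>dml \<mu> n\<close> is the
  coefficient of \<open>z\<^sup>n\<close> in \<open>(1 - z)\<^bsup>\<alpha>-1\<^esup> / ((1 - z)\<^sup>\<alpha> + \<mu>)\<close>, expanded in powers of \<open>\<mu>\<close>. Since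
  \<open>1 - (1 - z)\<^sup>\<alpha>\<close> has nonnegative coefficients, it generates the jump law of a renewal process,
  and multiplying by the denominator gives the renewal equation \<open>dml_renewal\<close>. Its weights are
  nonnegative and \<open>\<mu>\<close> enters only through the factor \<open>1 + \<mu>\<close>, so sign, monotonicity and
  logarithmic convexity in \<open>\<mu>\<close> all follow
    by induction on \<open>n\<close>. With \<open>\<mu> = x / n\<^sup>\<alpha>\<close> and \<open>n \<rightarrow> \<infinity>\<close> they
  pass to the Mittag-Leffler function.
\<close>

context
  fixes \<alpha> :: real
  assumes \<alpha>: "0 < \<alpha>" "\<alpha> < 1"
begin

definition dml :: "real \<Rightarrow> nat \<Rightarrow> real" where
  "dml \<mu> n = (\<Sum>k. (- \<mu>) ^ k * nbc (real k * \<alpha> + 1) n)"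

lemma dml_summable:
  assumes "\<bar>\<mu>\<bar> < 1"
  shows "summable (\<lambda>k. (- \<mu>) ^ k * nbc (real k * \<alpha> + 1) n)"
proof -
  obtain \<rho> where \<rho>: "0 < \<rho>" "\<rho> < 1" "\<bar>\<mu>\<bar> * (1 - \<rho>) powr (- \<alpha>) < 1"
  proof -
    have "((\<lambda>\<rho>. \<bar>\<mu>\<bar> * (1 - \<rho>) powr (- \<alpha>)) \<longlongrightarrow> \<bar>\<mu>\<bar> * (1 - 0) powr (- \<alpha>)) (at_right 0)"
      by (intro tendsto_intros) auto
    then have "\<forall>\<^sub>F \<rho> in at_right 0. \<bar>\<mu>\<bar> * (1 - \<rho>) powr (- \<alpha>) < 1"
      by (rule order_tendstoD(2)) (use assms in simp)
    moreover have "\<forall>\<^sub>F \<rho> in at_right (0::real). \<rho> > 0 \<and> \<rho> < 1"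
      using eventually_at_right_less[of 0] eventually_at_right_real[of 0 1] by (auto elim: eventually_elim2)
    ultimately have "\<forall>\<^sub>F \<rho> in at_right 0. \<bar>\<mu>\<bar> * (1 - \<rho>) powr (- \<alpha>) < 1 \<and> \<rho> > 0 \<and> \<rho> < 1"
      by (rule eventually_conj)
    then show ?thesis using that eventually_happens'[of "at_right (0::real)"] trivial_limit_at_right_real by blast
  qed
  let ?q = "\<bar>\<mu>\<bar> * (1 - \<rho>) powr (- \<alpha>)"
  have "norm ((- \<mu>) ^ k * nbc (real k * \<alpha> + 1) n) \<le> (1 / \<rho>) ^ n * ?q ^ k" for k
  proof -
    have "(1 - \<rho>) powr (- (real k * \<alpha>)) = ((1 - \<rho>) powr (- \<alpha>)) ^ k"
      using \<rho> by (simp add: powr_powr mult.commute flip: powr_realpow)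
    then have "nbc (real k * \<alpha> + 1) n \<le> (1 / \<rho>) ^ n * ((1 - \<rho>) powr (- \<alpha>)) ^ k"
      using nbc_bound[of "real k * \<alpha>" \<rho> n] \<rho> \<alpha> by simp
    then have "\<bar>\<mu>\<bar> ^ k * nbc (real k * \<alpha> + 1) n \<le> \<bar>\<mu>\<bar> ^ k * ((1 / \<rho>) ^ n * ((1 - \<rho>) powr (- \<alpha>)) ^ k)"
      by (intro mult_left_mono) auto
    then show ?thesis
      using nbc_nonneg[of "real k * \<alpha> + 1" n] \<alpha> by (simp add: abs_mult power_abs power_mult_distrib mult_ac)
  qed
  moreover have "summable (\<lambda>k. (1 / \<rho>) ^ n * ?q ^ k)"
    using \<rho> by (intro summable_mult summable_geometric) auto
  ultimately show ?thesis by (intro summable_comparison_test[OF _ \<open>summable (\<lambda>k. (1 / \<rho>) ^ n * ?q ^ k)\<close>]) auto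
qed

lemma jump_weight_nonneg: "n > 0 \<Longrightarrow> - nbc (- \<alpha>) n \<ge> 0"
proof -
  assume "n > 0"
  then obtain m where n: "n = Suc m" by (cases n) auto
  have "pochhammer (1 - \<alpha>) m \<ge> 0"
    using \<alpha> by (auto simp: pochhammer_prod intro!: prod_nonneg)
  then show ?thesis using \<alpha> by (simp add: n nbc_def pochhammer_rec)
qed

text \<open>
  Multiplying by \<open>(1 - z)\<^sup>\<alpha>\<close> lowers the exponent of the \<open>k\<close>-th term
    by \<open>\<alpha>\<close>, which shifts the
  series in \<open>\<mu>\<close> by one.
\<close>

lemma dml_renewal:
  assumes "\<bar>\<mu>\<bar> < 1"
  shows "(1 + \<mu>) * dml \<mu> n = nbc (1 - \<alpha>) n + (\<Sum>j<n. - nbc (- \<alpha>) (n - j) * dml \<mu> j)"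
proof -
  note sm = dml_summable[OF assms]
  \<comment> \<open>The coefficient \<open>nbc (- \<alpha>) 0 = 1\<close> is included here and split off at the end.\<close>
  have "(\<Sum>j\<le>n. dml \<mu> j * nbc (- \<alpha>) (n - j))
      = (\<Sum>k. \<Sum>j\<le>n. (- \<mu>) ^ k * nbc (real k * \<alpha> + 1) j * nbc (- \<alpha>) (n - j))"
    unfolding dml_def by (subst suminf_sum) (auto intro!: summable_mult2 sm sum.cong simp: suminf_mult2[OF sm])
  also have "\<dots> = (\<Sum>k. (- \<mu>) ^ k * nbc (real k * \<alpha> + 1 - \<alpha>) n)"
    using nbc_add[of "real _ * \<alpha> + 1" "- \<alpha>" n] by (simp add: sum_distrib_left mult.assoc)
  also have "\<dots> = nbc (1 - \<alpha>) n + (\<Sum>k. - \<mu> * ((- \<mu>) ^ k * nbc (real k * \<alpha> + 1) n))"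
  proof -
    have *: "(- \<mu>) ^ Suc k * nbc (real (Suc k) * \<alpha> + 1 - \<alpha>) n = - \<mu> * ((- \<mu>) ^ k * nbc (real k * \<alpha> + 1) n)" for k
      by (simp add: algebra_simps)
    have "summable (\<lambda>k. (- \<mu>) ^ Suc k * nbc (real (Suc k) * \<alpha> + 1 - \<alpha>) n)"
      unfolding * by (intro summable_mult sm)
    then have "summable (\<lambda>k. (- \<mu>) ^ k * nbc (real k * \<alpha> + 1 - \<alpha>) n)"
      by (subst (asm) summable_Suc_iff)
    from suminf_split_head[OF this] show ?thesis unfolding * by simp
  qed
  also have "\<dots> = nbc (1 - \<alpha>) n - \<mu> * dml \<mu> n"
    unfolding dml_def by (simp add: suminf_mult[OF sm] suminf_minus[OF summable_mult[OF sm]])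
  finally have "(\<Sum>j<n. dml \<mu> j * nbc (- \<alpha>) (n - j)) + dml \<mu> n = nbc (1 - \<alpha>) n - \<mu> * dml \<mu> n"
    by (simp add: lessThan_Suc_atMost[symmetric])
  then show ?thesis by (simp add: algebra_simps sum_negf)
qed

lemma dml_nonneg: assumes "0 \<le> \<mu>" "\<mu> < 1" shows "dml \<mu> n \<ge> 0"
proof (induction n rule: less_induct)
  case (less n)
  have "0 \<le> nbc (1 - \<alpha>) n + (\<Sum>j<n. - nbc (- \<alpha>) (n - j) * dml \<mu> j)"
    using \<alpha> less by (intro add_nonneg_nonneg nbc_nonneg sum_nonneg mult_nonneg_nonneg jump_weight_nonneg) auto
  then have "0 \<le> (1 + \<mu>) * dml \<mu> n" using dml_renewal[of \<mu> n] assms by simp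
  then show ?case using assms by (simp add: zero_le_mult_iff)
qed

lemma dml_antimono: assumes "0 \<le> \<mu>" "\<mu> \<le> \<nu>" "\<nu> < 1" shows "dml \<nu> n \<le> dml \<mu> n"
proof (induction n rule: less_induct)
  case (less n)
  have "(1 + \<nu>) * dml \<nu> n = nbc (1 - \<alpha>) n + (\<Sum>j<n. - nbc (- \<alpha>) (n - j) * dml \<nu> j)"
    using assms by (intro dml_renewal) auto
  also have "\<dots> \<le> nbc (1 - \<alpha>) n + (\<Sum>j<n. - nbc (- \<alpha>) (n - j) * dml \<mu> j)"
    using less by (intro add_left_mono sum_mono mult_left_mono jump_weight_nonneg) auto
  also have "\<dots> = (1 + \<mu>) * dml \<mu> n" using assms by (intro dml_renewal[symmetric]) auto
  also have "\<dots> \<le> (1 + \<nu>) * dml \<mu> n" using assms by (intro mult_right_mono dml_nonneg) auto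
  finally show ?case using assms by (simp add: mult_le_cancel_left)
qed

lemma dml_log_convex:
  assumes "0 \<le> \<mu>" "\<mu> < 1" "0 \<le> \<nu>" "\<nu> < 1"
  shows "(dml ((\<mu> + \<nu>) / 2) n)\<^sup>2 \<le> dml \<mu> n * dml \<nu> n"
proof (induction n rule: less_induct)
  case (less n)
  let ?m = "(\<mu> + \<nu>) / 2"
  note nn = dml_nonneg[of \<mu>] dml_nonneg[of \<nu>] dml_nonneg[of ?m]
  have sums: "(\<Sum>j<n. - nbc (- \<alpha>) (n - j) * dml ?m j)\<^sup>2
      \<le> (\<Sum>j<n. - nbc (- \<alpha>) (n - j) * dml \<mu> j) * (\<Sum>j<n. - nbc (- \<alpha>) (n - j) * dml \<nu> j)"
    using less nn assms by (intro log_convex_sum jump_weight_nonneg) auto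
  have "((1 + ?m) * dml ?m n)\<^sup>2 \<le> ((1 + \<mu>) * dml \<mu> n) * ((1 + \<nu>) * dml \<nu> n)"
  proof -
    have 1: "(1 + ?m) * dml ?m n = nbc (1 - \<alpha>) n + (\<Sum>j<n. - nbc (- \<alpha>) (n - j) * dml ?m j)"
      using assms by (intro dml_renewal) auto
    have 2: "(1 + \<mu>) * dml \<mu> n = nbc (1 - \<alpha>) n + (\<Sum>j<n. - nbc (- \<alpha>) (n - j) * dml \<mu> j)"
      using assms by (intro dml_renewal) auto
    have 3: "(1 + \<nu>) * dml \<nu> n = nbc (1 - \<alpha>) n + (\<Sum>j<n. - nbc (- \<alpha>) (n - j) * dml \<nu> j)"
      using assms by (intro dml_renewal) auto
    have nonneg: "0 \<le> (\<Sum>j<n. - nbc (- \<alpha>) (n - j) * dml \<mu> j)" "0 \<le> (\<Sum>j<n. - nbc (- \<alpha>) (n - j) * dml \<nu> j)"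
      using nn assms by (intro sum_nonneg mult_nonneg_nonneg jump_weight_nonneg; simp)+
    have "0 \<le> nbc (1 - \<alpha>) n" using \<alpha> by (simp add: nbc_nonneg)
    moreover have "(nbc (1 - \<alpha>) n)\<^sup>2 \<le> nbc (1 - \<alpha>) n * nbc (1 - \<alpha>) n"
      by (simp add: power2_eq_square)
    ultimately show ?thesis unfolding 1 2 3 using nonneg sums by (intro log_convex_add) assumption+
  qed
  moreover have "(1 + \<mu>) * (1 + \<nu>) \<le> (1 + ?m)\<^sup>2"
    using zero_le_power2[of "\<mu> - \<nu>"] by (simp add: power2_eq_square field_simps)
  then have "((1 + \<mu>) * (1 + \<nu>)) * (dml \<mu> n * dml \<nu> n) \<le> (1 + ?m)\<^sup>2 * (dml \<mu> n * dml \<nu> n)"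
    using assms nn by (intro mult_right_mono) auto
  ultimately have "(1 + ?m)\<^sup>2 * (dml ?m n)\<^sup>2 \<le> (1 + ?m)\<^sup>2 * (dml \<mu> n * dml \<nu> n)"
    by (simp add: power_mult_distrib mult_ac)
  moreover have "(1 + ?m)\<^sup>2 > 0" using assms by (intro zero_less_power add_pos_nonneg) auto
  ultimately show ?case using mult_le_cancel_left_pos by blast
qed

text \<open>
  Each term converges by the product formula for the Gamma function. For the interchange of limit
  and sum, \<open>nbc_bound\<close> with \<open>1 - \<rho> = R / n\<close> bounds the \<open>k\<close>-th term by a constant times
  \<open>(x / R\<^sup>\<alpha>)\<^sup>k\<close>, and \<open>R\<close> is at our disposal.
\<close>

lemma dml_limit:
  assumes x: "x \<ge> 0"
  shows "(\<lambda>n. dml (x / real n powr \<alpha>) n) \<longlonglongrightarrow> mittag_leffler \<alpha> 1 (- x)"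
    and mittag_leffler_summable_nonneg: "summable (\<lambda>k. x ^ k / Gamma (real k * \<alpha> + 1))"
proof -
  define R where "R = (x + 1) powr (1 / \<alpha>) + 1"
  have R: "R > 0" unfolding R_def by (simp add: add_nonneg_pos)
  have "x < R powr \<alpha>"
  proof -
    have "x < ((x + 1) powr (1 / \<alpha>)) powr \<alpha>" using x \<alpha> by (simp add: powr_powr)
    also have "\<dots> \<le> R powr \<alpha>" unfolding R_def using \<alpha> by (intro powr_mono2) auto
    finally show ?thesis .
  qed
  define q where "q = x / R powr \<alpha>"
  have q: "0 \<le> q" "q < 1" unfolding q_def using x R \<open>x < R powr \<alpha>\<close> by auto
  define a where "a k n = (- (x / real n powr \<alpha>)) ^ k * nbc (real k * \<alpha> + 1) n" for k n
  define b where "b k = (- x) ^ k / Gamma (real k * \<alpha> + 1)" for k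
  define M where "M k = 2 * exp R * q ^ k" for k
  have lim: "(\<lambda>n. a k n) \<longlonglongrightarrow> b k" for k
  proof -
    have "(\<lambda>n. (- x) ^ k * (nbc (real k * \<alpha> + 1) n / real n powr (real k * \<alpha>))) \<longlonglongrightarrow> (- x) ^ k * (1 / Gamma (real k * \<alpha> + 1))"
      using \<alpha> by (intro tendsto_mult tendsto_const nbc_limit) auto
    moreover have "\<forall>\<^sub>F n in sequentially. (- x) ^ k * (nbc (real k * \<alpha> + 1) n / real n powr (real k * \<alpha>)) = a k n"
      using eventually_gt_at_top[of 0]
    proof eventually_elim
      case (elim n)
      have "real n powr (real k * \<alpha>) = (real n powr \<alpha>) ^ k"
        using elim by (simp add: powr_powr mult.commute flip: powr_realpow)
      then show ?case by (simp add: a_def power_minus[of "x / _"] power_minus[of x] power_divide)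
    qed
    ultimately show ?thesis unfolding b_def by (simp add: tendsto_cong)
  qed
  have ev: "\<forall>\<^sub>F n in sequentially. \<forall>k. norm (a k n) \<le> M k"
  proof -
    have "(\<lambda>n. (1 + (- R) / real n) ^ n) \<longlonglongrightarrow> exp (- R)" by (rule tendsto_exp_limit_sequentially)
    then have "\<forall>\<^sub>F n in sequentially. (1 + (- R) / real n) ^ n > exp (- R) / 2"
      by (rule order_tendstoD(1)) simp
    moreover have "\<forall>\<^sub>F n in sequentially. real n > R"
      using filterlim_real_sequentially by (rule filterlim_at_top_dense[THEN iffD1, rule_format])
    ultimately show ?thesis
    proof eventually_elim
      case (elim n)
      define \<rho> where "\<rho> = 1 - R / real n"
      have n: "real n > 0" using elim R by linarith
      have \<rho>: "0 < \<rho>" "\<rho> < 1" unfolding \<rho>_def using elim R n by (auto simp: field_simps)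
      have "\<rho> ^ n > exp (- R) / 2" using elim unfolding \<rho>_def by simp
      then have inv: "(1 / \<rho>) ^ n \<le> 2 * exp R"
        using \<rho> by (simp add: power_one_over exp_minus field_simps)
      show ?case
      proof
        fix k
        have "(1 - \<rho>) powr (- (real k * \<alpha>)) = (real n / R) powr (real k * \<alpha>)"
          unfolding \<rho>_def using n R by (simp add: powr_minus powr_divide)
        also have "\<dots> = ((real n / R) powr \<alpha>) ^ k"
          using n R by (simp add: powr_powr mult.commute flip: powr_realpow)
        finally have "nbc (real k * \<alpha> + 1) n \<le> (1 / \<rho>) ^ n * ((real n / R) powr \<alpha>) ^ k"
          using nbc_bound[of "real k * \<alpha>" \<rho> n] \<rho> \<alpha> by simp
        also have "\<dots> \<le> 2 * exp R * ((real n / R) powr \<alpha>) ^ k"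
          using inv by (intro mult_right_mono) auto
        finally have nb: "nbc (real k * \<alpha> + 1) n \<le> 2 * exp R * ((real n / R) powr \<alpha>) ^ k" .
        have "norm (a k n) = (x / real n powr \<alpha>) ^ k * nbc (real k * \<alpha> + 1) n"
          unfolding a_def using nbc_nonneg[of "real k * \<alpha> + 1" n] \<alpha> x by (simp add: abs_mult power_abs)
        also have "\<dots> \<le> (x / real n powr \<alpha>) ^ k * (2 * exp R * ((real n / R) powr \<alpha>) ^ k)"
          using nb x by (intro mult_left_mono) auto
        also have "\<dots> = 2 * exp R * ((x / real n powr \<alpha>) * (real n / R) powr \<alpha>) ^ k"
          by (simp only: power_mult_distrib mult_ac)
        also have "(x / real n powr \<alpha>) * (real n / R) powr \<alpha> = q"
          unfolding q_def using n R by (simp add: powr_divide)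
        finally show "norm (a k n) \<le> M k" by (simp add: M_def)
      qed
    qed
  qed
  have bound: "\<forall>\<^sub>F (k, n) in at_top \<times>\<^sub>F sequentially. norm (a k n) \<le> M k"
    using eventually_prod2[OF trivial_limit_at_top_linorder, THEN iffD2, OF ev]
    by (rule eventually_mono) auto
  have sumM: "summable M" unfolding M_def using q by (intro summable_mult summable_geometric) auto
  have T: "summable (\<lambda>k. norm (b k)) \<and> (\<lambda>n. suminf (\<lambda>k. a k n)) \<longlonglongrightarrow> suminf b"
    using tannerys_theorem[OF lim bound sumM sequentially_bot] by blast
  then show "(\<lambda>n. dml (x / real n powr \<alpha>) n) \<longlonglongrightarrow> mittag_leffler \<alpha> 1 (- x)"
    unfolding dml_def mittag_leffler_def a_def b_def by simp
  have "norm (b k) = x ^ k / Gamma (real k * \<alpha> + 1)" for k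
    unfolding b_def using x \<alpha> Gamma_real_pos[of "real k * \<alpha> + 1"] by (simp add: power_abs add_nonneg_pos)
  then show "summable (\<lambda>k. x ^ k / Gamma (real k * \<alpha> + 1))" using T by simp
qed

lemma mittag_leffler_continuous: "continuous_on UNIV (mittag_leffler \<alpha> 1)"
proof (rule continuous_at_imp_continuous_on, rule ballI)
  fix z :: real
  have "summable (\<lambda>k. 1 / Gamma (real k * \<alpha> + 1) * y ^ k)" for y :: real
  proof (rule summable_comparison_test)
    show "summable (\<lambda>k. \<bar>y\<bar> ^ k / Gamma (real k * \<alpha> + 1))" by (rule mittag_leffler_summable_nonneg) simp
    show "\<exists>N. \<forall>n\<ge>N. norm (1 / Gamma (real n * \<alpha> + 1) * y ^ n) \<le> \<bar>y\<bar> ^ n / Gamma (real n * \<alpha> + 1)"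
      using \<alpha> Gamma_real_pos[of "real _ * \<alpha> + 1"] by (auto simp: abs_mult power_abs add_nonneg_pos)
  qed
  from isCont_powser_converges_everywhere[OF this, of z]
  show "isCont (mittag_leffler \<alpha> 1) z" by (simp add: mittag_leffler_def[abs_def])
qed

lemma mittag_leffler_at_0: "mittag_leffler \<alpha> 1 0 = 1"
  unfolding mittag_leffler_def using suminf_finite[of "{0}" "\<lambda>k. 0 ^ k / Gamma (real k * \<alpha> + 1)"] by simp

lemma small_scaled: "\<forall>\<^sub>F n in sequentially. x / real n powr \<alpha> < 1"
proof -
  have "(\<lambda>n. x / real n powr \<alpha>) \<longlonglongrightarrow> 0" using \<alpha> by real_asymp
  then show ?thesis by (rule order_tendstoD(2)) simp
qed

lemma mittag_leffler_antimono:
  assumes "0 \<le> x" "x \<le> y" shows "mittag_leffler \<alpha> 1 (- y) \<le> mittag_leffler \<alpha> 1 (- x)"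
proof (rule tendsto_le[OF sequentially_bot])
  show "\<forall>\<^sub>F n in sequentially. dml (y / real n powr \<alpha>) n \<le> dml (x / real n powr \<alpha>) n"
    using small_scaled[of y] by eventually_elim (use assms in \<open>auto intro!: dml_antimono divide_right_mono\<close>)
qed (use assms in \<open>auto intro!: dml_limit\<close>)

lemma mittag_leffler_nonneg: assumes "0 \<le> x" shows "mittag_leffler \<alpha> 1 (- x) \<ge> 0"
proof (rule tendsto_le[OF sequentially_bot])
  show "\<forall>\<^sub>F n in sequentially. 0 \<le> dml (x / real n powr \<alpha>) n"
    using small_scaled[of x] by eventually_elim (use assms in \<open>auto intro!: dml_nonneg\<close>)
qed (use assms in \<open>auto intro!: dml_limit\<close>)

text \<open>
  A zero at \<open>x\<close> would propagate to \<open>x/2, x/4, \<dots>\<close> by logarithmic convexity and contradict the value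
  \<open>1\<close> at the origin.
\<close>

lemma mittag_leffler_pos: assumes "0 \<le> x" shows "mittag_leffler \<alpha> 1 (- x) > 0"
proof (rule ccontr)
  assume "\<not> ?thesis"
  then have 0: "mittag_leffler \<alpha> 1 (- x) = 0" using mittag_leffler_nonneg[OF assms] by simp
  have half: "mittag_leffler \<alpha> 1 (- (y / 2)) = 0" if "mittag_leffler \<alpha> 1 (- y) = 0" "y \<ge> 0" for y
  proof -
    have "(mittag_leffler \<alpha> 1 (- (y / 2)))\<^sup>2 \<le> mittag_leffler \<alpha> 1 (- 0) * mittag_leffler \<alpha> 1 (- y)"
    proof (rule tendsto_le[OF sequentially_bot])
      show "(\<lambda>n. dml (0 / real n powr \<alpha>) n * dml (y / real n powr \<alpha>) n)
          \<longlonglongrightarrow> mittag_leffler \<alpha> 1 (- 0) * mittag_leffler \<alpha> 1 (- y)"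
        using that by (intro tendsto_mult dml_limit) auto
      show "(\<lambda>n. (dml (y / 2 / real n powr \<alpha>) n)\<^sup>2) \<longlonglongrightarrow> (mittag_leffler \<alpha> 1 (- (y / 2)))\<^sup>2"
        using that by (intro tendsto_power dml_limit) auto
      show "\<forall>\<^sub>F n in sequentially. (dml (y / 2 / real n powr \<alpha>) n)\<^sup>2
          \<le> dml (0 / real n powr \<alpha>) n * dml (y / real n powr \<alpha>) n"
        using small_scaled[of y]
      proof eventually_elim
        case (elim n)
        then show ?case using dml_log_convex[of 0 "y / real n powr \<alpha>" n] that by (simp add: field_simps)
      qed
    qed
    then show ?thesis using that by simp
  qed
  have zero: "mittag_leffler \<alpha> 1 (- (x / 2 ^ n)) = 0" for n
  proof (induction n)
    case (Suc n)
    then show ?case using half[of "x / 2 ^ n"] assms by (simp add: field_simps)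
  qed (use 0 in simp)
  have "(\<lambda>n. - (x / 2 ^ n)) \<longlonglongrightarrow> 0" by real_asymp
  then have "(\<lambda>n. mittag_leffler \<alpha> 1 (- (x / 2 ^ n))) \<longlonglongrightarrow> mittag_leffler \<alpha> 1 0"
    using mittag_leffler_continuous by (auto intro: isCont_tendsto_compose simp: continuous_on_eq_continuous_at)
  then show False unfolding zero mittag_leffler_at_0 by (simp add: LIMSEQ_const_iff)
qed

end


section \<open>Square-integrable functions\<close>

lemma square_integrable_inner:
  assumes "square_integrable M f" "square_integrable M g"
  shows "integrable M (\<lambda>x. f x \<bullet> g x)"
proof (rule Bochner_Integration.integrable_bound)
  show "integrable M (\<lambda>x. (norm (f x))\<^sup>2 + (norm (g x))\<^sup>2)"
    using assms by (auto simp: square_integrable_def)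
  show "(\<lambda>x. f x \<bullet> g x) \<in> borel_measurable M"
    using assms by (auto simp: square_integrable_def)
  have "\<bar>a \<bullet> b\<bar> \<le> (norm a)\<^sup>2 + (norm b)\<^sup>2" for a b :: 'b
  proof -
    have "2 * (norm a * norm b) \<le> (norm a)\<^sup>2 + (norm b)\<^sup>2"
      using sum_squares_bound[of "norm a" "norm b"] by simp
    moreover have "norm a * norm b \<ge> 0" by simp
    ultimately show ?thesis using Cauchy_Schwarz_ineq2[of a b] by linarith
  qed
  then show "AE x in M. norm (f x \<bullet> g x) \<le> norm ((norm (f x))\<^sup>2 + (norm (g x))\<^sup>2)" by simp
qed

lemma square_integrable_zero [simp]: "square_integrable M (\<lambda>x. 0)"
  by (simp add: square_integrable_def)

lemma square_integrable_scale:
  assumes "square_integrable M f" shows "square_integrable M (\<lambda>x. c *\<^sub>R f x)"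
  using assms by (auto simp: square_integrable_def power_mult_distrib)

lemma square_integrable_add:
  assumes f: "square_integrable M f" and g: "square_integrable M g"
  shows "square_integrable M (\<lambda>x. f x + g x)"
  unfolding square_integrable_def
proof
  show "(\<lambda>x. f x + g x) \<in> borel_measurable M" using assms by (auto simp: square_integrable_def)
  have "integrable M (\<lambda>x. (norm (f x))\<^sup>2 + 2 * (f x \<bullet> g x) + (norm (g x))\<^sup>2)"
    using square_integrable_inner[OF f g] f g by (auto simp: square_integrable_def)
  then show "integrable M (\<lambda>x. (norm (f x + g x))\<^sup>2)"
    by (simp add: power2_norm_eq_inner inner_add inner_commute algebra_simps)
qed

lemma square_integrable_minus:
  assumes "square_integrable M f" shows "square_integrable M (\<lambda>x. - f x)"
  using square_integrable_scale[OF assms, of "-1"] by simp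

lemma square_integrable_diff:
  assumes f: "square_integrable M f" and g: "square_integrable M g"
  shows "square_integrable M (\<lambda>x. f x - g x)"
  using square_integrable_add[OF f square_integrable_minus[OF g]] by simp

lemma L2_inner_self_eq_0:
  assumes "square_integrable M f"
  shows "L2_inner M f f = 0 \<longleftrightarrow> (AE x in M. f x = 0)"
  unfolding L2_inner_def
  using integral_nonneg_eq_0_iff_AE[OF square_integrable_inner[OF assms assms]] by simp

lemma L2_inner_commute: "L2_inner M f g = L2_inner M g f"
  by (simp add: L2_inner_def inner_commute)

lemma L2_inner_add_left:
  assumes "square_integrable M f" "square_integrable M g" "square_integrable M h"
  shows "L2_inner M (\<lambda>x. f x + g x) h = L2_inner M f h + L2_inner M g h"
  using square_integrable_inner[OF assms(1,3)] square_integrable_inner[OF assms(2,3)]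
  by (simp add: L2_inner_def inner_add_left)

lemma L2_inner_diff_left:
  assumes "square_integrable M f" "square_integrable M g" "square_integrable M h"
  shows "L2_inner M (\<lambda>x. f x - g x) h = L2_inner M f h - L2_inner M g h"
  using square_integrable_inner[OF assms(1,3)] square_integrable_inner[OF assms(2,3)]
  by (simp add: L2_inner_def inner_diff_left)

lemma L2_inner_diff_right:
  assumes "square_integrable M f" "square_integrable M g" "square_integrable M h"
  shows "L2_inner M h (\<lambda>x. f x - g x) = L2_inner M h f - L2_inner M h g"
  using L2_inner_diff_left[OF assms] by (simp add: L2_inner_commute)

lemma L2_inner_scale_left: "L2_inner M (\<lambda>x. c *\<^sub>R f x) h = c * L2_inner M f h"
  by (simp add: L2_inner_def)

lemma L2_inner_self_nonneg: "L2_inner M f f \<ge> 0" by (simp add: L2_inner_def)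

lemma L2_norm_nonneg: "L2_norm M f \<ge> 0" by (simp add: L2_norm_def L2_inner_self_nonneg)

lemma L2_norm_sq: "(L2_norm M f)\<^sup>2 = L2_inner M f f" by (simp add: L2_norm_def L2_inner_self_nonneg)

lemma L2_norm_minus: "L2_norm M (\<lambda>x. - f x) = L2_norm M f" by (simp add: L2_norm_def L2_inner_def)

lemma L2_norm_diff_commute: "L2_norm M (\<lambda>x. f x - g x) = L2_norm M (\<lambda>x. g x - f x)"
  using L2_norm_minus[of M "\<lambda>x. f x - g x"] by simp

lemma L2_Cauchy_Schwarz:
  assumes f: "square_integrable M f" and g: "square_integrable M g"
  shows "\<bar>L2_inner M f g\<bar> \<le> L2_norm M f * L2_norm M g"
proof -
  define a b c where "a = L2_inner M f f" and "b = L2_inner M f g" and "c = L2_inner M g g"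
  have quad: "0 \<le> a - 2 * t * b + t\<^sup>2 * c" for t
  proof -
    have tg: "square_integrable M (\<lambda>x. t *\<^sub>R g x)" using g by (rule square_integrable_scale)
    have "0 \<le> L2_inner M (\<lambda>x. f x - t *\<^sub>R g x) (\<lambda>x. f x - t *\<^sub>R g x)"
      by (rule L2_inner_self_nonneg)
    also have "\<dots> = a - 2 * t * b + t\<^sup>2 * c"
      unfolding L2_inner_diff_left[OF f tg square_integrable_diff[OF f tg]]
        L2_inner_diff_right[OF f tg f] L2_inner_diff_right[OF f tg tg] a_def b_def c_def
      by (simp add: L2_inner_scale_left L2_inner_commute[of M _ "\<lambda>x. t *\<^sub>R g x"] L2_inner_commute[of M g f]
          power2_eq_square algebra_simps)
    finally show ?thesis .
  qed
  have "b\<^sup>2 \<le> a * c"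
  proof (cases "c = 0")
    case True
    have "b = 0"
    proof (rule ccontr)
      assume "b \<noteq> 0"
      have "0 \<le> a - 2 * ((a + 1) / (2 * b)) * b + ((a + 1) / (2 * b))\<^sup>2 * c" by (rule quad)
      then show False using True \<open>b \<noteq> 0\<close> by simp
    qed
    then show ?thesis using True by simp
  next
    case False
    then have c: "c > 0" using L2_inner_self_nonneg[of M g] by (simp add: c_def)
    have "0 \<le> c * (a - 2 * (b / c) * b + (b / c)\<^sup>2 * c)" using quad[of "b / c"] c by simp
    also have "\<dots> = a * c - b\<^sup>2" using c by (simp add: power2_eq_square field_simps)
    finally show ?thesis by simp
  qed
  then have "\<bar>b\<bar> \<le> sqrt (a * c)" by (intro real_le_rsqrt) simp
  then show ?thesis by (simp add: L2_norm_def real_sqrt_mult a_def b_def c_def)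
qed

lemma L2_norm_triangle:
  assumes f: "square_integrable M f" and g: "square_integrable M g"
  shows "L2_norm M (\<lambda>x. f x + g x) \<le> L2_norm M f + L2_norm M g"
proof (rule power2_le_imp_le)
  have fg: "square_integrable M (\<lambda>x. f x + g x)" using f g by (rule square_integrable_add)
  have "(L2_norm M (\<lambda>x. f x + g x))\<^sup>2 = L2_inner M f f + 2 * L2_inner M f g + L2_inner M g g"
    unfolding L2_norm_sq L2_inner_add_left[OF f g fg] L2_inner_commute[of M f "\<lambda>x. f x + g x"]
      L2_inner_commute[of M g "\<lambda>x. f x + g x"] L2_inner_add_left[OF f g f] L2_inner_add_left[OF f g g]
    by (simp add: L2_inner_commute[of M g f])
  also have "\<dots> \<le> (L2_norm M f + L2_norm M g)\<^sup>2"
    using L2_Cauchy_Schwarz[OF f g] by (simp add: power2_sum L2_norm_sq)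
  finally show "(L2_norm M (\<lambda>x. f x + g x))\<^sup>2 \<le> (L2_norm M f + L2_norm M g)\<^sup>2" .
qed (simp add: L2_norm_nonneg)

lemma L2_tendsto_inner:
  assumes "L2_tendsto M F f" and g: "square_integrable M g"
  shows "(\<lambda>n. L2_inner M (F n) g) \<longlonglongrightarrow> L2_inner M f g"
proof (rule LIM_zero_cancel, rule Lim_null_comparison)
  have sq: "square_integrable M f" "\<And>n. square_integrable M (F n)"
    and lim: "(\<lambda>n. L2_norm M (\<lambda>x. F n x - f x)) \<longlonglongrightarrow> 0" using assms
      by (auto simp: L2_tendsto_def)
  show "\<forall>\<^sub>F n in sequentially. norm (L2_inner M (F n) g - L2_inner M f g) \<le> L2_norm M (\<lambda>x. F n x - f x) * L2_norm M g"
    using L2_Cauchy_Schwarz[OF square_integrable_diff[OF sq(2) sq(1)] g] sq g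
    by (simp add: L2_inner_diff_left)
  show "(\<lambda>n. L2_norm M (\<lambda>x. F n x - f x) * L2_norm M g) \<longlonglongrightarrow> 0"
    using tendsto_mult[OF lim tendsto_const[of "L2_norm M g"]] by simp
qed

lemma L2_tendsto_bounded:
  assumes "L2_tendsto M F f"
  obtains B where "\<And>n. L2_norm M (F n) \<le> B"
proof -
  have sq: "square_integrable M f" "\<And>n. square_integrable M (F n)"
    and lim: "(\<lambda>n. L2_norm M (\<lambda>x. F n x - f x)) \<longlonglongrightarrow> 0" using assms
      by (auto simp: L2_tendsto_def)
  have "Bseq (\<lambda>n. L2_norm M (\<lambda>x. F n x - f x))" using lim
    by (intro convergent_imp_Bseq) (auto simp: convergent_def)
  then obtain K where K: "\<And>n. norm (L2_norm M (\<lambda>x. F n x - f x)) \<le> K" by (auto simp: Bseq_def)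
  have "L2_norm M (F n) \<le> K + L2_norm M f" for n
    using L2_norm_triangle[OF square_integrable_diff[OF sq(2)[of n] sq(1)] sq(1)] K[of n] by simp
  then show ?thesis by (rule that)
qed


section \<open>The Hilbert space of square-integrable functions\<close>

text \<open>
  Functions on the whole space modulo null sets of Lebesgue measure. A type in the class of complete
  inner product spaces makes norms, limits and closures available; functions on a domain \<open>D\<close> enter
  through their extension by zero (\<open>ext_Lsq\<close> below).
\<close>

quotient_type (overloaded) ('a, 'b) Lsq =
  "'a::euclidean_space \<Rightarrow> 'b::euclidean_space" / partial: "\<lambda>f g. square_integrable lebesgue f \<and> square_integrable lebesgue g \<and> (AE x in lebesgue. f x = g x)"
proof (rule part_equivpI)
  show "\<exists>f::'a \<Rightarrow> 'b. square_integrable lebesgue f \<and> square_integrable lebesgue f \<and> (AE x in lebesgue. f x = f x)"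
    by (intro exI[of _ "\<lambda>x. 0"]) auto
  show "symp (\<lambda>f (g::'a \<Rightarrow> 'b). square_integrable lebesgue f \<and> square_integrable lebesgue g \<and> (AE x in lebesgue. f x = g x))"
    by (auto simp: symp_def)
  show "transp (\<lambda>f (g::'a \<Rightarrow> 'b). square_integrable lebesgue f \<and> square_integrable lebesgue g \<and> (AE x in lebesgue. f x = g x))"
    by (rule transpI) (auto elim: eventually_elim2)
qed

instantiation Lsq :: (euclidean_space, euclidean_space) real_inner
begin

lift_definition zero_Lsq :: "('a, 'b) Lsq" is "\<lambda>x. 0" by simp

lift_definition plus_Lsq :: "('a, 'b) Lsq \<Rightarrow> ('a, 'b) Lsq \<Rightarrow> ('a, 'b) Lsq" is "\<lambda>f g x. f x + g x"
  by (auto intro: square_integrable_add)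

lift_definition minus_Lsq :: "('a, 'b) Lsq \<Rightarrow> ('a, 'b) Lsq \<Rightarrow> ('a, 'b) Lsq" is "\<lambda>f g x. f x - g x"
  by (auto intro: square_integrable_diff)

lift_definition uminus_Lsq :: "('a, 'b) Lsq \<Rightarrow> ('a, 'b) Lsq" is "\<lambda>f x. - f x"
  by (auto intro: square_integrable_minus)

lift_definition scaleR_Lsq :: "real \<Rightarrow> ('a, 'b) Lsq \<Rightarrow> ('a, 'b) Lsq" is "\<lambda>c f x. c *\<^sub>R f x"
  by (auto intro: square_integrable_scale)

lift_definition inner_Lsq :: "('a, 'b) Lsq \<Rightarrow> ('a, 'b) Lsq \<Rightarrow> real" is "L2_inner lebesgue"
  unfolding L2_inner_def
proof (rule integral_cong_AE, goal_cases)
  case (3 f f' g g')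
  then have "AE x in lebesgue. f x = f' x" "AE x in lebesgue. g x = g' x" by auto
  then show ?case by eventually_elim simp
qed (auto simp: square_integrable_def)

definition norm_Lsq :: "('a, 'b) Lsq \<Rightarrow> real" where "norm_Lsq v = sqrt (v \<bullet> v)"
definition sgn_Lsq :: "('a, 'b) Lsq \<Rightarrow> ('a, 'b) Lsq" where "sgn_Lsq v = inverse (norm v) *\<^sub>R v"
definition dist_Lsq :: "('a, 'b) Lsq \<Rightarrow> ('a, 'b) Lsq \<Rightarrow> real" where "dist_Lsq v w = norm (v - w)"
definition uniformity_Lsq :: "(('a, 'b) Lsq \<times> ('a, 'b) Lsq) filter"
  where "uniformity_Lsq = (INF e\<in>{0<..}. principal {(x, y). dist x y < e})"
definition open_Lsq :: "('a, 'b) Lsq set \<Rightarrow> bool"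
  where "open_Lsq U = (\<forall>x\<in>U. eventually (\<lambda>(x', y). x' = x \<longrightarrow> y \<in> U) uniformity)"

instance
proof
  fix u v w :: "('a, 'b) Lsq" and a b :: real
  show "u + v + w = u + (v + w)" by transfer (auto intro!: square_integrable_add simp: add.assoc)
  show "u + v = v + u" by transfer (auto intro!: square_integrable_add simp: add.commute)
  show "0 + u = u" by transfer auto
  show "- u + u = 0" by transfer auto
  show "u - v = u + - v" by transfer (auto intro!: square_integrable_diff)
  show "a *\<^sub>R (u + v) = a *\<^sub>R u + a *\<^sub>R v"
    by transfer (auto intro!: square_integrable_add square_integrable_scale simp: scaleR_add_right)
  show "(a + b) *\<^sub>R u = a *\<^sub>R u + b *\<^sub>R u"
    by transfer (auto intro!: square_integrable_add square_integrable_scale simp: scaleR_add_left)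
  show "a *\<^sub>R b *\<^sub>R u = (a * b) *\<^sub>R u" by transfer (auto intro!: square_integrable_scale)
  show "1 *\<^sub>R u = u" by transfer auto
  show "dist u v = norm (u - v)" by (rule dist_Lsq_def)
  show "sgn u = inverse (norm u) *\<^sub>R u" by (rule sgn_Lsq_def)
  show "(uniformity :: (('a, 'b) Lsq \<times> ('a, 'b) Lsq) filter) = (INF e\<in>{0<..}. principal {(x, y). dist x y < e})"
    by (rule uniformity_Lsq_def)
  show "open U = (\<forall>x\<in>U. eventually (\<lambda>(x', y). x' = x \<longrightarrow> y \<in> U) uniformity)"
    for U :: "('a, 'b) Lsq set"
    by (rule open_Lsq_def)
  show "u \<bullet> v = v \<bullet> u" by transfer (simp add: L2_inner_def inner_commute)
  show "(u + v) \<bullet> w = u \<bullet> w + v \<bullet> w"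
    by transfer (auto simp: L2_inner_def inner_add_left square_integrable_inner)
  show "(a *\<^sub>R u) \<bullet> v = a * (u \<bullet> v)" by transfer (auto simp: L2_inner_def)
  show "0 \<le> u \<bullet> u" by transfer (auto simp: L2_inner_def)
  show "u \<bullet> u = 0 \<longleftrightarrow> u = 0"
    by transfer (auto simp: L2_inner_self_eq_0)
  show "norm u = sqrt (u \<bullet> u)" by (rule norm_Lsq_def)
qed

end

lemma ennreal_term_le_suminf: "a k \<le> (\<Sum>k. a k)" for a :: "nat \<Rightarrow> ennreal"
  using sum_le_suminf[OF summableI, of "{k}" a] by simp

lemma fast_Cauchy_subseq:
  fixes X :: "nat \<Rightarrow> 'v::metric_space"
  assumes "Cauchy X" and e: "\<And>k. e k > 0"
  obtains r :: "nat \<Rightarrow> nat" where "strict_mono r" "\<And>k. dist (X (r (Suc k))) (X (r k)) < e k"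
proof -
  have "\<exists>N. \<forall>m\<ge>N. \<forall>n\<ge>N. dist (X m) (X n) < e k" for k
    using metric_CauchyD[OF assms(1) e] by blast
  then obtain N where N: "\<And>k m n. m \<ge> N k \<Longrightarrow> n \<ge> N k \<Longrightarrow> dist (X m) (X n) < e k" by metis
  define r where "r = rec_nat (N 0) (\<lambda>k rk. max (Suc rk) (N (Suc k)))"
  have r: "r 0 = N 0" "\<And>k. r (Suc k) = max (Suc (r k)) (N (Suc k))" by (auto simp: r_def)
  have ge: "r k \<ge> N k" for k by (cases k) (auto simp: r)
  have less: "r k < r (Suc k)" for k by (simp add: r)
  have "dist (X (r (Suc k))) (X (r k)) < e k" for k
    using N[of k "r (Suc k)" "r k"] ge[of k] less[of k] by simp
  then show ?thesis using less by (intro that[of r]) (auto simp: strict_mono_Suc_iff)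
qed

lemma norm_Lsq_abs:
  assumes "square_integrable lebesgue f"
  shows "(norm (abs_Lsq f))\<^sup>2 = (\<integral>x. (norm (f x))\<^sup>2 \<partial>lebesgue)"
  unfolding power2_norm_eq_inner using assms
  by (subst inner_Lsq.abs_eq) (auto simp: L2_inner_def)

lemma Lsq_cases:
  fixes v :: "('a::euclidean_space, 'b::euclidean_space) Lsq"
  obtains f where "square_integrable lebesgue f" "v = abs_Lsq f"
proof -
  have "\<exists>f. square_integrable lebesgue f \<and> v = abs_Lsq f" by (induct v rule: Lsq.abs_induct) auto
  then show ?thesis using that by blast
qed

lemma diff_abs_Lsq:
  assumes "square_integrable lebesgue f" "square_integrable lebesgue g"
  shows "abs_Lsq f - abs_Lsq g = abs_Lsq (\<lambda>x. f x - g x)"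
  using assms by (simp add: minus_Lsq.abs_eq)

text \<open>
  The Riesz--Fischer theorem. Along a subsequence with \<open>\<parallel>X\<^sub>k\<^sub>+\<^sub>1 - X\<^sub>k\<parallel> < 4\<^sup>-\<^sup>k\<close>, the integral of
  \<open>\<Sum> 4\<^sup>k |f\<^sub>k\<^sub>+\<^sub>1 - f\<^sub>k|\<^sup>2\<close> is finite, so the increments are pointwise \<open>O(2\<^sup>-\<^sup>k)\<close> almost everywhere.
  The pointwise limit is the limit in norm by Fatou's lemma.
\<close>

instance Lsq :: (euclidean_space, euclidean_space) complete_space
proof
  fix X :: "nat \<Rightarrow> ('a, 'b) Lsq" assume X: "Cauchy X"
  obtain r :: "nat \<Rightarrow> nat" where r: "strict_mono r"
    and fast: "\<And>k. dist (X (r (Suc k))) (X (r k)) < (1/4) ^ k"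
    using fast_Cauchy_subseq[OF X, of "\<lambda>k. (1/4) ^ k"] by auto
  have "\<exists>f. square_integrable lebesgue f \<and> X (r k) = abs_Lsq f" for k by (metis Lsq_cases)
  then obtain f where sq: "\<And>k. square_integrable lebesgue (f k)" and Xf: "\<And>k. X (r k) = abs_Lsq (f k)"
    by metis
  have [measurable]: "f k \<in> borel_measurable lebesgue" for k using sq by (simp add: square_integrable_def)
  have norm_diff: "(dist (X (r i)) (X (r j)))\<^sup>2 = (\<integral>x. (norm (f i x - f j x))\<^sup>2 \<partial>lebesgue)" for i j
    unfolding dist_norm Xf diff_abs_Lsq[OF sq sq] by (rule norm_Lsq_abs[OF square_integrable_diff[OF sq sq]])
  have int_diff: "integrable lebesgue (\<lambda>x. (norm (f i x - f j x))\<^sup>2)" for i j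
    using square_integrable_diff[OF sq sq] by (auto simp: square_integrable_def)
  have nn_diff: "(\<integral>\<^sup>+x. ennreal ((norm (f i x - f j x))\<^sup>2) \<partial>lebesgue) = ennreal ((dist (X (r i)) (X (r j)))\<^sup>2)" for i j
    unfolding norm_diff by (rule nn_integral_eq_integral[OF int_diff]) auto
  have "(\<integral>\<^sup>+x. (\<Sum>k. ennreal (4 ^ k * (norm (f (Suc k) x - f k x))\<^sup>2)) \<partial>lebesgue)
      = (\<Sum>k. \<integral>\<^sup>+x. ennreal (4 ^ k * (norm (f (Suc k) x - f k x))\<^sup>2) \<partial>lebesgue)"
    by (rule nn_integral_suminf) measurable
  also have "\<dots> \<le> (\<Sum>k. ennreal ((1/4) ^ k))"
  proof (rule suminf_le)
    fix k
    have "(\<integral>\<^sup>+x. ennreal (4 ^ k * (norm (f (Suc k) x - f k x))\<^sup>2) \<partial>lebesgue)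
        = ennreal (4 ^ k) * ennreal ((dist (X (r (Suc k))) (X (r k)))\<^sup>2)"
      unfolding nn_diff[symmetric] by (subst nn_integral_cmult[symmetric]) (auto simp: ennreal_mult)
    also have "\<dots> = ennreal (4 ^ k * (dist (X (r (Suc k))) (X (r k)))\<^sup>2)"
      by (simp add: ennreal_mult)
    also have "\<dots> \<le> ennreal (4 ^ k * ((1/4) ^ k)\<^sup>2)"
      using fast[of k] by (intro ennreal_leI mult_left_mono power_mono) auto
    also have "4 ^ k * ((1/4) ^ k)\<^sup>2 = ((1/4) ^ k :: real)"
      by (simp add: power2_eq_square power_one_over field_simps)
    finally show "(\<integral>\<^sup>+x. ennreal (4 ^ k * (norm (f (Suc k) x - f k x))\<^sup>2) \<partial>lebesgue) \<le> ennreal ((1/4) ^ k)" .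
  qed auto
  also have "\<dots> = ennreal (\<Sum>k. (1/4) ^ k)"
    by (rule suminf_ennreal_eq) (auto intro!: summable_sums summable_geometric)
  also have "\<dots> < \<infinity>" by simp
  finally have "AE x in lebesgue. (\<Sum>k. ennreal (4 ^ k * (norm (f (Suc k) x - f k x))\<^sup>2)) \<noteq> \<infinity>"
    by (intro nn_integral_PInf_AE) auto
  then have conv: "AE x in lebesgue. convergent (\<lambda>k. f k x)"
  proof eventually_elim
    case (elim x)
    define B where "B = enn2real (\<Sum>k. ennreal (4 ^ k * (norm (f (Suc k) x - f k x))\<^sup>2))"
    have "norm (f (Suc k) x - f k x) \<le> sqrt B * (1/2) ^ k" for k
    proof -
      have "ennreal (4 ^ k * (norm (f (Suc k) x - f k x))\<^sup>2) \<le> (\<Sum>k. ennreal (4 ^ k * (norm (f (Suc k) x - f k x))\<^sup>2))"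
        by (rule ennreal_term_le_suminf)
      also have "\<dots> = ennreal B" unfolding B_def using elim by (simp add: top.not_eq_extremum)
      finally have "4 ^ k * (norm (f (Suc k) x - f k x))\<^sup>2 \<le> B"
        by (subst (asm) ennreal_le_iff) (auto simp: B_def)
      moreover have "(2 ^ k)\<^sup>2 = (4 ^ k :: real)" by (simp add: power2_eq_square flip: power_mult_distrib)
      ultimately have "(2 ^ k * norm (f (Suc k) x - f k x))\<^sup>2 \<le> B"
        by (simp only: power_mult_distrib)
      then have "2 ^ k * norm (f (Suc k) x - f k x) \<le> sqrt B" by (rule real_le_rsqrt)
      then show ?thesis by (simp add: field_simps power_one_over)
    qed
    then have "summable (\<lambda>k. f (Suc k) x - f k x)"
      by (intro summable_comparison_test[OF _ summable_mult[OF summable_geometric[of "1/2"]]]) auto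
    then have "convergent (\<lambda>n. \<Sum>k<n. f (Suc k) x - f k x)" by (simp add: summable_iff_convergent)
    then have "convergent (\<lambda>n. f n x - f 0 x)"
      by (simp only: sum_lessThan_telescope[of "\<lambda>k. f k x"])
    then have "convergent (\<lambda>n. (f n x - f 0 x) + f 0 x)" by (intro convergent_add convergent_const)
    then show ?case by simp
  qed
  define g where "g x = lim (\<lambda>k. f k x)" for x
  have [measurable]: "g \<in> borel_measurable lebesgue"
    unfolding g_def by (rule borel_measurable_lim_metric) measurable
  have lim: "AE x in lebesgue. (\<lambda>k. f k x) \<longlonglongrightarrow> g x"
    using conv by eventually_elim (simp add: g_def convergent_LIMSEQ_iff)
  have fatou: "(\<integral>\<^sup>+x. ennreal ((norm (g x - f j x))\<^sup>2) \<partial>lebesgue) \<le> ennreal (\<epsilon>\<^sup>2)"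
    if e: "\<And>i. i \<ge> N \<Longrightarrow> dist (X (r i)) (X (r j)) \<le> \<epsilon>" for j N \<epsilon>
  proof -
    have "(\<integral>\<^sup>+x. ennreal ((norm (g x - f j x))\<^sup>2) \<partial>lebesgue)
        = (\<integral>\<^sup>+x. liminf (\<lambda>i. ennreal ((norm (f i x - f j x))\<^sup>2)) \<partial>lebesgue)"
    proof (rule nn_integral_cong_AE, use lim in eventually_elim)
      case (elim x)
      have "(\<lambda>i. ennreal ((norm (f i x - f j x))\<^sup>2)) \<longlonglongrightarrow> ennreal ((norm (g x - f j x))\<^sup>2)"
        by (intro tendsto_intros elim)
      then show ?case using lim_imp_Liminf[OF sequentially_bot] by metis
    qed
    also have "\<dots> \<le> liminf (\<lambda>i. \<integral>\<^sup>+x. ennreal ((norm (f i x - f j x))\<^sup>2) \<partial>lebesgue)"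
      by (rule nn_integral_liminf) measurable
    also have "\<dots> \<le> ennreal (\<epsilon>\<^sup>2)"
    proof (rule Liminf_le)
      show "\<forall>\<^sub>F i in sequentially. (\<integral>\<^sup>+x. ennreal ((norm (f i x - f j x))\<^sup>2) \<partial>lebesgue) \<le> ennreal (\<epsilon>\<^sup>2)"
        unfolding nn_diff using e by (auto simp: eventually_sequentially intro!: exI[of _ N] ennreal_leI power_mono)
    qed simp
    finally show ?thesis .
  qed
  have Cr: "Cauchy (\<lambda>k. X (r k))" using Cauchy_subseq_Cauchy[OF X r] by (simp add: o_def)
  have int: "square_integrable lebesgue (\<lambda>x. g x - f j x)"
    if e: "\<And>i. i \<ge> N \<Longrightarrow> dist (X (r i)) (X (r j)) \<le> \<epsilon>" for j N \<epsilon>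
  proof -
    have "(\<integral>\<^sup>+x. ennreal ((norm (g x - f j x))\<^sup>2) \<partial>lebesgue) < \<infinity>"
      using fatou[OF e] by (auto simp: less_top[symmetric] top_unique)
    then show ?thesis unfolding square_integrable_def by (auto simp: integrable_iff_bounded)
  qed
  obtain N1 where N1: "\<And>i. i \<ge> N1 \<Longrightarrow> dist (X (r i)) (X (r N1)) \<le> 1"
    using metric_CauchyD[OF Cr, of 1] by (auto intro: less_imp_le)
  have "square_integrable lebesgue (\<lambda>x. (g x - f N1 x) + f N1 x)"
    by (rule square_integrable_add[OF int[of N1, OF N1] sq])
  then have sqg: "square_integrable lebesgue g" by simp
  have "(\<lambda>k. X (r k)) \<longlonglongrightarrow> abs_Lsq g"
  proof (rule metric_LIMSEQ_I)
    fix e :: real assume "e > 0"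
    then obtain N where N: "\<And>i j. i \<ge> N \<Longrightarrow> j \<ge> N \<Longrightarrow> dist (X (r i)) (X (r j)) < e / 2"
      using metric_CauchyD[OF Cr, of "e/2"] by auto
    have "dist (X (r j)) (abs_Lsq g) < e" if j: "j \<ge> N" for j
    proof -
      have "dist (X (r i)) (X (r j)) \<le> e/2" if "i \<ge> N" for i using N[OF that j] by simp
      note * = this
      have "ennreal ((dist (abs_Lsq g) (X (r j)))\<^sup>2) = ennreal (\<integral>x. (norm (g x - f j x))\<^sup>2 \<partial>lebesgue)"
        unfolding dist_norm Xf diff_abs_Lsq[OF sqg sq]
        by (simp add: norm_Lsq_abs[OF square_integrable_diff[OF sqg sq]])
      also have "\<dots> = (\<integral>\<^sup>+x. ennreal ((norm (g x - f j x))\<^sup>2) \<partial>lebesgue)"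
        using square_integrable_diff[OF sqg sq] by (intro nn_integral_eq_integral[symmetric]) (auto simp: square_integrable_def)
      also have "\<dots> \<le> ennreal ((e/2)\<^sup>2)" by (rule fatou[of N]) (rule *)
      finally have "(dist (abs_Lsq g) (X (r j)))\<^sup>2 \<le> (e/2)\<^sup>2" by simp
      then show ?thesis unfolding dist_commute[of _ "abs_Lsq g"] using \<open>e > 0\<close> power2_le_imp_le[of _ "e/2"]
        by fastforce
    qed
    then show "\<exists>N. \<forall>n\<ge>N. dist (X (r n)) (abs_Lsq g) < e" by blast
  qed
  then show "convergent X" using Cauchy_converges_subseq[OF X r] by (auto simp: convergent_def o_def)
qed


section \<open>Eigenvectors of a compactly embedded form\<close>

text \<open>
  The graph \<open>V\<close> of the gradient on \<open>H\<^sub>0\<^sup>1\<close> in abstract form: a closed subspace of pairs (function,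
  gradient). The last assumption expresses compactness of the embedding \<open>v \<mapsto> v\<close> from the gradient
  norm to the ambient norm without any sequence: up to a small multiple of the gradient norm, \<open>v\<close> is
  controlled by finitely many linear functionals.
\<close>

locale compact_form =
  fixes V :: "('h::{real_inner,complete_space} \<times> 'g::{real_inner,complete_space}) set" and C :: real
  assumes subspace: "subspace V" and closed: "closed V" and C_pos: "C > 0"
    and poincare: "\<And>v d. (v, d) \<in> V \<Longrightarrow> (norm v)\<^sup>2 \<le> C * (norm d)\<^sup>2"
    and finite_rank: "\<And>\<epsilon>. \<epsilon> > 0 \<Longrightarrow> \<exists>E. finite E \<and>
          (\<forall>(v, d)\<in>V. (norm v)\<^sup>2 \<le> \<epsilon> * (norm d)\<^sup>2 + (\<Sum>e\<in>E. (v \<bullet> e)\<^sup>2))"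
begin

text \<open>
  The weak Poisson problem. The energy \<open>\<parallel>d\<parallel>\<^sup>2 - 2 (w, v)\<close> is bounded below
    by the Poincare inequality,
  a minimising sequence is Cauchy by the parallelogram law, and the Euler--Lagrange equation of
  the minimiser is the assertion.
\<close>

lemma energy_minimiser: "\<exists>v d. (v, d) \<in> V \<and> (\<forall>(\<psi>, e)\<in>V. d \<bullet> e = w \<bullet> \<psi>)"
proof -
  define Q where "Q p = (norm (snd p))\<^sup>2 - 2 * (w \<bullet> fst p)" for p :: "'h \<times> 'g"
  have lower: "Q p \<ge> - (C * (norm w)\<^sup>2)" if "p \<in> V" for p
  proof -
    obtain v d where p: "p = (v, d)" by (cases p)
    have 1: "(norm v)\<^sup>2 / C \<le> (norm d)\<^sup>2"
      using poincare[of v d] that p C_pos by (simp add: field_simps)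
    have "0 \<le> (norm (C *\<^sub>R w - v))\<^sup>2 / C" using C_pos by simp
    also have "\<dots> = C * (norm w)\<^sup>2 - 2 * (w \<bullet> v) + (norm v)\<^sup>2 / C"
      using C_pos unfolding power2_norm_eq_inner
      by (simp add: inner_diff field_simps inner_commute)
    finally show ?thesis using 1 unfolding Q_def p by simp
  qed
  define m where "m = Inf (Q ` V)"
  have bdd: "bdd_below (Q ` V)" using lower by (auto intro!: bdd_belowI)
  have ne: "V \<noteq> {}" using subspace_0[OF subspace] by auto
  have m_le: "m \<le> Q p" if "p \<in> V" for p
    unfolding m_def using bdd that by (auto intro: cInf_lower)
  have "\<exists>p\<in>V. Q p < m + 1 / Suc n" for n
  proof -
    have "m < m + 1 / Suc n" by simp
    then show ?thesis using ne bdd unfolding m_def by (subst (asm) cInf_less_iff) auto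
  qed
  then obtain p where pV: "\<And>n. p n \<in> V" and pm: "\<And>n. Q (p n) < m + 1 / Suc n" by metis
  have diffV: "p i - p j \<in> V" for i j using pV subspace_diff[OF subspace] by blast
  have grad: "(norm (snd (p i - p j)))\<^sup>2 \<le> 2 / Suc i + 2 / Suc j" for i j
  proof -
    let ?q = "(1/2) *\<^sub>R (p i + p j)"
    have "?q \<in> V" using pV subspace_add[OF subspace] subspace_scale[OF subspace] by blast
    then have "m \<le> Q ?q" by (rule m_le)
    moreover have "(norm (snd (p i - p j)))\<^sup>2 = 2 * Q (p i) + 2 * Q (p j) - 4 * Q ?q"
      unfolding Q_def power2_norm_eq_inner
      by (simp add: algebra_simps inner_add inner_diff inner_commute)
    ultimately show ?thesis using pm[of i] pm[of j] by linarith
  qed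
  have dist: "(norm (p i - p j))\<^sup>2 \<le> (1 + C) * (2 / Suc i + 2 / Suc j)" for i j
  proof -
    have "(norm (p i - p j))\<^sup>2 = (norm (fst (p i - p j)))\<^sup>2 + (norm (snd (p i - p j)))\<^sup>2"
      by (simp add: norm_prod_def)
    also have "\<dots> \<le> (1 + C) * (norm (snd (p i - p j)))\<^sup>2"
    proof -
      have "(fst (p i - p j), snd (p i - p j)) \<in> V" using diffV[of i j] by (simp only: prod.collapse)
      from poincare[OF this] show ?thesis by (simp only: distrib_right mult_1 add.commute add_le_cancel_right)
    qed
    also have "\<dots> \<le> (1 + C) * (2 / Suc i + 2 / Suc j)"
      using grad[of i j] C_pos by (intro mult_left_mono) auto
    finally show ?thesis .
  qed
  have "Cauchy p"
  proof (rule metric_CauchyI)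
    fix e :: real assume e: "e > 0"
    have "(\<lambda>i. (1 + C) * (2 / real (Suc i))) \<longlonglongrightarrow> (1 + C) * 0"
      by (intro tendsto_mult tendsto_const) real_asymp
    then have "\<forall>\<^sub>F i in sequentially. (1 + C) * (2 / real (Suc i)) < e\<^sup>2 / 2"
      using e by (intro order_tendstoD(2)[of _ "(1 + C) * 0"]) auto
    then obtain N where N: "\<And>i. i \<ge> N \<Longrightarrow> (1 + C) * (2 / real (Suc i)) < e\<^sup>2 / 2"
      by (auto simp: eventually_sequentially)
    have "dist (p i) (p j) < e" if "i \<ge> N" "j \<ge> N" for i j
    proof -
      have "(norm (p i - p j))\<^sup>2 < e\<^sup>2"
        using dist[of i j] N[OF that(1)] N[OF that(2)] unfolding distrib_left by linarith
      then show ?thesis using e by (simp add: dist_norm power_less_imp_less_base)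
    qed
    then show "\<exists>M. \<forall>m\<ge>M. \<forall>n\<ge>M. dist (p m) (p n) < e" by blast
  qed
  then obtain q where q: "p \<longlonglongrightarrow> q" by (auto simp: Cauchy_convergent_iff convergent_def)
  have qV: "q \<in> V" using closed_sequentially[OF closed _ q] pV by blast
  have Q_lim: "(\<lambda>n. Q (p n)) \<longlonglongrightarrow> Q q" unfolding Q_def using q by (intro tendsto_intros)
  have m_lim: "(\<lambda>n. m + 1 / Suc n) \<longlonglongrightarrow> m" by real_asymp
  have Qq: "Q q \<le> m"
    by (rule tendsto_le[OF sequentially_bot m_lim Q_lim]) (intro always_eventually allI less_imp_le pm)
  have "snd q \<bullet> e = w \<bullet> \<psi>" if "(\<psi>, e) \<in> V" for \<psi> e
  proof (rule ccontr)
    assume ne: "snd q \<bullet> e \<noteq> w \<bullet> \<psi>"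
    define b where "b = snd q \<bullet> e - w \<bullet> \<psi>"
    define n where "n = (norm e)\<^sup>2 + 1"
    have n: "n > 0" unfolding n_def by (simp add: add_nonneg_pos)
    have expand: "Q (q + t *\<^sub>R (\<psi>, e)) = Q q + 2 * t * b + t\<^sup>2 * (norm e)\<^sup>2" for t
      unfolding Q_def power2_norm_eq_inner b_def
      by (simp add: algebra_simps inner_add inner_diff inner_commute power2_eq_square)
    \<comment> \<open>The step \<open>t = - b / n\<close> lowers the energy; \<open>n\<close> exceeds \<open>\<parallel>e\<parallel>\<^sup>2\<close> by one so as not to vanish.\<close>
    let ?t = "- b / n"
    have "q + ?t *\<^sub>R (\<psi>, e) \<in> V"
      using qV that subspace_add[OF subspace] subspace_scale[OF subspace] by blast
    then have "Q q \<le> Q (q + ?t *\<^sub>R (\<psi>, e))" using m_le Qq by fastforce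
    also have "\<dots> = Q q + 2 * ?t * b + ?t\<^sup>2 * (norm e)\<^sup>2" by (rule expand)
    finally have "0 \<le> 2 * ?t * b + ?t\<^sup>2 * (norm e)\<^sup>2" by simp
    also have "\<dots> \<le> 2 * ?t * b + ?t\<^sup>2 * n" unfolding n_def by (simp add: algebra_simps)
    also have "\<dots> = - b\<^sup>2 / n" using n by (simp add: field_simps power2_eq_square)
    also have "\<dots> < 0" using n ne unfolding b_def by simp
    finally show False by simp
  qed
  then show ?thesis using qV by (intro exI[of _ "fst q"] exI[of _ "snd q"]) auto
qed

text \<open>
  The solution operator: \<open>K\<close> is the inverse of the operator associated with the form, and \<open>dK w\<close> is
  the gradient of \<open>K w\<close>.
\<close>

definition sol :: "'h \<Rightarrow> 'h \<times> 'g" where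
  "sol w = (SOME p. p \<in> V \<and> (\<forall>(\<psi>, e)\<in>V. snd p \<bullet> e = w \<bullet> \<psi>))"

abbreviation "K w \<equiv> fst (sol w)"
abbreviation "dK w \<equiv> snd (sol w)"

lemma sol: "sol w \<in> V" "\<And>\<psi> e. (\<psi>, e) \<in> V \<Longrightarrow> dK w \<bullet> e = w \<bullet> \<psi>"
proof -
  have "\<exists>p. p \<in> V \<and> (\<forall>(\<psi>, e)\<in>V. snd p \<bullet> e = w \<bullet> \<psi>)"
    using energy_minimiser[of w] by auto
  then have "sol w \<in> V \<and> (\<forall>(\<psi>, e)\<in>V. snd (sol w) \<bullet> e = w \<bullet> \<psi>)"
    unfolding sol_def by (rule someI_ex)
  then show "sol w \<in> V" "\<And>\<psi> e. (\<psi>, e) \<in> V \<Longrightarrow> dK w \<bullet> e = w \<bullet> \<psi>" by auto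
qed

lemma sol_pair: "(K w, dK w) \<in> V" using sol(1)[of w] by simp

lemma inner_K: "K w \<bullet> w' = dK w \<bullet> dK w'"
  using sol(2)[OF sol_pair, of w' w] by (simp add: inner_commute)

lemma K_nonneg: "K w \<bullet> w \<ge> 0" by (simp add: inner_K)

lemma norm_dK: "(norm (dK w))\<^sup>2 = K w \<bullet> w" by (simp add: inner_K power2_norm_eq_inner)

lemma norm_K: "norm (K w) \<le> C * norm w"
proof -
  have "(norm (K w))\<^sup>2 \<le> C * (K w \<bullet> w)" using poincare[OF sol_pair, of w] by (simp add: norm_dK)
  also have "\<dots> \<le> C * (norm (K w) * norm w)"
    using C_pos by (intro mult_left_mono norm_cauchy_schwarz) auto
  finally have "norm (K w) * norm (K w) \<le> norm (K w) * (C * norm w)"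
    by (simp add: power2_eq_square mult_ac)
  then show ?thesis using C_pos by (cases "K w = 0") (auto simp: mult_le_cancel_left)
qed

lemma sol_unique: assumes "p \<in> V" "\<And>\<psi> e. (\<psi>, e) \<in> V \<Longrightarrow> snd p \<bullet> e = w \<bullet> \<psi>" shows "p = sol w"
proof -
  let ?q = "p - sol w"
  have q: "(fst ?q, snd ?q) \<in> V" using subspace_diff[OF subspace assms(1) sol(1)] by (simp only: prod.collapse)
  have "snd ?q \<bullet> snd ?q = snd p \<bullet> snd ?q - dK w \<bullet> snd ?q" by (metis inner_diff_left snd_diff)
  also have "\<dots> = 0" by (simp only: assms(2)[OF q] sol(2)[OF q] diff_self)
  finally have "snd ?q \<bullet> snd ?q = 0" .
  then have "snd ?q = 0" by simp
  moreover have "fst ?q = 0" using poincare[OF q] calculation by simp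
  ultimately show ?thesis by (simp add: prod_eq_iff)
qed

lemma K_diff: "K (w - w') = K w - K w'"
proof -
  have "sol w - sol w' = sol (w - w')"
    by (rule sol_unique) (auto simp: subspace_diff[OF subspace] sol inner_diff)
  then show ?thesis by (metis fst_diff)
qed

lemma K_scale: "K (c *\<^sub>R w) = c *\<^sub>R K w"
proof -
  have "c *\<^sub>R sol w = sol (c *\<^sub>R w)"
    by (rule sol_unique) (auto simp: subspace_scale[OF subspace] sol)
  then show ?thesis by (metis fst_scaleR)
qed

text \<open>
  For a fixed tolerance the finitely many functionals converge along a subsequence, which makes the
  sequence Cauchy up to that tolerance; a diagonal argument removes the tolerance.
\<close>

lemma compact_embedding:
  assumes V: "\<And>n. (v n, d n) \<in> V" and bound: "\<And>n. norm (d n) \<le> A"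
  obtains r :: "nat \<Rightarrow> nat" where "strict_mono r" "Cauchy (v \<circ> r)"
proof -
  define P where "P k r \<longleftrightarrow> (\<exists>N. \<forall>i\<ge>N. \<forall>j\<ge>N. (norm (v (r i) - v (r j)))\<^sup>2 < 1 / Suc k)"
    for k and r :: "nat \<Rightarrow> nat"
  have A: "A \<ge> 0" using bound[of 0] norm_ge_zero order_trans by blast
  have coord: "\<exists>r::nat\<Rightarrow>nat. strict_mono r \<and> (\<forall>e\<in>E. convergent (\<lambda>n. v (s (r n)) \<bullet> e))" if "finite E"
    for E and s :: "nat \<Rightarrow> nat"
    using that
  proof (induction E)
    case empty show ?case by (intro exI[of _ id]) (auto simp: strict_mono_def)
  next
    case (insert e E)
    then obtain r where r: "strict_mono r" "\<forall>e\<in>E. convergent (\<lambda>n. v (s (r n)) \<bullet> e)" by blast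
    have "bounded (range (\<lambda>n. v (s (r n)) \<bullet> e))"
    proof (rule boundedI)
      fix y assume "y \<in> range (\<lambda>n. v (s (r n)) \<bullet> e)"
      then obtain n where n: "y = v (s (r n)) \<bullet> e" by blast
      let ?k = "s (r n)"
      have "(norm (v ?k))\<^sup>2 \<le> C * A\<^sup>2"
        using poincare[OF V, of ?k] bound[of ?k] C_pos A
        by (smt (verit) mult_left_mono norm_ge_zero power_mono)
      then have "norm (v ?k) \<le> sqrt (C * A\<^sup>2)" by (rule real_le_rsqrt)
      then show "norm y \<le> sqrt (C * A\<^sup>2) * norm e"
        unfolding n using Cauchy_Schwarz_ineq2[of "v ?k" e]
        by (smt (verit) mult_right_mono norm_ge_zero real_norm_def)
    qed
    then obtain l q where q: "strict_mono q" "((\<lambda>n. v (s (r n)) \<bullet> e) \<circ> q) \<longlonglongrightarrow> l"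
      using bounded_imp_convergent_subsequence by blast
    have "convergent (\<lambda>n. v (s ((r \<circ> q) n)) \<bullet> e')" if "e' \<in> insert e E" for e'
    proof (cases "e' = e")
      case True then show ?thesis using q(2) by (auto simp: convergent_def o_def)
    next
      case False
      then have "convergent (\<lambda>n. v (s (r n)) \<bullet> e')" using that r by auto
      then show ?thesis using convergent_subseq_convergent[OF _ q(1)] by (auto simp: o_def)
    qed
    then show ?case using strict_mono_o[OF r(1) q(1)] by blast
  qed
  have ex: "\<exists>r. strict_mono r \<and> P k (s \<circ> r)" for k and s :: "nat \<Rightarrow> nat"
  proof -
    define \<epsilon> where "\<epsilon> = 1 / (2 * Suc k * (4 * A\<^sup>2 + 1))"
    have pos: "4 * A\<^sup>2 + 1 > 0" by (simp add: add_nonneg_pos)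
    have \<epsilon>: "\<epsilon> > 0" unfolding \<epsilon>_def using pos by simp
    obtain E where E: "finite E" "\<And>v d. (v, d)\<in>V \<Longrightarrow> (norm v)\<^sup>2 \<le> \<epsilon> * (norm d)\<^sup>2 + (\<Sum>e\<in>E. (v \<bullet> e)\<^sup>2)"
      using finite_rank[OF \<epsilon>] by auto
    obtain r where r: "strict_mono r" "\<And>e. e \<in> E \<Longrightarrow> convergent (\<lambda>n. v (s (r n)) \<bullet> e)"
      using coord[OF E(1), of s] by blast
    then obtain l where l: "\<And>e. e \<in> E \<Longrightarrow> (\<lambda>n. v (s (r n)) \<bullet> e) \<longlonglongrightarrow> l e"
      unfolding convergent_def by metis
    define \<eta> where "\<eta> = 1 / (8 * Suc k)"
    have "(\<lambda>n. \<Sum>e\<in>E. (v (s (r n)) \<bullet> e - l e)\<^sup>2) \<longlonglongrightarrow> (\<Sum>e\<in>E. (l e - l e)\<^sup>2)"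
      by (intro tendsto_intros l)
    then have "\<forall>\<^sub>F n in sequentially. (\<Sum>e\<in>E. (v (s (r n)) \<bullet> e - l e)\<^sup>2) < \<eta>"
      by (rule order_tendstoD(2)) (simp add: \<eta>_def)
    then obtain N where N: "\<And>n. n \<ge> N \<Longrightarrow> (\<Sum>e\<in>E. (v (s (r n)) \<bullet> e - l e)\<^sup>2) < \<eta>"
      by (auto simp: eventually_sequentially)
    have "(norm (v (s (r i)) - v (s (r j))))\<^sup>2 < 1 / Suc k" if ij: "i \<ge> N" "j \<ge> N" for i j
    proof -
      let ?i = "s (r i)" and ?j = "s (r j)"
      have mem: "(v ?i - v ?j, d ?i - d ?j) \<in> V" using subspace_diff[OF subspace V V, of ?i ?j] by simp
      have "norm (d ?i - d ?j) \<le> 2 * A"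
        using norm_triangle_ineq4[of "d ?i" "d ?j"] bound[of ?i] bound[of ?j] by linarith
      then have "(norm (d ?i - d ?j))\<^sup>2 \<le> (2 * A)\<^sup>2" by (rule power_mono) simp
      then have "\<epsilon> * (norm (d ?i - d ?j))\<^sup>2 \<le> \<epsilon> * (4 * A\<^sup>2)"
        using \<epsilon> by (intro mult_left_mono) (auto simp: power_mult_distrib)
      also have "\<dots> < \<epsilon> * (4 * A\<^sup>2 + 1)" using \<epsilon> by simp
      also have "\<dots> = 1 / (2 * Suc k)"
        unfolding \<epsilon>_def using pos by simp
      finally have 1: "\<epsilon> * (norm (d ?i - d ?j))\<^sup>2 < 1 / (2 * Suc k)" .
      have "(\<Sum>e\<in>E. ((v ?i - v ?j) \<bullet> e)\<^sup>2) \<le> (\<Sum>e\<in>E. 2 * (v ?i \<bullet> e - l e)\<^sup>2 + 2 * (v ?j \<bullet> e - l e)\<^sup>2)"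
      proof (rule sum_mono)
        fix e assume "e \<in> E"
        have "2 * (x - l e)\<^sup>2 + 2 * (y - l e)\<^sup>2 - (x - y)\<^sup>2 = ((x - l e) + (y - l e))\<^sup>2" for x y :: real
          by (simp add: power2_eq_square algebra_simps)
        from this[of "v ?i \<bullet> e" "v ?j \<bullet> e"]
        show "((v ?i - v ?j) \<bullet> e)\<^sup>2 \<le> 2 * (v ?i \<bullet> e - l e)\<^sup>2 + 2 * (v ?j \<bullet> e - l e)\<^sup>2"
          unfolding inner_diff_left by (smt (verit) zero_le_power2)
      qed
      also have "\<dots> < 4 * \<eta>"
        using N[OF ij(1)] N[OF ij(2)] by (simp add: sum.distrib flip: sum_distrib_left)
      finally have 2: "(\<Sum>e\<in>E. ((v ?i - v ?j) \<bullet> e)\<^sup>2) < 1 / (2 * Suc k)" unfolding \<eta>_def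
        by (simp add: divide_simps algebra_simps)
      have half: "1 / real (2 * Suc k) + 1 / real (2 * Suc k) = 1 / real (Suc k)" by (simp add: divide_simps)
      show ?thesis using le_less_trans[OF E(2)[OF mem] add_strict_mono[OF 1 2]] unfolding half .
    qed
    then show ?thesis using r(1) unfolding P_def by auto
  qed
  interpret S: subseqs P using ex by unfold_locales auto
  have diag: "P k (S.diagseq \<circ> (+) (Suc k))" for k
  proof (rule S.diagseq_holds)
    fix n r and s :: "nat \<Rightarrow> nat"
    assume s: "strict_mono s" and "P n r"
    then obtain N where N: "\<forall>i\<ge>N. \<forall>j\<ge>N. (norm (v (r i) - v (r j)))\<^sup>2 < 1 / Suc n"
      unfolding P_def by blast
    have "s i \<ge> N" if "i \<ge> N" for i using seq_suble[OF s, of i] that by linarith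
    then show "P n (r \<circ> s)" unfolding P_def using N by (intro exI[of _ N]) auto
  qed
  have "Cauchy (v \<circ> S.diagseq)"
  proof (rule metric_CauchyI)
    fix e :: real assume e: "e > 0"
    obtain k where k: "1 / Suc k < e\<^sup>2" using nat_approx_posE[of "e\<^sup>2"] e by auto
    obtain N where N: "\<forall>i\<ge>N. \<forall>j\<ge>N. (norm (v ((S.diagseq \<circ> (+) (Suc k)) i) - v ((S.diagseq \<circ> (+) (Suc k)) j)))\<^sup>2 < 1 / Suc k"
      using diag[of k] unfolding P_def by blast
    have "dist ((v \<circ> S.diagseq) i) ((v \<circ> S.diagseq) j) < e" if "i \<ge> N + Suc k" "j \<ge> N + Suc k" for i j
    proof -
      have "(norm (v (S.diagseq i) - v (S.diagseq j)))\<^sup>2 < 1 / Suc k"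
        using N[rule_format, of "i - Suc k" "j - Suc k"] that by simp
      then have "(norm (v (S.diagseq i) - v (S.diagseq j)))\<^sup>2 < e\<^sup>2" using k by simp
      then show ?thesis using e by (simp add: dist_norm power_less_imp_less_base)
    qed
    then show "\<exists>M. \<forall>m\<ge>M. \<forall>n\<ge>M. dist ((v \<circ> S.diagseq) m) ((v \<circ> S.diagseq) n) < e" by blast
  qed
  then show ?thesis using that S.subseq_diagseq by blast
qed

text \<open>
  The orthogonal complement \<open>X\<close> of a set of eigenvectors is invariant under the compact symmetric
  positive operator \<open>K\<close>,
    and \<open>K\<close> does not vanish on \<open>X\<close> because of \<open>w\<close>. Hence the supremum \<open>M\<close> of
  \<open>(K x, x)\<close> over the unit ball of \<open>X\<close> is positive and is attained at an eigenvector. For a maximising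
  sequence, \<open>\<parallel>K x\<parallel>\<^sup>2 \<le> M (K x, x)\<close> gives \<open>K x\<^sub>n - M x\<^sub>n \<rightarrow> 0\<close>, and compactness supplies the limit.
\<close>

lemma eigenvector_orthogonal:
  assumes \<Phi>: "\<And>\<phi>. \<phi> \<in> \<Phi> \<Longrightarrow> \<exists>d \<mu>. (\<phi>, d) \<in> V \<and> (\<forall>(\<psi>, e)\<in>V. d \<bullet> e = \<mu> * (\<phi> \<bullet> \<psi>))"
    and w: "\<And>\<phi>. \<phi> \<in> \<Phi> \<Longrightarrow> w \<bullet> \<phi> = 0"
    and test: "(\<psi>\<^sub>0, e\<^sub>0) \<in> V" "w \<bullet> \<psi>\<^sub>0 \<noteq> 0"
  shows "\<exists>v d \<mu>. (v, d) \<in> V \<and> v \<noteq> 0 \<and> (\<forall>(\<psi>, e)\<in>V. d \<bullet> e = \<mu> * (v \<bullet> \<psi>)) \<and> (\<forall>\<phi>\<in>\<Phi>. v \<bullet> \<phi> = 0)"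
proof -
  define X where "X = {x. \<forall>\<phi>\<in>\<Phi>. x \<bullet> \<phi> = 0}"
  have X_scale: "c *\<^sub>R x \<in> X" if "x \<in> X" for c x using that by (auto simp: X_def)
  have X_closed: "closed X"
  proof -
    have "X = (\<Inter>\<phi>\<in>\<Phi>. {x. x \<bullet> \<phi> = 0})" by (auto simp: X_def)
    then show ?thesis by (auto intro!: closed_INT closed_Collect_eq continuous_intros)
  qed
  have KX: "K x \<in> X" if "x \<in> X" for x
    unfolding X_def
  proof (rule CollectI, rule ballI)
    fix \<phi> assume \<phi>: "\<phi> \<in> \<Phi>"
    obtain d \<mu> where d: "(\<phi>, d) \<in> V" "\<And>\<psi> e. (\<psi>, e)\<in>V \<Longrightarrow> d \<bullet> e = \<mu> * (\<phi> \<bullet> \<psi>)"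
      using \<Phi>[OF \<phi>] by fast
    have "dK x \<bullet> d = 0" using sol(2)[OF d(1), of x] that \<phi> by (simp add: X_def)
    then have 0: "\<mu> * (\<phi> \<bullet> K x) = 0" using d(2)[OF sol_pair, of x] by (simp add: inner_commute)
    show "K x \<bullet> \<phi> = 0"
    proof (cases "\<mu> = 0")
      case True
      then have "d \<bullet> d = 0" using d(2)[OF d(1)] by simp
      then have "\<phi> = 0" using poincare[OF d(1)] by simp
      then show ?thesis by simp
    next
      case False
      then show ?thesis using 0 by (simp add: inner_commute)
    qed
  qed
  define M where "M = (SUP x\<in>X \<inter> cball 0 1. K x \<bullet> x)"
  have quad_bound: "K x \<bullet> x \<le> C" if "norm x \<le> 1" for x
  proof -
    have "K x \<bullet> x \<le> norm (K x) * norm x" by (rule norm_cauchy_schwarz)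
    also have "\<dots> \<le> (C * norm x) * norm x" by (intro mult_right_mono norm_K) auto
    also have "\<dots> \<le> C * 1"
      using C_pos mult_left_le_one_le[of "norm x" "norm x"] that
      by (simp only: mult.assoc, intro mult_left_mono) auto
    finally show ?thesis by simp
  qed
  have bdd: "bdd_above ((\<lambda>x. K x \<bullet> x) ` (X \<inter> cball 0 1))" using quad_bound by (auto intro!: bdd_aboveI)
  have M_upper: "K x \<bullet> x \<le> M * (norm x)\<^sup>2" if "x \<in> X" for x
  proof (cases "x = 0")
    case False
    let ?y = "(1 / norm x) *\<^sub>R x"
    have "?y \<in> X \<inter> cball 0 1" using that False X_scale by auto
    then have "K ?y \<bullet> ?y \<le> M" unfolding M_def using bdd by (intro cSUP_upper) auto
    then show ?thesis using False by (simp add: K_scale power2_eq_square field_simps)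
  qed simp
  have wX: "w \<in> X" using w by (simp add: X_def)
  have "dK w \<noteq> 0" using sol(2)[OF test(1), of w] test(2) by auto
  then have "K w \<bullet> w > 0" using norm_dK[of w] by (metis norm_eq_zero zero_less_power2)
  then have "0 < M * (norm w)\<^sup>2" using M_upper[OF wX] by linarith
  then have M_pos: "M > 0" by (simp add: zero_less_mult_iff)
  have K_sq: "(norm (K x))\<^sup>2 \<le> M * (K x \<bullet> x)" if "x \<in> X" for x
  proof -
    \<comment> \<open>The Cauchy--Schwarz inequality for the form \<open>(K x, y)\<close>, applied to \<open>x\<close> and \<open>K x\<close>.\<close>
    have "K x \<bullet> K x = dK x \<bullet> dK (K x)" by (simp only: inner_K)
    then have "(norm (K x))\<^sup>2 \<le> norm (dK x) * norm (dK (K x))"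
      by (metis norm_cauchy_schwarz power2_norm_eq_inner)
    then have "((norm (K x))\<^sup>2)\<^sup>2 \<le> (norm (dK x))\<^sup>2 * (norm (dK (K x)))\<^sup>2"
      by (metis power_mono power_mult_distrib zero_le_power2)
    also have "\<dots> = (K x \<bullet> x) * (K (K x) \<bullet> K x)" by (simp add: norm_dK)
    also have "\<dots> \<le> (K x \<bullet> x) * (M * (norm (K x))\<^sup>2)"
      using M_upper[OF KX[OF that]] K_nonneg by (intro mult_left_mono) auto
    finally have "(norm (K x))\<^sup>2 * (norm (K x))\<^sup>2 \<le> (M * (K x \<bullet> x)) * (norm (K x))\<^sup>2"
      by (simp add: power2_eq_square mult_ac)
    then show ?thesis
    proof (cases "K x = 0")
      case False then show ?thesis
        using \<open>(norm (K x))\<^sup>2 * (norm (K x))\<^sup>2 \<le> _\<close>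
          by (intro mult_right_le_imp_le[of "(norm (K x))\<^sup>2" "(norm (K x))\<^sup>2"]) auto
    qed simp
  qed
  have "\<exists>x\<in>X. norm x = 1 \<and> M - 1 / Suc n < K x \<bullet> x \<or> (norm x \<le> 1 \<and> M - 1 / Suc n < K x \<bullet> x)" for n
  proof -
    have "M - 1 / Suc n < M" by simp
    then show ?thesis unfolding M_def using bdd wX X_scale[of w 0]
      by (subst (asm) less_cSUP_iff) auto
  qed
  then have "\<exists>x\<in>X. norm x \<le> 1 \<and> M - 1 / Suc n < K x \<bullet> x" for n by force
  then obtain x where xX: "\<And>n. x n \<in> X" and x1: "\<And>n. norm (x n) \<le> 1"
    and xM: "\<And>n. M - 1 / Suc n < K (x n) \<bullet> x n" by metis
  have dK_bound: "norm (dK (x n)) \<le> sqrt C" for n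
    using norm_dK[of "x n"] quad_bound[OF x1, of n] by (intro real_le_rsqrt) simp
  from compact_embedding[where v="\<lambda>n. K (x n)" and d="\<lambda>n. dK (x n)", OF sol_pair dK_bound]
  obtain r :: "nat \<Rightarrow> nat" where r: "strict_mono r" "Cauchy ((\<lambda>n. K (x n)) \<circ> r)" .
  then obtain z where z: "(\<lambda>n. K (x (r n))) \<longlonglongrightarrow> z"
    by (auto simp: Cauchy_convergent_iff convergent_def o_def)
  have "(norm (K (x n) - M *\<^sub>R x n))\<^sup>2 \<le> M / Suc n" for n
  proof -
    have "(norm (K (x n) - M *\<^sub>R x n))\<^sup>2 = (norm (K (x n)))\<^sup>2 - 2 * M * (K (x n) \<bullet> x n) + M\<^sup>2 * (norm (x n))\<^sup>2"
      unfolding power2_norm_eq_inner by (simp add: inner_diff inner_commute power2_eq_square algebra_simps)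
    also have "\<dots> \<le> M * (K (x n) \<bullet> x n) - 2 * M * (K (x n) \<bullet> x n) + M\<^sup>2 * 1"
      using K_sq[OF xX, of n] x1[of n] M_pos
      by (intro add_mono diff_mono mult_left_mono) (auto simp: power_le_one)
    also have "\<dots> = M * (M - K (x n) \<bullet> x n)" by (simp add: power2_eq_square algebra_simps)
    also have "\<dots> \<le> M * (1 / Suc n)" using xM[of n] M_pos by (intro mult_left_mono) auto
    finally show ?thesis by simp
  qed
  then have "norm (K (x n) - M *\<^sub>R x n) \<le> sqrt (M / Suc n)" for n by (rule real_le_rsqrt)
  moreover have "(\<lambda>n. sqrt (M / Suc n)) \<longlonglongrightarrow> 0" using M_pos by real_asymp
  ultimately have "(\<lambda>n. K (x n) - M *\<^sub>R x n) \<longlonglongrightarrow> 0"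
    by (intro Lim_null_comparison[of "\<lambda>n. K (x n) - M *\<^sub>R x n" "\<lambda>n. sqrt (M / Suc n)" sequentially]
        always_eventually allI)
  from LIMSEQ_subseq_LIMSEQ[OF this r(1)]
  have "(\<lambda>n. (1 / M) *\<^sub>R (K (x (r n)) - (K (x (r n)) - M *\<^sub>R x (r n)))) \<longlonglongrightarrow> (1 / M) *\<^sub>R (z - 0)"
    by (intro tendsto_scaleR tendsto_const tendsto_diff z) (simp add: o_def)
  then have lim: "(\<lambda>n. x (r n)) \<longlonglongrightarrow> (1 / M) *\<^sub>R z" using M_pos by simp
  let ?y = "(1 / M) *\<^sub>R z"
  have "(\<lambda>n. K (x (r n)) - K ?y) \<longlonglongrightarrow> 0"
  proof (rule Lim_null_comparison)
    show "\<forall>\<^sub>F n in sequentially. norm (K (x (r n)) - K ?y) \<le> C * norm (x (r n) - ?y)"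
      using norm_K[of "x (r _) - ?y"] by (simp only: K_diff) simp
    have "(\<lambda>n. C * norm (x (r n) - ?y)) \<longlonglongrightarrow> C * norm (?y - ?y)"
      by (intro tendsto_intros lim)
    then show "(\<lambda>n. C * norm (x (r n) - ?y)) \<longlonglongrightarrow> 0" by simp
  qed
  then have Ky: "(\<lambda>n. K (x (r n))) \<longlonglongrightarrow> K ?y" by (simp add: LIM_zero_iff)
  then have "K ?y = z" using z LIMSEQ_unique by blast
  have yX: "?y \<in> X" using closed_sequentially[OF X_closed _ lim] xX by blast
  have "(\<lambda>n. K (x (r n)) \<bullet> x (r n)) \<longlonglongrightarrow> K ?y \<bullet> ?y" by (intro tendsto_intros Ky lim)
  moreover have "(\<lambda>n. M - 1 / Suc n) \<longlonglongrightarrow> M" by real_asymp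
  from LIMSEQ_subseq_LIMSEQ[OF this r(1)] have "(\<lambda>n. M - 1 / Suc (r n)) \<longlonglongrightarrow> M"
    by (simp only: o_def)
  ultimately have "M \<le> K ?y \<bullet> ?y"
    by (rule tendsto_le[OF sequentially_bot]) (intro always_eventually allI less_imp_le xM)
  then have "?y \<noteq> 0" using M_pos by (metis inner_zero_right not_le)
  then have z0: "z \<noteq> 0" by auto
  have zX: "z \<in> X" using KX[OF yX] \<open>K ?y = z\<close> by simp
  show ?thesis
  proof (intro exI conjI ballI)
    \<comment> \<open>Here \<open>z = M y\<close>, so the eigenvalue of the form is \<open>1 / M\<close>.\<close>
    show "(z, dK ?y) \<in> V" using sol_pair[of ?y] \<open>K ?y = z\<close> by simp
    show "case p of (\<psi>, e) \<Rightarrow> dK ?y \<bullet> e = (1 / M) * (z \<bullet> \<psi>)" if "p \<in> V" for p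
      using sol(2)[of "fst p" "snd p" ?y] that by (simp add: case_prod_beta)
    show "z \<bullet> \<phi> = 0" if "\<phi> \<in> \<Phi>" for \<phi> using zX that by (auto simp: X_def)
  qed (rule z0)
qed

end

lemma subspace_closure_real_normed:
  fixes V :: "'v::real_normed_vector set"
  assumes "subspace V"
  shows "subspace (closure V)"
  unfolding subspace_def
proof (intro conjI ballI allI)
  show "0 \<in> closure V" using subspace_0[OF assms] closure_subset by blast
next
  fix x y assume "x \<in> closure V" "y \<in> closure V"
  then obtain X Y where "\<And>n. X n \<in> V" "X \<longlonglongrightarrow> x" "\<And>n. Y n \<in> V" "Y \<longlonglongrightarrow> y"
    unfolding closure_sequential by metis
  then show "x + y \<in> closure V"
    unfolding closure_sequential
    by (intro exI[of _ "\<lambda>n. X n + Y n"]) (auto intro: tendsto_add subspace_add[OF assms])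
next
  fix x c assume "x \<in> closure V"
  then obtain X where "\<And>n. X n \<in> V" "X \<longlonglongrightarrow> x" unfolding closure_sequential by metis
  then show "c *\<^sub>R x \<in> closure V"
    unfolding closure_sequential
    by (intro exI[of _ "\<lambda>n. c *\<^sub>R X n"]) (auto intro: tendsto_scaleR subspace_scale[OF assms])
qed

lemma compact_form_closure:
  fixes V :: "('h::{real_inner,complete_space} \<times> 'g::{real_inner,complete_space}) set"
  assumes "subspace V" "C > 0"
    and P: "\<And>v d. (v, d) \<in> V \<Longrightarrow> (norm v)\<^sup>2 \<le> C * (norm d)\<^sup>2"
    and R: "\<And>\<epsilon>. \<epsilon> > 0 \<Longrightarrow> \<exists>E. finite E \<and>
          (\<forall>(v, d)\<in>V. (norm v)\<^sup>2 \<le> \<epsilon> * (norm d)\<^sup>2 + (\<Sum>e\<in>E. (v \<bullet> e)\<^sup>2))"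
  shows "compact_form (closure V) C"
proof
  show "subspace (closure V)" using assms(1) by (rule subspace_closure_real_normed)
  have ext: "g p \<ge> 0" if "continuous_on UNIV g" "\<And>p. p \<in> V \<Longrightarrow> g p \<ge> 0" "p \<in> closure V"
    for g :: "'h \<times> 'g \<Rightarrow> real" and p
  proof -
    have "closure V \<subseteq> {p. g p \<ge> 0}"
      using that by (intro closure_minimal closed_Collect_le) (auto intro: continuous_intros)
    then show ?thesis using that by auto
  qed
  show "(norm v)\<^sup>2 \<le> C * (norm d)\<^sup>2" if "(v, d) \<in> closure V" for v d
  proof -
    have "continuous_on UNIV (\<lambda>p::'h \<times> 'g. C * (norm (snd p))\<^sup>2 - (norm (fst p))\<^sup>2)"
      by (intro continuous_intros)
    from ext[OF this _ that] P show ?thesis by auto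
  qed
  show "\<exists>E. finite E \<and> (\<forall>(v, d)\<in>closure V. (norm v)\<^sup>2 \<le> \<epsilon> * (norm d)\<^sup>2 + (\<Sum>e\<in>E. (v \<bullet> e)\<^sup>2))"
    if pos: "\<epsilon> > 0" for \<epsilon>
  proof -
    obtain E where E: "finite E"
      "\<And>v d. (v, d) \<in> V \<Longrightarrow> (norm v)\<^sup>2 \<le> \<epsilon> * (norm d)\<^sup>2 + (\<Sum>e\<in>E. (v \<bullet> e)\<^sup>2)"
      using R[OF pos] by fast
    have "(norm v)\<^sup>2 \<le> \<epsilon> * (norm d)\<^sup>2 + (\<Sum>e\<in>E. (v \<bullet> e)\<^sup>2)"
      if "(v, d) \<in> closure V" for v d
    proof -
      have "continuous_on UNIV
          (\<lambda>p::'h \<times> 'g. \<epsilon> * (norm (snd p))\<^sup>2 + (\<Sum>e\<in>E. (fst p \<bullet> e)\<^sup>2) - (norm (fst p))\<^sup>2)"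
        by (intro continuous_intros)
      from ext[OF this _ that] E(2) show ?thesis by auto
    qed
    then show ?thesis using E(1) by auto
  qed
qed (use assms in auto)


section \<open>Test functions, the Poincare inequality and compactness\<close>

definition ext_Lsq :: "'a::euclidean_space set \<Rightarrow> ('a \<Rightarrow> 'b::euclidean_space) \<Rightarrow> ('a, 'b) Lsq" where
  "ext_Lsq D f = abs_Lsq (\<lambda>x. indicator D x *\<^sub>R f x)"

context
  fixes D :: "'a::euclidean_space set"
  assumes D: "D \<in> sets lebesgue"
begin

lemma square_integrable_on_iff:
  "square_integrable (lebesgue_on D) f \<longleftrightarrow> square_integrable lebesgue (\<lambda>x. indicator D x *\<^sub>R f x)"
proof -
  have *: "(norm (indicator D x *\<^sub>R f x))\<^sup>2 = indicator D x *\<^sub>R (norm (f x))\<^sup>2" for x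
    by (simp add: indicator_def)
  show ?thesis unfolding square_integrable_def *
    using D by (simp add: borel_measurable_restrict_space_iff integrable_restrict_space)
qed

lemma inner_ext_Lsq:
  assumes "square_integrable (lebesgue_on D) f" "square_integrable (lebesgue_on D) g"
  shows "ext_Lsq D f \<bullet> ext_Lsq D g = L2_inner (lebesgue_on D) f g"
proof -
  have "ext_Lsq D f \<bullet> ext_Lsq D g = L2_inner lebesgue (\<lambda>x. indicator D x *\<^sub>R f x) (\<lambda>x. indicator D x *\<^sub>R g x)"
    unfolding ext_Lsq_def using assms[unfolded square_integrable_on_iff] by (subst inner_Lsq.abs_eq) auto
  also have "\<dots> = L2_inner (lebesgue_on D) f g"
    unfolding L2_inner_def using D
    by (subst integral_restrict_space) (auto intro!: Bochner_Integration.integral_cong simp: indicator_def)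
  finally show ?thesis .
qed

lemma norm_ext_Lsq: "square_integrable (lebesgue_on D) f \<Longrightarrow> norm (ext_Lsq D f) = L2_norm (lebesgue_on D) f"
  by (simp add: norm_eq_sqrt_inner inner_ext_Lsq L2_norm_def)

lemma ext_Lsq_diff:
  assumes "square_integrable (lebesgue_on D) f" "square_integrable (lebesgue_on D) g"
  shows "ext_Lsq D (\<lambda>x. f x - g x) = ext_Lsq D f - ext_Lsq D g"
  unfolding ext_Lsq_def using assms[unfolded square_integrable_on_iff]
  by (simp add: diff_abs_Lsq scaleR_diff_right)

lemma ext_Lsq_add:
  assumes "square_integrable (lebesgue_on D) f" "square_integrable (lebesgue_on D) g"
  shows "ext_Lsq D (\<lambda>x. f x + g x) = ext_Lsq D f + ext_Lsq D g"
  unfolding ext_Lsq_def using assms[unfolded square_integrable_on_iff]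
  by (simp add: plus_Lsq.abs_eq scaleR_add_right)

lemma ext_Lsq_scale:
  assumes "square_integrable (lebesgue_on D) f"
  shows "ext_Lsq D (\<lambda>x. c *\<^sub>R f x) = c *\<^sub>R ext_Lsq D f"
  unfolding ext_Lsq_def using assms[unfolded square_integrable_on_iff]
  by (simp add: scaleR_Lsq.abs_eq mult.commute)

lemma ext_Lsq_tendsto:
  assumes "L2_tendsto (lebesgue_on D) F f"
  shows "(\<lambda>n. ext_Lsq D (F n)) \<longlonglongrightarrow> ext_Lsq D f"
proof (rule LIM_zero_cancel, rule tendsto_norm_zero_cancel)
  have sq: "square_integrable (lebesgue_on D) f" "\<And>n. square_integrable (lebesgue_on D) (F n)"
    and lim: "(\<lambda>n. L2_norm (lebesgue_on D) (\<lambda>x. F n x - f x)) \<longlonglongrightarrow> 0"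
    using assms by (auto simp: L2_tendsto_def)
  show "(\<lambda>n. norm (ext_Lsq D (F n) - ext_Lsq D f)) \<longlonglongrightarrow> 0"
    using lim by (simp add: ext_Lsq_diff[OF sq(2) sq(1), symmetric] norm_ext_Lsq square_integrable_diff sq)
qed

text \<open>
  The functions vanishing outside \<open>D\<close> form a closed subspace.
\<close>

lemma ext_Lsq_limitE:
  assumes sq: "\<And>n. square_integrable (lebesgue_on D) (F n)"
    and Z: "(\<lambda>n. ext_Lsq D (F n)) \<longlonglongrightarrow> Z"
  obtains f where "L2_tendsto (lebesgue_on D) F f" "Z = ext_Lsq D f"
proof -
  obtain z where z: "square_integrable lebesgue z" "Z = abs_Lsq z" by (rule Lsq_cases)
  have zD: "square_integrable (lebesgue_on D) z"
    unfolding square_integrable_on_iff unfolding square_integrable_def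
  proof
    show m: "(\<lambda>x. indicator D x *\<^sub>R z x) \<in> borel_measurable lebesgue"
      using z(1) D by (auto simp: square_integrable_def)
    show "integrable lebesgue (\<lambda>x. (norm (indicator D x *\<^sub>R z x))\<^sup>2)"
    proof (rule Bochner_Integration.integrable_bound)
      show "integrable lebesgue (\<lambda>x. (norm (z x))\<^sup>2)" using z(1) by (simp add: square_integrable_def)
      show "(\<lambda>x. (norm (indicator D x *\<^sub>R z x))\<^sup>2) \<in> borel_measurable lebesgue" using m by measurable
    qed (auto simp: indicator_def)
  qed
  note sq' = sq[unfolded square_integrable_on_iff]
  have le: "L2_norm (lebesgue_on D) (\<lambda>x. F n x - z x) \<le> norm (ext_Lsq D (F n) - Z)" for n
  proof (rule power2_le_imp_le)
    have d: "square_integrable lebesgue (\<lambda>x. indicator D x *\<^sub>R F n x - z x)"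
      by (rule square_integrable_diff[OF sq' z(1)])
    have d': "square_integrable (lebesgue_on D) (\<lambda>x. F n x - z x)"
      by (rule square_integrable_diff[OF sq zD])
    have "(L2_norm (lebesgue_on D) (\<lambda>x. F n x - z x))\<^sup>2
        = (\<integral>x. (norm (indicator D x *\<^sub>R (F n x - z x)))\<^sup>2 \<partial>lebesgue)"
      unfolding norm_ext_Lsq[OF d', symmetric] ext_Lsq_def
      by (rule norm_Lsq_abs) (use d' in \<open>simp only: square_integrable_on_iff\<close>)
    also have "\<dots> \<le> (\<integral>x. (norm (indicator D x *\<^sub>R F n x - z x))\<^sup>2 \<partial>lebesgue)"
    proof (rule integral_mono)
      show "integrable lebesgue (\<lambda>x. (norm (indicator D x *\<^sub>R (F n x - z x)))\<^sup>2)"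
        using d' unfolding square_integrable_on_iff by (simp add: square_integrable_def)
      show "integrable lebesgue (\<lambda>x. (norm (indicator D x *\<^sub>R F n x - z x))\<^sup>2)"
        using d by (simp add: square_integrable_def)
    qed (auto simp: indicator_def)
    also have "\<dots> = (norm (ext_Lsq D (F n) - Z))\<^sup>2"
      unfolding ext_Lsq_def z(2) diff_abs_Lsq[OF sq' z(1)] norm_Lsq_abs[OF d] ..
    finally show "(L2_norm (lebesgue_on D) (\<lambda>x. F n x - z x))\<^sup>2 \<le> (norm (ext_Lsq D (F n) - Z))\<^sup>2" .
  qed simp
  have "(\<lambda>n. norm (ext_Lsq D (F n) - Z)) \<longlonglongrightarrow> 0"
    using Z by (simp add: LIM_zero tendsto_norm_zero)
  then have "(\<lambda>n. L2_norm (lebesgue_on D) (\<lambda>x. F n x - z x)) \<longlonglongrightarrow> 0"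
    by (rule Lim_null_comparison[rotated]) (use le in \<open>simp add: L2_norm_nonneg\<close>)
  then have lim: "L2_tendsto (lebesgue_on D) F z" using sq zD by (simp add: L2_tendsto_def)
  then show ?thesis using that LIMSEQ_unique[OF Z ext_Lsq_tendsto[OF lim]] by blast
qed

lemma ext_Lsq_eq_0_iff:
  assumes "square_integrable (lebesgue_on D) f"
  shows "ext_Lsq D f = 0 \<longleftrightarrow> (AE x in lebesgue_on D. f x = 0)"
  using inner_ext_Lsq[OF assms assms] L2_inner_self_eq_0[OF assms] by (metis inner_eq_zero_iff)

end


lemma C1c_continuous: "C1c D \<psi> d\<psi> \<Longrightarrow> continuous_on UNIV \<psi>"
  unfolding C1c_def gderiv_def by (auto intro!: continuous_at_imp_continuous_on has_derivative_continuous)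

lemma C1c_gradient_continuous: "C1c D \<psi> d\<psi> \<Longrightarrow> continuous_on UNIV d\<psi>"
  by (simp add: C1c_def)

lemma C1c_support:
  assumes "C1c D \<psi> d\<psi>"
  obtains K where "compact K" "K \<subseteq> D" "\<And>x. x \<notin> K \<Longrightarrow> \<psi> x = 0" "\<And>x. x \<notin> K \<Longrightarrow> d\<psi> x = 0"
proof -
  let ?K = "closure {x. \<psi> x \<noteq> 0}"
  have z: "\<psi> x = 0" if "x \<notin> ?K" for x using closure_subset[of "{x. \<psi> x \<noteq> 0}"] that by auto
  have "d\<psi> x = 0" if "x \<notin> ?K" for x
  proof -
    have 1: "(\<psi> has_derivative (\<lambda>h. h \<bullet> d\<psi> x)) (at x)" using assms by (simp add: C1c_def gderiv_def)
    have "((\<lambda>x. 0::real) has_derivative (\<lambda>h. 0)) (at x)" by (rule has_derivative_const)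
    then have "(\<psi> has_derivative (\<lambda>h. 0)) (at x)"
    proof (rule has_derivative_transform_within_open[where s="- ?K"])
      show "open (- ?K)" by (rule open_Compl[OF closed_closure])
      show "x \<in> - ?K" using that by (simp only: Compl_iff not_False_eq_True)
      show "0 = \<psi> y" if "y \<in> - ?K" for y using z[of y] that by (metis Compl_iff)
    qed
    from has_derivative_unique[OF 1 this] have "d\<psi> x \<bullet> d\<psi> x = 0" by meson
    then show ?thesis by simp
  qed
  then have dz: "d\<psi> x = 0" if "x \<notin> ?K" for x using that by blast
  have "compact ?K" "?K \<subseteq> D" using assms by (simp_all only: C1c_def)
  then show ?thesis using z dz by (rule that)
qed

lemma compact_support_square_integrable:
  fixes f :: "'a::euclidean_space \<Rightarrow> 'b::euclidean_space"
  assumes "compact K" "continuous_on UNIV f" "\<And>x. x \<notin> K \<Longrightarrow> f x = 0"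
  shows "square_integrable lborel f"
  unfolding square_integrable_def
proof
  show "f \<in> borel_measurable lborel" using borel_measurable_continuous_onI[OF assms(2)] by simp
  have "integrable lborel (\<lambda>x. indicator K x *\<^sub>R (norm (f x))\<^sup>2)"
    using assms(1) continuous_on_subset[OF assms(2)] by (intro borel_integrable_compact continuous_intros) auto
  moreover have "(\<lambda>x. indicator K x *\<^sub>R (norm (f x))\<^sup>2) = (\<lambda>x. (norm (f x))\<^sup>2)"
  proof
    show "indicator K x *\<^sub>R (norm (f x))\<^sup>2 = (norm (f x))\<^sup>2" for x
      by (cases "x \<in> K") (simp_all add: assms(3))
  qed
  ultimately show "integrable lborel (\<lambda>x. (norm (f x))\<^sup>2)" by simp
qed

lemma square_integrable_completion: "square_integrable lborel f \<Longrightarrow> square_integrable lebesgue f"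
  by (auto simp: square_integrable_def integrable_completion intro: measurable_completion)

lemma C1c_facts:
  assumes "C1c D \<psi> d\<psi>"
  shows C1c_sq_lborel: "square_integrable lborel \<psi>" "square_integrable lborel d\<psi>"
    and C1c_indicator: "indicator D x *\<^sub>R \<psi> x = \<psi> x" "indicator D x *\<^sub>R d\<psi> x = d\<psi> x"
proof -
  obtain K where K: "compact K" "K \<subseteq> D" "\<And>x. x \<notin> K \<Longrightarrow> \<psi> x = 0" "\<And>x. x \<notin> K \<Longrightarrow> d\<psi> x = 0"
    using C1c_support[OF assms] by blast
  show "square_integrable lborel \<psi>" "square_integrable lborel d\<psi>"
    using K C1c_continuous[OF assms] C1c_gradient_continuous[OF assms] by (auto intro: compact_support_square_integrable)
  show "indicator D x *\<^sub>R \<psi> x = \<psi> x" "indicator D x *\<^sub>R d\<psi> x = d\<psi> x"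
    using K by (auto simp: indicator_def)
qed

lemma C1c_ext:
  assumes "C1c D \<psi> d\<psi>"
  shows C1c_ext_Lsq: "ext_Lsq D \<psi> = abs_Lsq \<psi>" "ext_Lsq D d\<psi> = abs_Lsq d\<psi>"
  unfolding ext_Lsq_def C1c_indicator[OF assms] by simp_all

lemma C1c_square_integrable:
  assumes "C1c D \<psi> d\<psi>" "D \<in> sets lebesgue"
  shows "square_integrable (lebesgue_on D) \<psi>" "square_integrable (lebesgue_on D) d\<psi>"
  unfolding square_integrable_on_iff[OF assms(2)] C1c_indicator[OF assms(1)]
  using C1c_sq_lborel[OF assms(1)] by (auto intro: square_integrable_completion)

lemma norm_abs_Lsq_nn:
  assumes "square_integrable lborel f"
  shows "ennreal ((norm (abs_Lsq f))\<^sup>2) = (\<integral>\<^sup>+x. ennreal ((norm (f x))\<^sup>2) \<partial>lborel)"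
proof -
  have "(norm (abs_Lsq f))\<^sup>2 = (\<integral>x. (norm (f x))\<^sup>2 \<partial>lebesgue)"
    by (rule norm_Lsq_abs[OF square_integrable_completion[OF assms]])
  also have "\<dots> = (\<integral>x. (norm (f x))\<^sup>2 \<partial>lborel)"
    using assms by (intro integral_completion) (auto simp: square_integrable_def)
  finally show ?thesis
    using assms by (subst nn_integral_eq_integral) (auto simp: square_integrable_def)
qed

lemma closure_support_subset:
  fixes f :: "'a::euclidean_space \<Rightarrow> real"
  assumes "{x. f x \<noteq> 0} \<subseteq> S"  "compact (closure S)" "closure S \<subseteq> D"
  shows "compact (closure {x. f x \<noteq> 0}) \<and> closure {x. f x \<noteq> 0} \<subseteq> D"
proof
  have "bounded (closure {x. f x \<noteq> 0})"
    by (rule bounded_subset[OF compact_imp_bounded[OF assms(2)] closure_mono[OF assms(1)]])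
  then show "compact (closure {x. f x \<noteq> 0})" using closed_closure compact_eq_bounded_closed by blast
  show "closure {x. f x \<noteq> 0} \<subseteq> D" using closure_mono[OF assms(1)] assms(3) by blast
qed

lemma C1c_zero: "C1c D (\<lambda>x. 0) (\<lambda>x. 0)"
  by (simp add: C1c_def GDERIV_const)

lemma C1c_add:
  assumes f: "C1c D f df" and g: "C1c D g dg"
  shows "C1c D (\<lambda>x. f x + g x) (\<lambda>x. df x + dg x)"
proof -
  have "closure ({x. f x \<noteq> 0} \<union> {x. g x \<noteq> 0}) = closure {x. f x \<noteq> 0} \<union> closure {x. g x \<noteq> 0}"
    by (rule closure_Un)
  then have "compact (closure {x. f x + g x \<noteq> 0}) \<and> closure {x. f x + g x \<noteq> 0} \<subseteq> D"
    using f g by (intro closure_support_subset[of _ "{x. f x \<noteq> 0} \<union> {x. g x \<noteq> 0}"]) (auto simp: C1c_def compact_Un)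
  then show ?thesis using f g by (auto simp: C1c_def intro!: GDERIV_add continuous_on_add)
qed

lemma C1c_compose:
  assumes f: "C1c D f df" and g: "\<And>y. (g has_real_derivative g' y) (at y)" "continuous_on UNIV g'" "g 0 = 0"
  shows "C1c D (\<lambda>x. g (f x)) (\<lambda>x. g' (f x) *\<^sub>R df x)"
proof -
  have "compact (closure {x. g (f x) \<noteq> 0}) \<and> closure {x. g (f x) \<noteq> 0} \<subseteq> D"
    using f g by (intro closure_support_subset[of _ "{x. f x \<noteq> 0}"]) (auto simp: C1c_def)
  moreover have "continuous_on UNIV (\<lambda>x. g' (f x) *\<^sub>R df x)"
    using C1c_continuous[OF f] C1c_gradient_continuous[OF f]
    by (intro continuous_on_scaleR continuous_on_compose2[OF g(2)]) auto
  moreover have "GDERIV (\<lambda>x. g (f x)) x :> g' (f x) *\<^sub>R df x" for x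
    by (rule GDERIV_DERIV_compose[where f=f and g=g]) (use f g(1) in \<open>auto simp: C1c_def\<close>)
  ultimately show ?thesis by (simp add: C1c_def)
qed

lemma C1c_scale:
  assumes f: "C1c D f df" shows "C1c D (\<lambda>x. c *\<^sub>R f x) (\<lambda>x. c *\<^sub>R df x)"
  using C1c_compose[OF f, of "\<lambda>y. c * y" "\<lambda>_. c"] by (auto intro!: derivative_eq_intros)

lemma subspace_C1c:
  assumes D: "D \<in> sets lebesgue"
  shows "subspace {(ext_Lsq D \<psi>, ext_Lsq D d\<psi>) | \<psi> d\<psi>. C1c D \<psi> d\<psi>}"
  unfolding subspace_def
proof (intro conjI ballI allI)
  have "ext_Lsq D (\<lambda>x. 0::'b::euclidean_space) = 0"
    using ext_Lsq_eq_0_iff[OF D square_integrable_zero] by simp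
  moreover have "ext_Lsq D (\<lambda>x. 0::real) = 0"
    using ext_Lsq_eq_0_iff[OF D square_integrable_zero] by simp
  ultimately show "0 \<in> {(ext_Lsq D \<psi>, ext_Lsq D d\<psi>) | \<psi> d\<psi>. C1c D \<psi> d\<psi>}"
    using C1c_zero[of D] ext_Lsq_eq_0_iff[OF D square_integrable_zero] by (force simp: zero_prod_def)
next
  fix x y assume "x \<in> {(ext_Lsq D \<psi>, ext_Lsq D d\<psi>) | \<psi> d\<psi>. C1c D \<psi> d\<psi>}" "y \<in> {(ext_Lsq D \<psi>, ext_Lsq D d\<psi>) | \<psi> d\<psi>. C1c D \<psi> d\<psi>}"
  then obtain f df g dg where fg: "C1c D f df" "C1c D g dg" "x = (ext_Lsq D f, ext_Lsq D df)" "y = (ext_Lsq D g, ext_Lsq D dg)"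
    by blast
  then show "x + y \<in> {(ext_Lsq D \<psi>, ext_Lsq D d\<psi>) | \<psi> d\<psi>. C1c D \<psi> d\<psi>}"
    using C1c_add[OF fg(1,2)] by (force simp: ext_Lsq_add[OF D] C1c_square_integrable[OF _ D])
next
  fix c x assume "x \<in> {(ext_Lsq D \<psi>, ext_Lsq D d\<psi>) | \<psi> d\<psi>. C1c D \<psi> d\<psi>}"
  then obtain f df where f: "C1c D f df" "x = (ext_Lsq D f, ext_Lsq D df)" by blast
  have "c *\<^sub>R x = (ext_Lsq D (\<lambda>x. c *\<^sub>R f x), ext_Lsq D (\<lambda>x. c *\<^sub>R df x))"
    unfolding f(2) ext_Lsq_scale[OF D C1c_square_integrable(1)[OF f(1) D]] ext_Lsq_scale[OF D C1c_square_integrable(2)[OF f(1) D]]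
    by simp
  then show "c *\<^sub>R x \<in> {(ext_Lsq D \<psi>, ext_Lsq D d\<psi>) | \<psi> d\<psi>. C1c D \<psi> d\<psi>}"
    using C1c_scale[OF f(1), of c] by blast
qed


lemma nn_integral_translate:
  fixes f :: "'a::euclidean_space \<Rightarrow> ennreal"
  assumes "f \<in> borel_measurable borel"
  shows "(\<integral>\<^sup>+x. f (x + z) \<partial>lborel) = (\<integral>\<^sup>+x. f x \<partial>lborel)"
proof -
  have "(\<integral>\<^sup>+x. f x \<partial>lborel) = (\<integral>\<^sup>+x. f x \<partial>distr lborel borel ((+) z))"
    by (simp add: lborel_distr_plus)
  also have "\<dots> = (\<integral>\<^sup>+x. f (z + x) \<partial>lborel)" using assms by (subst nn_integral_distr) auto
  finally show ?thesis by (simp add: add.commute)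
qed

text \<open>
  The fundamental theorem of calculus on the segment from \<open>x\<close> to \<open>x + z\<close> and the Cauchy--Schwarz
  inequality, the latter in the form \<open>\<integral> (g' - c)\<^sup>2 \<ge> 0\<close> with \<open>c = \<integral> g'\<close>.
\<close>

lemma increment_bound:
  assumes "C1c D \<psi> d\<psi>"
  shows "ennreal ((\<psi> (x + z) - \<psi> x)\<^sup>2) \<le>
    (\<integral>\<^sup>+t. ennreal ((norm z)\<^sup>2 * (norm (d\<psi> (x + t *\<^sub>R z)))\<^sup>2) * indicator {0..1} t \<partial>lborel)"
proof -
  define g where "g t = \<psi> (x + t *\<^sub>R z)" for t :: real
  define g' where "g' t = z \<bullet> d\<psi> (x + t *\<^sub>R z)" for t :: real
  define f where "f t = (norm z)\<^sup>2 * (norm (d\<psi> (x + t *\<^sub>R z)))\<^sup>2" for t :: real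
  have grad: "(\<psi> has_derivative (\<lambda>h. h \<bullet> d\<psi> y)) (at y)" for y using assms
    by (simp add: C1c_def gderiv_def)
  have cont: "continuous_on S (\<lambda>t. d\<psi> (x + t *\<^sub>R z))" for S :: "real set"
    by (rule continuous_on_compose2[OF C1c_gradient_continuous[OF assms]]) (auto intro!: continuous_intros)
  have g'_cont: "continuous_on {0..1} g'" unfolding g'_def by (intro continuous_intros cont)
  have f_cont: "continuous_on {0..1} f" unfolding f_def by (intro continuous_intros cont)
  have dg: "(g has_vector_derivative g' t) (at t within {0..1})" for t
  proof -
    have "((\<lambda>t. x + t *\<^sub>R z) has_derivative (\<lambda>h. h *\<^sub>R z)) (at t within {0..1})"
      by (auto intro!: derivative_eq_intros)
    from has_derivative_compose[OF this grad]
    show ?thesis unfolding has_vector_derivative_def g_def g'_def by (simp add: o_def)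
  qed
  define c where "c = \<psi> (x + z) - \<psi> x"
  have "(g' has_integral g 1 - g 0) {0..1}"
    by (rule fundamental_theorem_of_calculus) (use dg in auto)
  then have g'_int: "(g' has_integral c) {0..1}" by (simp add: g_def c_def)
  define I where "I = integral {0..1} (\<lambda>t. (g' t)\<^sup>2)"
  have I: "((\<lambda>t. (g' t)\<^sup>2) has_integral I) {0..1}"
    unfolding I_def by (intro integrable_integral integrable_continuous_real continuous_intros g'_cont)
  have "((\<lambda>t. (g' t)\<^sup>2 - (2 * c) * g' t + c\<^sup>2) has_integral I - (2 * c) * c + measure lborel {0..1::real} *\<^sub>R c\<^sup>2) {0..1}"
    by (intro has_integral_add has_integral_diff has_integral_mult_right I g'_int has_integral_const_real)
  then have "((\<lambda>t. (g' t - c)\<^sup>2) has_integral I - c\<^sup>2) {0..1}"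
    by (simp add: power2_eq_square algebra_simps)
  then have "0 \<le> I - c\<^sup>2" by (rule has_integral_nonneg) auto
  moreover have fI: "(f has_integral integral {0..1} f) {0..1}"
    by (intro integrable_integral integrable_continuous_real f_cont)
  have "I \<le> integral {0..1} f"
  proof (rule has_integral_le[OF I fI])
    fix t :: real
    have "\<bar>g' t\<bar>\<^sup>2 \<le> (norm z * norm (d\<psi> (x + t *\<^sub>R z)))\<^sup>2"
      unfolding g'_def by (intro power_mono Cauchy_Schwarz_ineq2) auto
    then show "(g' t)\<^sup>2 \<le> f t" by (simp add: f_def power_mult_distrib)
  qed
  ultimately have "c\<^sup>2 \<le> integral {0..1} f" by simp
  then have "ennreal (c\<^sup>2) \<le> ennreal (integral {0..1} f)" by (rule ennreal_leI)
  also have "\<dots> = (\<integral>\<^sup>+t. ennreal (indicator {0..1} t * f t) \<partial>lborel)"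
    by (rule nn_integral_has_integral_lebesgue[symmetric, OF _ fI]) (simp add: f_def)
  also have "\<dots> = (\<integral>\<^sup>+t. ennreal (f t) * indicator {0..1} t \<partial>lborel)"
    by (intro nn_integral_cong) (auto simp: indicator_def)
  finally show ?thesis unfolding c_def f_def .
qed

text \<open>
  Translations move a function by at most \<open>|z|\<close> times its gradient norm. Both the Poincare inequality
  and the compactness of the embedding follow from this single estimate.
\<close>

lemma translation_estimate:
  fixes D :: "'a::euclidean_space set"
  assumes "C1c D \<psi> d\<psi>"
  shows "(\<integral>\<^sup>+x. ennreal ((\<psi> (x + z) - \<psi> x)\<^sup>2) \<partial>lborel) \<le> ennreal ((norm z)\<^sup>2 * (norm (ext_Lsq D d\<psi>))\<^sup>2)"
proof -
  have [measurable]: "d\<psi> \<in> borel_measurable borel"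
    using C1c_gradient_continuous[OF assms] by (rule borel_measurable_continuous_onI)
  let ?F = "\<lambda>(x::'a) (t::real). ennreal ((norm z)\<^sup>2 * (norm (d\<psi> (x + t *\<^sub>R z)))\<^sup>2) * indicator {0..1} t"
  have "(\<integral>\<^sup>+x. ennreal ((\<psi> (x + z) - \<psi> x)\<^sup>2) \<partial>lborel) \<le> (\<integral>\<^sup>+x. \<integral>\<^sup>+t. ?F x t \<partial>lborel \<partial>lborel)"
    by (intro nn_integral_mono increment_bound[OF assms])
  also have "\<dots> = (\<integral>\<^sup>+t. \<integral>\<^sup>+x. ?F x t \<partial>lborel \<partial>lborel)"
    by (rule lborel_pair.Fubini'[symmetric]) measurable
  also have "\<dots> = (\<integral>\<^sup>+t. ennreal ((norm z)\<^sup>2 * (norm (ext_Lsq D d\<psi>))\<^sup>2) * indicator {0..1::real} t \<partial>lborel)"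
  proof (rule nn_integral_cong)
    fix t :: real
    have "(\<integral>\<^sup>+x. ?F x t \<partial>lborel) = (\<integral>\<^sup>+x. ennreal ((norm z)\<^sup>2) * ennreal ((norm (d\<psi> (x + t *\<^sub>R z)))\<^sup>2) \<partial>lborel) * indicator {0..1} t"
      by (subst nn_integral_multc) (auto simp: ennreal_mult)
    also have "(\<integral>\<^sup>+x. ennreal ((norm z)\<^sup>2) * ennreal ((norm (d\<psi> (x + t *\<^sub>R z)))\<^sup>2) \<partial>lborel)
        = ennreal ((norm z)\<^sup>2) * (\<integral>\<^sup>+x. ennreal ((norm (d\<psi> (x + t *\<^sub>R z)))\<^sup>2) \<partial>lborel)"
      by (rule nn_integral_cmult) measurable
    also have "(\<integral>\<^sup>+x. ennreal ((norm (d\<psi> (x + t *\<^sub>R z)))\<^sup>2) \<partial>lborel) = (\<integral>\<^sup>+x. ennreal ((norm (d\<psi> x))\<^sup>2) \<partial>lborel)"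
      by (rule nn_integral_translate[of "\<lambda>x. ennreal ((norm (d\<psi> x))\<^sup>2)"]) measurable
    also have "\<dots> = ennreal ((norm (ext_Lsq D d\<psi>))\<^sup>2)"
      by (simp add: C1c_ext_Lsq[OF assms] norm_abs_Lsq_nn[OF C1c_sq_lborel(2)[OF assms]])
    finally show "(\<integral>\<^sup>+x. ?F x t \<partial>lborel) = ennreal ((norm z)\<^sup>2 * (norm (ext_Lsq D d\<psi>))\<^sup>2) * indicator {0..1} t"
      by (simp add: ennreal_mult)
  qed
  also have "\<dots> = ennreal ((norm z)\<^sup>2 * (norm (ext_Lsq D d\<psi>))\<^sup>2)"
    by (subst nn_integral_cmult) auto
  finally show ?thesis .
qed

text \<open>
  A translation by a distance that no two points of \<open>D\<close> have separates the function from its translate, so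
  \<open>\<psi>(x)\<^sup>2 \<le> (\<psi>(x + z) - \<psi>(x))\<^sup>2\<close> everywhere.
\<close>

lemma poincare_inequality:
  fixes D :: "'a::euclidean_space set"
  assumes "bounded D"
  obtains C where "C > 0" "\<And>\<psi> d\<psi>. C1c D \<psi> d\<psi> \<Longrightarrow> (norm (ext_Lsq D \<psi>))\<^sup>2 \<le> C * (norm (ext_Lsq D d\<psi>))\<^sup>2"
proof -
  obtain R where R: "R > 0" "\<And>x. x \<in> D \<Longrightarrow> norm x < R" using assms bounded_pos_less by metis
  obtain b :: 'a where b: "b \<in> Basis" using nonempty_Basis by blast
  define z where "z = (2 * R) *\<^sub>R b"
  have z: "norm z = 2 * R" using b R by (simp add: z_def)
  show ?thesis
  proof (rule that)
    show "(2 * R)\<^sup>2 > 0" using R by simp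
    fix \<psi> d\<psi> assume \<psi>: "C1c D \<psi> d\<psi>"
    have out: "\<psi> x = 0" if "x \<notin> D" for x using C1c_indicator(1)[OF \<psi>, of x] that by (simp add: indicator_def)
    have [measurable]: "\<psi> \<in> borel_measurable borel"
      using C1c_continuous[OF \<psi>] by (rule borel_measurable_continuous_onI)
    have split: "(\<psi> x)\<^sup>2 \<le> (\<psi> (x + z) - \<psi> x)\<^sup>2" for x
    proof (cases "x \<in> D")
      case True
      have "x + z \<notin> D"
      proof
        assume "x + z \<in> D"
        then have "norm (x + z - x) < 2 * R"
          using R(2)[OF True] R(2)[of "x + z"] norm_triangle_ineq4[of "x + z" x] by linarith
        then show False using z by simp
      qed
      then show ?thesis using out by simp
    qed (use out in simp)
    have "ennreal ((norm (ext_Lsq D \<psi>))\<^sup>2) = (\<integral>\<^sup>+x. ennreal ((norm (\<psi> x))\<^sup>2) \<partial>lborel)"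
      by (simp only: C1c_ext_Lsq[OF \<psi>] norm_abs_Lsq_nn[OF C1c_sq_lborel(1)[OF \<psi>]])
    also have "\<dots> \<le> (\<integral>\<^sup>+x. ennreal ((\<psi> (x + z) - \<psi> x)\<^sup>2) \<partial>lborel)"
      using split by (intro nn_integral_mono ennreal_leI) simp
    also have "\<dots> \<le> ennreal ((norm z)\<^sup>2 * (norm (ext_Lsq D d\<psi>))\<^sup>2)"
      by (rule translation_estimate[OF \<psi>])
    finally show "(norm (ext_Lsq D \<psi>))\<^sup>2 \<le> (2 * R)\<^sup>2 * (norm (ext_Lsq D d\<psi>))\<^sup>2"
      unfolding z by simp
  qed
qed


lemma square_integrable_indicator_mult:
  fixes f :: "'m \<Rightarrow> real"
  assumes f: "square_integrable M f" and A: "A \<in> sets M"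
  shows "square_integrable M (\<lambda>x. indicator A x * f x)"
  unfolding square_integrable_def
proof
  have [measurable]: "f \<in> borel_measurable M" "A \<in> sets M" using assms by (auto simp: square_integrable_def)
  show "(\<lambda>x. indicator A x * f x) \<in> borel_measurable M" by measurable
  show "integrable M (\<lambda>x. (norm (indicator A x * f x))\<^sup>2)"
  proof (rule Bochner_Integration.integrable_bound)
    show "integrable M (\<lambda>x. (norm (f x))\<^sup>2)" using f by (simp add: square_integrable_def)
    show "(\<lambda>x. (norm (indicator A x * f x))\<^sup>2) \<in> borel_measurable M" by measurable
  qed (auto simp: indicator_def)
qed

lemma square_integrable_indicator:
  assumes "A \<in> sets M" "emeasure M A < \<infinity>"
  shows "square_integrable M (indicat_real A)"
proof -
  have "(\<lambda>x. (norm (indicat_real A x))\<^sup>2) = indicat_real A" by (auto simp: indicator_def)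
  then show ?thesis using assms by (simp add: square_integrable_def)
qed

text \<open>
  The Rellich compactness theorem. Cover \<open>D\<close>
    by finitely many balls of radius \<open>\<delta>\<close>. At a point \<open>x\<close> of
  such a ball \<open>B\<close>, the value \<open>\<psi>(x)\<close> differs from the mean of \<open>\<psi>\<close> over \<open>B\<close>, which is one of finitely
  many linear functionals of \<open>\<psi>\<close>,
    by at most a multiple of the mean oscillation of \<open>\<psi>\<close> over the ball of radius \<open>2\<delta>\<close>
  about \<open>x\<close>. The square of this oscillation integrates to \<open>O(\<delta>\<^sup>2)\<close> times the squared gradient norm by
  \<open>translation_estimate\<close>.
\<close>

lemma finite_rank_estimate:
  fixes D :: "'a::euclidean_space set"
  assumes D: "bounded D" "open D" and \<epsilon>: "\<epsilon> > 0"
  shows "\<exists>E. finite E \<and> (\<forall>\<psi> d\<psi>. C1c D \<psi> d\<psi> \<longrightarrow>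
    (norm (ext_Lsq D \<psi>))\<^sup>2 \<le> \<epsilon> * (norm (ext_Lsq D d\<psi>))\<^sup>2 + (\<Sum>e\<in>E. (ext_Lsq D \<psi> \<bullet> e)\<^sup>2))"
proof -
  define n where "n = DIM('a)"
  \<comment> \<open>The factor \<open>2 ^ n\<close> is the volume ratio of balls of radius \<open>2\<delta>\<close> and \<open>\<delta>\<close>; \<open>8 = 2 * 2\<^sup>2\<close>.\<close>
  define \<delta> where "\<delta> = sqrt (\<epsilon> / (8 * 2 ^ n))"
  have \<delta>: "\<delta> > 0" and \<delta>_sq: "8 * 2 ^ n * \<delta>\<^sup>2 = \<epsilon>" using \<epsilon>
    by (auto simp: \<delta>_def)
  define m where "m = unit_ball_vol (real n) * \<delta> ^ n"
  have m: "m > 0" using \<delta> by (simp add: m_def)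
  have ball_m: "emeasure lborel (ball c \<delta>) = ennreal m" for c :: 'a
    using \<delta> by (simp add: emeasure_ball m_def n_def)
  have measure_m: "measure lborel (ball c \<delta>) = m" for c :: 'a
    using ball_m[of c] m by (simp add: measure_def)
  have ball_2: "emeasure lborel (ball (0::'a) (2 * \<delta>)) = ennreal (2 ^ n * m)"
    using \<delta> by (simp add: emeasure_ball m_def n_def power_mult_distrib mult_ac)
  \<comment> \<open>Adding one keeps \<open>\<kappa>\<close> positive.\<close>
  define \<kappa> where "\<kappa> = measure lborel D + 1"
  have \<kappa>: "\<kappa> > 0" "measure lborel D \<le> \<kappa>" unfolding \<kappa>_def by (auto simp: add_nonneg_pos)
  have D_fin: "emeasure lborel D = ennreal (measure lborel D)"
    using emeasure_bounded_finite[OF D(1)] by (intro emeasure_eq_ennreal_measure) auto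
  have "compact (closure D)" using D(1) by (simp add: compact_closure)
  then obtain X where X: "finite X" "closure D \<subseteq> (\<Union>c\<in>X. ball c \<delta>)"
    using seq_compact_imp_totally_bounded[OF compact_imp_seq_compact] \<delta> by metis
  define e where "e c = (sqrt (2 * \<kappa>) / m) *\<^sub>R abs_Lsq (indicat_real (ball c \<delta>))" for c :: 'a
  have "(norm (ext_Lsq D \<psi>))\<^sup>2 \<le> \<epsilon> * (norm (ext_Lsq D d\<psi>))\<^sup>2 + (\<Sum>e\<in>e ` X. (ext_Lsq D \<psi> \<bullet> e)\<^sup>2)"
    if \<psi>: "C1c D \<psi> d\<psi>" for \<psi> d\<psi>
  proof -
    define S where "S = (\<Sum>e\<in>e ` X. (ext_Lsq D \<psi> \<bullet> e)\<^sup>2)"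
    have S: "S \<ge> 0" unfolding S_def by (simp add: sum_nonneg)
    have [measurable]: "\<psi> \<in> borel_measurable borel"
      using C1c_continuous[OF \<psi>] by (rule borel_measurable_continuous_onI)
    have \<psi>_sq: "square_integrable lborel \<psi>" by (rule C1c_sq_lborel[OF \<psi>])
    have ind_sq: "square_integrable lborel (indicat_real (ball c \<delta>))" for c :: 'a
      by (rule square_integrable_indicator) (auto simp: ball_m)
    define a where "a c = (\<integral>y. indicator (ball c \<delta>) y * \<psi> y \<partial>lborel) / m" for c
    have inner_e: "ext_Lsq D \<psi> \<bullet> e c = sqrt (2 * \<kappa>) * a c" for c
    proof -
      have "abs_Lsq \<psi> \<bullet> abs_Lsq (indicat_real (ball c \<delta>)) = L2_inner lebesgue \<psi> (indicat_real (ball c \<delta>))"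
        using square_integrable_completion[OF \<psi>_sq] square_integrable_completion[OF ind_sq]
        by (subst inner_Lsq.abs_eq) auto
      also have "\<dots> = (\<integral>y. indicator (ball c \<delta>) y * \<psi> y \<partial>lborel)"
      proof -
        have "(\<lambda>y. \<psi> y \<bullet> indicat_real (ball c \<delta>) y) \<in> borel_measurable lborel"
          unfolding inner_real_def by (intro borel_measurable_times borel_measurable_indicator) auto
        then show ?thesis unfolding L2_inner_def by (simp add: integral_completion mult.commute)
      qed
      finally show ?thesis unfolding C1c_ext_Lsq(1)[OF \<psi>] e_def a_def by simp
    qed
    define G where "G x = (\<integral>\<^sup>+z. indicator (ball 0 (2 * \<delta>)) z * ennreal ((\<psi> (x + z) - \<psi> x)\<^sup>2) \<partial>lborel)" for x
    have osc: "ennreal ((a c - \<psi> x)\<^sup>2) \<le> ennreal (1 / m) * G x" if x: "x \<in> ball c \<delta>" for x c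
    proof -
      define g where "g y = indicator (ball c \<delta>) y * \<psi> y - \<psi> x *\<^sub>R indicat_real (ball c \<delta>) y" for y
      have g_sq: "square_integrable lborel g" unfolding g_def
        by (intro square_integrable_diff square_integrable_indicator_mult square_integrable_scale ind_sq \<psi>_sq) simp
      have i1: "integrable lborel (\<lambda>y. indicator (ball c \<delta>) y * \<psi> y)"
        using square_integrable_inner[OF ind_sq \<psi>_sq] by simp
      have "L2_inner lborel (indicat_real (ball c \<delta>)) g = (\<integral>y. indicator (ball c \<delta>) y * \<psi> y - \<psi> x * indicat_real (ball c \<delta>) y \<partial>lborel)"
        unfolding L2_inner_def g_def by (intro Bochner_Integration.integral_cong) (auto simp: indicator_def)
      also have "\<dots> = m * a c - \<psi> x * m"
        using i1 m measure_m[of c] ball_m[of c] by (subst Bochner_Integration.integral_diff) (auto simp: a_def)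
      finally have ind_g: "L2_inner lborel (indicat_real (ball c \<delta>)) g = m * (a c - \<psi> x)" by (simp add: algebra_simps)
      have ind_ind: "L2_inner lborel (indicat_real (ball c \<delta>)) (indicat_real (ball c \<delta>)) = m"
      proof -
        have "(\<lambda>y. indicat_real (ball c \<delta>) y \<bullet> indicat_real (ball c \<delta>) y) = indicat_real (ball c \<delta>)"
          by (auto simp: indicator_def)
        then show ?thesis unfolding L2_inner_def using measure_m[of c] by simp
      qed
      have "\<bar>m * (a c - \<psi> x)\<bar>\<^sup>2 \<le> (L2_norm lborel (indicat_real (ball c \<delta>)) * L2_norm lborel g)\<^sup>2"
        using L2_Cauchy_Schwarz[OF ind_sq[of c] g_sq] unfolding ind_g by (rule power_mono) simp
      also have "\<dots> = m * L2_inner lborel g g"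
        unfolding power_mult_distrib L2_norm_sq ind_ind ..
      finally have "m * (m * (a c - \<psi> x)\<^sup>2) \<le> m * L2_inner lborel g g"
        by (simp add: power_mult_distrib power2_eq_square mult_ac)
      then have "m * (a c - \<psi> x)\<^sup>2 \<le> L2_inner lborel g g" using m by simp
      then have "(a c - \<psi> x)\<^sup>2 \<le> (1 / m) * L2_inner lborel g g" using m by (simp add: field_simps)
      then have "ennreal ((a c - \<psi> x)\<^sup>2) \<le> ennreal (1 / m) * ennreal (L2_inner lborel g g)"
        using m L2_inner_self_nonneg[of lborel g] by (simp add: ennreal_mult[symmetric] ennreal_leI)
      also have "ennreal (L2_inner lborel g g) = (\<integral>\<^sup>+y. ennreal (g y * g y) \<partial>lborel)"
        unfolding L2_inner_def using square_integrable_inner[OF g_sq g_sq] by (subst nn_integral_eq_integral) auto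
      also have "\<dots> \<le> (\<integral>\<^sup>+y. indicator (ball x (2 * \<delta>)) y * ennreal ((\<psi> y - \<psi> x)\<^sup>2) \<partial>lborel)"
      proof (rule nn_integral_mono)
        fix y
        show "ennreal (g y * g y) \<le> indicator (ball x (2 * \<delta>)) y * ennreal ((\<psi> y - \<psi> x)\<^sup>2)"
        proof (cases "y \<in> ball c \<delta>")
          case True
          then have "dist x y < 2 * \<delta>" using x dist_triangle_less_add[of x c \<delta> y \<delta>]
            by (simp add: dist_commute)
          then show ?thesis using True by (simp add: g_def power2_eq_square)
        qed (simp add: g_def)
      qed
      also have "\<dots> = (\<integral>\<^sup>+z. indicator (ball x (2 * \<delta>)) (z + x) * ennreal ((\<psi> (z + x) - \<psi> x)\<^sup>2) \<partial>lborel)"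
      proof (rule nn_integral_translate[symmetric])
        have "ball x (2 * \<delta>) \<in> sets borel" by simp
        then have "indicator (ball x (2 * \<delta>)) \<in> borel_measurable borel" by (rule borel_measurable_indicator)
        moreover have "(\<lambda>y. ennreal ((\<psi> y - \<psi> x)\<^sup>2)) \<in> borel_measurable borel" by measurable
        ultimately show "(\<lambda>y. indicator (ball x (2 * \<delta>)) y * ennreal ((\<psi> y - \<psi> x)\<^sup>2)) \<in> borel_measurable borel"
          by (rule borel_measurable_times_ennreal)
      qed
      also have "\<dots> = G x"
        unfolding G_def by (intro nn_integral_cong) (auto simp: indicator_def dist_norm add.commute)
      finally show ?thesis by (simp add: mult_left_mono)
    qed
    have pointwise: "ennreal ((norm (\<psi> x))\<^sup>2) \<le> ennreal (2 / m) * G x + ennreal (S / \<kappa>) * indicator D x" for x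
    proof (cases "x \<in> D")
      case False
      then show ?thesis using C1c_indicator(1)[OF \<psi>, of x] by simp
    next
      case True
      then obtain c where c: "c \<in> X" "x \<in> ball c \<delta>" using X(2) closure_subset by blast
      have "(ext_Lsq D \<psi> \<bullet> e c)\<^sup>2 \<le> S" unfolding S_def using X(1) c(1) by (intro member_le_sum) auto
      then have "2 * (a c)\<^sup>2 \<le> S / \<kappa>" using \<kappa> by (simp add: inner_e power_mult_distrib field_simps)
      moreover have "(norm (\<psi> x))\<^sup>2 \<le> 2 * (a c - \<psi> x)\<^sup>2 + 2 * (a c)\<^sup>2"
        using zero_le_power2[of "2 * a c - \<psi> x"] by (simp add: power2_eq_square algebra_simps)
      ultimately have "(norm (\<psi> x))\<^sup>2 \<le> 2 * (a c - \<psi> x)\<^sup>2 + S / \<kappa>" by linarith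
      then have "ennreal ((norm (\<psi> x))\<^sup>2) \<le> ennreal (2 * (a c - \<psi> x)\<^sup>2 + S / \<kappa>)"
        by (rule ennreal_leI)
      also have "\<dots> = 2 * ennreal ((a c - \<psi> x)\<^sup>2) + ennreal (S / \<kappa>)"
        using S \<kappa> by (simp add: ennreal_plus ennreal_mult)
      also have "\<dots> \<le> 2 * (ennreal (1 / m) * G x) + ennreal (S / \<kappa>)"
        by (intro add_right_mono mult_left_mono osc c) auto
      also have "2 * (ennreal (1 / m) * G x) = ennreal (2 / m) * G x"
      proof -
        have "ennreal (2 / m) = 2 * ennreal (1 / m)" using m ennreal_mult[of 2 "1 / m"] by simp
        then show ?thesis by (simp add: mult.assoc)
      qed
      finally show ?thesis using True by simp
    qed
    have [measurable]: "ball (0::'a) (2 * \<delta>) \<in> sets borel" by simp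
    have [measurable]: "G \<in> borel_measurable borel" unfolding G_def by measurable
    have "(\<integral>\<^sup>+x. G x \<partial>lborel) = (\<integral>\<^sup>+z. \<integral>\<^sup>+x. indicator (ball 0 (2 * \<delta>)) z * ennreal ((\<psi> (x + z) - \<psi> x)\<^sup>2) \<partial>lborel \<partial>lborel)"
      unfolding G_def by (rule lborel_pair.Fubini'[symmetric]) measurable
    also have "\<dots> \<le> (\<integral>\<^sup>+z. ennreal ((2 * \<delta>)\<^sup>2 * (norm (ext_Lsq D d\<psi>))\<^sup>2) * indicator (ball (0::'a) (2 * \<delta>)) z \<partial>lborel)"
    proof (rule nn_integral_mono)
      fix z :: 'a
      have "(\<integral>\<^sup>+x. indicator (ball 0 (2 * \<delta>)) z * ennreal ((\<psi> (x + z) - \<psi> x)\<^sup>2) \<partial>lborel)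
          = indicator (ball 0 (2 * \<delta>)) z * (\<integral>\<^sup>+x. ennreal ((\<psi> (x + z) - \<psi> x)\<^sup>2) \<partial>lborel)"
        by (rule nn_integral_cmult) measurable
      also have "\<dots> \<le> indicator (ball 0 (2 * \<delta>)) z * ennreal ((2 * \<delta>)\<^sup>2 * (norm (ext_Lsq D d\<psi>))\<^sup>2)"
      proof (cases "z \<in> ball 0 (2 * \<delta>)")
        case True
        then have "(norm z)\<^sup>2 * (norm (ext_Lsq D d\<psi>))\<^sup>2 \<le> (2 * \<delta>)\<^sup>2 * (norm (ext_Lsq D d\<psi>))\<^sup>2"
          by (intro mult_right_mono power_mono) auto
        then show ?thesis using translation_estimate[OF \<psi>, of z]
          by (intro mult_left_mono) (auto intro: order_trans ennreal_leI)
      qed simp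
      finally show "(\<integral>\<^sup>+x. indicator (ball 0 (2 * \<delta>)) z * ennreal ((\<psi> (x + z) - \<psi> x)\<^sup>2) \<partial>lborel)
          \<le> ennreal ((2 * \<delta>)\<^sup>2 * (norm (ext_Lsq D d\<psi>))\<^sup>2) * indicator (ball 0 (2 * \<delta>)) z" by (simp add: mult.commute)
    qed
    also have "\<dots> = ennreal ((2 * \<delta>)\<^sup>2 * (norm (ext_Lsq D d\<psi>))\<^sup>2) * ennreal (2 ^ n * m)"
      by (subst nn_integral_cmult) (auto simp: ball_2)
    also have "\<dots> = ennreal ((2 * \<delta>)\<^sup>2 * (norm (ext_Lsq D d\<psi>))\<^sup>2 * (2 ^ n * m))"
      using m by (intro ennreal_mult[symmetric]) auto
    finally have G_int: "(\<integral>\<^sup>+x. G x \<partial>lborel) \<le> ennreal ((2 * \<delta>)\<^sup>2 * (norm (ext_Lsq D d\<psi>))\<^sup>2 * (2 ^ n * m))" .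
    have "ennreal ((norm (ext_Lsq D \<psi>))\<^sup>2) = (\<integral>\<^sup>+x. ennreal ((norm (\<psi> x))\<^sup>2) \<partial>lborel)"
      by (simp only: C1c_ext_Lsq[OF \<psi>] norm_abs_Lsq_nn[OF \<psi>_sq])
    also have "\<dots> \<le> (\<integral>\<^sup>+x. ennreal (2 / m) * G x + ennreal (S / \<kappa>) * indicator D x \<partial>lborel)"
      by (intro nn_integral_mono pointwise)
    also have "\<dots> = ennreal (2 / m) * (\<integral>\<^sup>+x. G x \<partial>lborel) + ennreal (S / \<kappa>) * emeasure lborel D"
      using D(2) by (subst nn_integral_add) (auto simp: nn_integral_cmult)
    also have "\<dots> \<le> ennreal (2 / m) * ennreal ((2 * \<delta>)\<^sup>2 * (norm (ext_Lsq D d\<psi>))\<^sup>2 * (2 ^ n * m)) + ennreal (S / \<kappa>) * ennreal \<kappa>"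
      unfolding D_fin using \<kappa> by (intro add_mono mult_left_mono G_int ennreal_leI) auto
    also have "\<dots> = ennreal (2 / m * ((2 * \<delta>)\<^sup>2 * (norm (ext_Lsq D d\<psi>))\<^sup>2 * (2 ^ n * m)) + S / \<kappa> * \<kappa>)"
    proof -
      have "ennreal p * ennreal q + ennreal r * ennreal t = ennreal (p * q + r * t)"
        if "0 \<le> p" "0 \<le> q" "0 \<le> r" "0 \<le> t" for p q r t
        using that by (simp add: ennreal_mult ennreal_plus)
      then show ?thesis using m S \<kappa>(1) by simp
    qed
    also have "2 / m * ((2 * \<delta>)\<^sup>2 * (norm (ext_Lsq D d\<psi>))\<^sup>2 * (2 ^ n * m)) + S / \<kappa> * \<kappa>
        = (8 * 2 ^ n * \<delta>\<^sup>2) * (norm (ext_Lsq D d\<psi>))\<^sup>2 + S"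
      using m \<kappa> by (simp add: power_mult_distrib)
    finally show ?thesis
      using S \<epsilon> unfolding \<delta>_sq S_def by (subst (asm) ennreal_le_iff) (auto intro!: add_nonneg_nonneg)
  qed
  then show ?thesis using X(1) by (intro exI[of _ "e ` X"]) auto
qed


section \<open>Completeness of the Dirichlet eigenfunctions\<close>

lemma DERIV_max0_sq: "((\<lambda>y. (max 0 y)\<^sup>2) has_real_derivative 2 * max 0 y) (at (y::real))"
  unfolding DERIV_def
proof (rule LIM_zero_cancel, rule Lim_null_comparison)
  show "((\<lambda>h::real. \<bar>h\<bar>) \<longlongrightarrow> 0) (at 0)" by (rule tendsto_eq_intros refl | simp)+
  have "\<bar>((max 0 (y + h))\<^sup>2 - (max 0 y)\<^sup>2) / h - 2 * max 0 y\<bar> \<le> \<bar>h\<bar>" if "h \<noteq> 0" for h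
  proof -
    have sq: "\<bar>(max 0 (y + h))\<^sup>2 - (max 0 y)\<^sup>2 - 2 * max 0 y * h\<bar> \<le> h\<^sup>2"
    proof -
      consider "y \<ge> 0" "y + h \<ge> 0" | "y \<ge> 0" "y + h < 0" | "y < 0" "y + h \<ge> 0" | "y < 0" "y + h < 0" by linarith
      then show ?thesis
      proof cases
        case 1 then show ?thesis by (simp add: max_def power2_eq_square algebra_simps)
      next
        case 2
        have "y * (- y - 2 * h) \<ge> 0" using 2 by (intro mult_nonneg_nonneg) auto
        moreover have "(y + h)\<^sup>2 \<ge> 0" by simp
        ultimately show ?thesis using 2 by (simp add: max_def power2_eq_square algebra_simps abs_le_iff)
      next
        case 3
        then have "(y + h)\<^sup>2 \<le> h\<^sup>2" by (intro power_mono) auto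
        then show ?thesis using 3 by (simp add: max_def)
      qed (simp add: max_def)
    qed
    have "((max 0 (y + h))\<^sup>2 - (max 0 y)\<^sup>2) / h - 2 * max 0 y = ((max 0 (y + h))\<^sup>2 - (max 0 y)\<^sup>2 - 2 * max 0 y * h) / h"
      using that by (simp add: field_simps)
    also have "\<bar>\<dots>\<bar> \<le> h\<^sup>2 / \<bar>h\<bar>" using sq by (simp add: abs_divide divide_right_mono)
    also have "\<dots> = \<bar>h\<bar>" using that by (simp add: power2_eq_square abs_if)
    finally show ?thesis .
  qed
  then show "\<forall>\<^sub>F h in at 0. norm (((max 0 (y + h))\<^sup>2 - (max 0 y)\<^sup>2) / h - 2 * max 0 y) \<le> \<bar>h\<bar>"
    by (auto simp: eventually_at_filter)
qed

text \<open>
  The square of the positive part of \<open>r\<^sup>2 - |x - c|\<^sup>2\<close> is continuously differentiable and is positive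
  exactly on the ball.
\<close>

lemma C1c_bump:
  fixes c :: "'a::euclidean_space"
  assumes "r > 0" "cball c r \<subseteq> D"
  shows "\<exists>F dF. C1c D F dF \<and> (\<forall>x. F x \<ge> 0) \<and> {x. F x \<noteq> 0} = ball c r"
proof -
  define q where "q x = r\<^sup>2 - (x - c) \<bullet> (x - c)" for x
  define F where "F x = (max 0 (q x))\<^sup>2" for x
  define dF where "dF x = (2 * max 0 (q x)) *\<^sub>R ((- 2) *\<^sub>R (x - c))" for x
  have supp: "{x. F x \<noteq> 0} = ball c r"
  proof -
    have "q x > 0 \<longleftrightarrow> x \<in> ball c r" for x
    proof -
      have "q x > 0 \<longleftrightarrow> (norm (x - c))\<^sup>2 < r\<^sup>2" by (simp add: q_def power2_norm_eq_inner)
      also have "\<dots> \<longleftrightarrow> norm (x - c) < r" using assms(1)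
        by (meson less_imp_le norm_ge_zero power_less_imp_less_base power_strict_mono zero_less_numeral)
      finally show ?thesis by (simp add: dist_norm norm_minus_commute)
    qed
    moreover have "F x \<noteq> 0 \<longleftrightarrow> q x > 0" for x by (auto simp: F_def max_def)
    ultimately show ?thesis by blast
  qed
  have "GDERIV F x :> dF x" for x
    unfolding F_def dF_def
  proof (rule GDERIV_DERIV_compose[where f=q and g="\<lambda>y. (max 0 y)\<^sup>2"])
    show "GDERIV q x :> (- 2) *\<^sub>R (x - c)"
      unfolding gderiv_def q_def
      by (auto intro!: derivative_eq_intros simp: inner_commute algebra_simps)
  qed (rule DERIV_max0_sq)
  moreover have "continuous_on UNIV dF"
    unfolding dF_def q_def by (intro continuous_intros)
  moreover have "compact (closure {x. F x \<noteq> 0})" "closure {x. F x \<noteq> 0} \<subseteq> D"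
    unfolding supp using assms by (auto simp: compact_closure)
  ultimately have "C1c D F dF" by (simp add: C1c_def)
  moreover have "F x \<ge> 0" for x by (simp add: F_def)
  ultimately show ?thesis using supp by blast
qed

lemma C1c_sum:
  assumes "finite I" "\<And>i. i \<in> I \<Longrightarrow> C1c D (F i) (dF i)"
  shows "C1c D (\<lambda>x. \<Sum>i\<in>I. F i x) (\<lambda>x. \<Sum>i\<in>I. dF i x)"
  using assms by (induction I) (auto intro: C1c_zero C1c_add)

text \<open>
  A function \<open>w\<close> orthogonal to all test functions vanishes almost everywhere. Its integral is zero
  over the set where a test function is nonzero, hence over finite unions of balls (the supports of
  sums of bumps), over open sets, over countable intersections of open sets, and finally over all
  measurable sets.
\<close>

context
  fixes D :: "'a::euclidean_space set" and w :: "'a \<Rightarrow> real"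
  assumes D: "bounded D" "open D" and w: "square_integrable (lebesgue_on D) w"
    and orth: "\<And>\<psi> d\<psi>. C1c D \<psi> d\<psi> \<Longrightarrow> L2_inner (lebesgue_on D) w \<psi> = 0"
begin

lemma D_lebesgue: "D \<in> sets lebesgue" using D by auto

lemma w_integrable: "integrable (lebesgue_on D) w"
proof -
  have "emeasure (lebesgue_on D) (space (lebesgue_on D)) < \<infinity>"
    using emeasure_bounded_finite[OF D(1)] D(2) by (simp add: emeasure_restrict_space D_lebesgue)
  then have "finite_measure (lebesgue_on D)" by (intro finite_measureI) simp
  then have "square_integrable (lebesgue_on D) (\<lambda>_. 1::real)"
    by (simp add: square_integrable_def finite_measure.integrable_const)
  from square_integrable_inner[OF w this] show ?thesis by simp
qed

lemma w_measurable [measurable]: "w \<in> borel_measurable (lebesgue_on D)"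
  using w by (simp add: square_integrable_def)

lemma integral_indicator_limit:
  assumes A: "\<And>n. A n \<in> sets lebesgue" "B \<in> sets lebesgue"
    and lim: "\<And>x. (\<lambda>n. indicat_real (A n) x) \<longlonglongrightarrow> indicator B x"
    and 0: "\<And>n. (\<integral>x. w x * indicator (A n) x \<partial>lebesgue_on D) = 0"
  shows "(\<integral>x. w x * indicator B x \<partial>lebesgue_on D) = 0"
proof -
  have m: "indicat_real S \<in> borel_measurable (lebesgue_on D)" if "S \<in> sets lebesgue" for S
    using that by (intro measurable_restrict_space1 borel_measurable_indicator)
  have "(\<lambda>n. \<integral>x. w x * indicator (A n) x \<partial>lebesgue_on D) \<longlonglongrightarrow> (\<integral>x. w x * indicator B x \<partial>lebesgue_on D)"
  proof (rule integral_dominated_convergence[where w="\<lambda>x. \<bar>w x\<bar>"])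
    show "(\<lambda>x. w x * indicat_real B x) \<in> borel_measurable (lebesgue_on D)" using m[OF A(2)] by measurable
    show "(\<lambda>x. w x * indicat_real (A n) x) \<in> borel_measurable (lebesgue_on D)" for n using m[OF A(1)] by measurable
    show "AE x in lebesgue_on D. (\<lambda>n. w x * indicator (A n) x) \<longlonglongrightarrow> w x * indicator B x"
      by (intro AE_I2 tendsto_mult tendsto_const lim)
  qed (use w_integrable in \<open>auto simp: indicator_def\<close>)
  then show ?thesis unfolding 0 by (simp add: LIMSEQ_const_iff)
qed

text \<open>
  The functions \<open>n F\<^sup>2 / (1 + n F\<^sup>2)\<close> are again test functions and converge to the indicator of
  \<open>{F \<noteq> 0}\<close>.
\<close>

lemma integral_support_zero:
  assumes F: "C1c D F dF"
  shows "(\<integral>x. w x * indicator {x. F x \<noteq> 0} x \<partial>lebesgue_on D) = 0"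
proof -
  define g where "g n y = real n * y\<^sup>2 / (1 + real n * y\<^sup>2)" for n and y :: real
  have pos: "1 + real n * y\<^sup>2 > 0" for n y by (intro add_pos_nonneg) auto
  have dg: "(g n has_real_derivative 2 * real n * y / (1 + real n * y\<^sup>2)\<^sup>2) (at y)" for n y
    unfolding g_def using pos[of n y]
    by (auto intro!: derivative_eq_intros simp: power2_eq_square field_simps)
  have comp: "C1c D (\<lambda>x. g n (F x)) (\<lambda>x. (2 * real n * F x / (1 + real n * (F x)\<^sup>2)\<^sup>2) *\<^sub>R dF x)" for n
  proof (rule C1c_compose[OF F dg])
    show "continuous_on UNIV (\<lambda>y. 2 * real n * y / (1 + real n * y\<^sup>2)\<^sup>2)"
      using pos[of n] by (intro continuous_intros) (simp add: less_imp_neq[symmetric])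
    show "g n 0 = 0" by (simp add: g_def)
  qed
  have zero: "(\<integral>x. w x * g n (F x) \<partial>lebesgue_on D) = 0" for n
    using orth[OF comp[of n]] by (simp add: L2_inner_def)
  have Fm: "F \<in> borel_measurable lebesgue"
    using C1c_continuous[OF F] by (intro measurable_completion) (simp add: borel_measurable_continuous_onI)
  then have Fm' [measurable]: "F \<in> borel_measurable (lebesgue_on D)" by (rule measurable_restrict_space1)
  have set: "{x. F x \<noteq> 0} \<in> sets lebesgue"
    using measurable_sets[OF Fm, of "- {0}"] by (simp add: vimage_def)
  have m: "indicat_real {x. F x \<noteq> 0} \<in> borel_measurable (lebesgue_on D)"
    using set by (intro measurable_restrict_space1 borel_measurable_indicator)
  have bound: "\<bar>g n y\<bar> \<le> 1" for n y
    using pos[of n y] by (simp add: g_def abs_divide divide_le_eq)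
  have "(\<lambda>n. \<integral>x. w x * g n (F x) \<partial>lebesgue_on D) \<longlonglongrightarrow> (\<integral>x. w x * indicator {x. F x \<noteq> 0} x \<partial>lebesgue_on D)"
  proof (rule integral_dominated_convergence[where w="\<lambda>x. \<bar>w x\<bar>"])
    show "(\<lambda>x. w x * indicat_real {x. F x \<noteq> 0} x) \<in> borel_measurable (lebesgue_on D)" using m by measurable
    show "(\<lambda>x. w x * g n (F x)) \<in> borel_measurable (lebesgue_on D)" for n unfolding g_def by measurable
    have "(\<lambda>n. g n y) \<longlonglongrightarrow> (if y \<noteq> 0 then 1 else 0)" for y
    proof (cases "y = 0")
      case False
      then have "y\<^sup>2 > 0" by simp
      then show ?thesis unfolding g_def using False by simp real_asymp
    qed (simp add: g_def)
    then show "AE x in lebesgue_on D. (\<lambda>n. w x * g n (F x)) \<longlonglongrightarrow> w x * indicator {x. F x \<noteq> 0} x"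
      by (intro AE_I2 tendsto_mult tendsto_const) (simp add: indicator_def of_bool_def)
    show "AE x in lebesgue_on D. norm (w x * g n (F x)) \<le> \<bar>w x\<bar>" for n
      using bound[of n "F _"] by (intro AE_I2) (simp add: abs_mult mult_left_le)
  qed (use w_integrable in simp)
  then show ?thesis unfolding zero by (simp add: LIMSEQ_const_iff)
qed

lemma indicator_UN_limit:
  "(\<lambda>n. indicat_real (\<Union>i\<le>n. B i) x) \<longlonglongrightarrow> indicator (\<Union>i. B i) x"
    for B :: "nat \<Rightarrow> 'a set"
proof (cases "x \<in> (\<Union>i. B i)")
  case True
  then obtain i where i: "x \<in> B i" by blast
  have "\<forall>\<^sub>F n in sequentially. indicat_real (\<Union>i\<le>n. B i) x = indicator (\<Union>i. B i) x"
    using eventually_ge_at_top[of i] by eventually_elim (use i in \<open>auto simp: indicator_def\<close>)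
  then show ?thesis by (rule tendsto_eventually)
next
  case False
  then show ?thesis by (simp add: indicator_def)
qed

lemma integral_open_zero:
  assumes U: "open U" "U \<subseteq> D"
  shows "(\<integral>x. w x * indicator U x \<partial>lebesgue_on D) = 0"
proof (cases "U = {}")
  case False
  define \<B> where "\<B> = {ball c r | c r. r > 0 \<and> cball c r \<subseteq> U}"
  obtain \<B>' where \<B>': "\<B>' \<subseteq> \<B>" "countable \<B>'" "\<Union>\<B>' = \<Union>\<B>"
    using Lindelof[of \<B>] by (auto simp: \<B>_def)
  have "\<Union>\<B> = U"
  proof
    show "\<Union>\<B> \<subseteq> U" unfolding \<B>_def using ball_subset_cball by fastforce
    show "U \<subseteq> \<Union>\<B>"
    proof
      fix x assume "x \<in> U"
      then obtain r where "r > 0" "cball x r \<subseteq> U" using U(1) open_contains_cball by blast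
      then show "x \<in> \<Union>\<B>" unfolding \<B>_def by (auto intro!: exI[of _ "ball x r"])
    qed
  qed
  then have ne: "\<B>' \<noteq> {}" using \<B>' False by auto
  define B where "B = from_nat_into \<B>'"
  have range_B: "range B = \<B>'" unfolding B_def using ne \<B>'(2) by (rule range_from_nat_into)
  have "\<exists>F dF. C1c D F dF \<and> (\<forall>x. F x \<ge> 0) \<and> {x. F x \<noteq> 0} = B i" for i
  proof -
    have "B i \<in> \<B>" using range_B \<B>'(1) by auto
    then obtain c r where cr: "B i = ball c r" "r > 0" "cball c r \<subseteq> U" unfolding \<B>_def by blast
    have "cball c r \<subseteq> D" using cr(3) U(2) by (rule subset_trans)
    from C1c_bump[OF cr(2) this] show ?thesis unfolding cr(1) .
  qed
  then obtain F dF where F: "\<And>i. C1c D (F i) (dF i)" "\<And>i x. F i x \<ge> 0" "\<And>i. {x. F i x \<noteq> 0} = B i"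
    by metis
  have B_open: "open (B i)" for i
  proof -
    have "B i \<in> \<B>" using range_B \<B>'(1) by auto
    then show ?thesis unfolding \<B>_def by auto
  qed
  have finite_union: "(\<integral>x. w x * indicator (\<Union>i\<le>n. B i) x \<partial>lebesgue_on D) = 0" for n
  proof -
    have "(\<Sum>i\<le>n. F i x) \<noteq> 0 \<longleftrightarrow> (\<exists>i\<le>n. F i x \<noteq> 0)" for x
      using F(2) by (subst sum_nonneg_eq_0_iff) auto
    then have "{x. (\<Sum>i\<le>n. F i x) \<noteq> 0} = (\<Union>i\<le>n. B i)"
      unfolding F(3)[symmetric] by auto
    then show ?thesis using integral_support_zero[OF C1c_sum[of "{..n}" D F dF]] F(1) by simp
  qed
  have "(\<integral>x. w x * indicator (\<Union>i. B i) x \<partial>lebesgue_on D) = 0"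
    by (rule integral_indicator_limit[OF _ _ indicator_UN_limit finite_union]) (use B_open in auto)
  moreover have "(\<Union>i. B i) = U" using range_B \<B>'(3) \<open>\<Union>\<B> = U\<close> by simp
  ultimately show ?thesis by simp
qed simp

lemma integral_set_zero:
  assumes A: "A \<in> sets lebesgue" "A \<subseteq> D"
  shows "(\<integral>x. w x * indicator A x \<partial>lebesgue_on D) = 0"
proof -
  have "\<exists>T. open T \<and> A \<subseteq> T \<and> emeasure lebesgue (T - A) < ennreal (1 / Suc n)" for n
    using sets_lebesgue_outer_open[OF A(1), of "1 / Suc n"] by (metis of_nat_0_less_iff zero_less_Suc zero_less_divide_1_iff)
  then obtain T where T: "\<And>n. open (T n)" "\<And>n. A \<subseteq> T n" "\<And>n. emeasure lebesgue (T n - A) < ennreal (1 / Suc n)"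
    by metis
  define V where "V n = D \<inter> (\<Inter>i\<le>n. T i)" for n
  define G where "G = D \<inter> (\<Inter>i. T i)"
  have V_open: "open (V n)" for n unfolding V_def using D T by (intro open_Int open_INT) auto
  have G_set: "G \<in> sets lebesgue" unfolding G_def using D T(1)
    by (intro sets.Int sets.countable_INT') (auto intro!: borel_open sets_completionI_sets)
  have "(\<integral>x. w x * indicator G x \<partial>lebesgue_on D) = 0"
  proof (rule integral_indicator_limit[OF _ G_set])
    show "V n \<in> sets lebesgue" for n using V_open[of n] by auto
    show "(\<integral>x. w x * indicator (V n) x \<partial>lebesgue_on D) = 0" for n
      by (rule integral_open_zero[OF V_open]) (auto simp: V_def)
    show "(\<lambda>n. indicat_real (V n) x) \<longlonglongrightarrow> indicator G x" for x
    proof (cases "x \<in> G")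
      case True
      then show ?thesis by (simp add: V_def G_def indicator_def)
    next
      case False
      then have "\<exists>i. x \<notin> D \<inter> T i" by (auto simp: G_def)
      then obtain i where i: "x \<notin> D \<inter> T i" by blast
      have "\<forall>\<^sub>F n in sequentially. indicat_real (V n) x = indicator G x"
        using eventually_ge_at_top[of i] by eventually_elim (use False i in \<open>auto simp: V_def indicator_def\<close>)
      then show ?thesis by (rule tendsto_eventually)
    qed
  qed
  moreover have "AE x in lebesgue_on D. w x * indicator G x = w x * indicator A x"
  proof -
    have "emeasure lebesgue (G - A) \<le> ennreal \<epsilon>" if "\<epsilon> > 0" for \<epsilon>
    proof -
      obtain n where n: "1 / Suc n < \<epsilon>" using nat_approx_posE[OF \<open>\<epsilon> > 0\<close>] by auto
      have "emeasure lebesgue (G - A) \<le> emeasure lebesgue (T n - A)"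
        using A T(1)[of n] by (intro emeasure_mono) (auto simp: G_def)
      also have "\<dots> \<le> ennreal (1 / Suc n)" using T(3)[of n] by simp
      also have "\<dots> \<le> ennreal \<epsilon>" using n by (intro ennreal_leI) simp
      finally show ?thesis .
    qed
    then have "emeasure lebesgue (G - A) = 0"
      by (metis ennreal_le_epsilon add.left_neutral le_zero_eq)
    then have "G - A \<in> null_sets lebesgue" using G_set A(1) by (auto simp: null_sets_def)
    then have "AE x in lebesgue. x \<notin> G - A" by (rule AE_not_in)
    then have "AE x in lebesgue_on D. x \<notin> G - A" by (subst AE_restrict_space_iff) (auto simp: D_lebesgue)
    then show ?thesis
    proof eventually_elim
      case (elim x)
      have "A \<subseteq> G" using A T(2) by (auto simp: G_def)
      then show ?case using elim by (auto simp: indicator_def)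
    qed
  qed
  moreover have "indicat_real S \<in> borel_measurable (lebesgue_on D)" if "S \<in> sets lebesgue" for S
    using that by (intro measurable_restrict_space1 borel_measurable_indicator)
  note m = this
  ultimately show ?thesis
    using m[OF A(1)] m[OF G_set] by (subst integral_cong_AE[where g="\<lambda>x. w x * indicator G x"]) auto
qed

lemma w_le_zero: "AE x in lebesgue_on D. w x \<le> 0"
proof -
  let ?A = "{x \<in> space (lebesgue_on D). w x > 0}"
  have "?A \<in> sets (lebesgue_on D)" by measurable
  then have A: "?A \<in> sets lebesgue" using D_lebesgue by (simp add: sets_restrict_space_iff)
  have "(\<integral>x. w x * indicator ?A x \<partial>lebesgue_on D) = 0" using A by (rule integral_set_zero) auto
  moreover have "integrable (lebesgue_on D) (\<lambda>x. w x * indicator ?A x)"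
    using w_integrable \<open>?A \<in> sets (lebesgue_on D)\<close> by (intro integrable_real_mult_indicator)
  ultimately have "AE x in lebesgue_on D. w x * indicator ?A x = 0"
    by (subst (asm) integral_nonneg_eq_0_iff_AE) (auto simp: indicator_def)
  moreover have "AE x in lebesgue_on D. x \<in> space (lebesgue_on D)" by (rule AE_space)
  ultimately show ?thesis by eventually_elim (auto simp: indicator_def split: if_splits)
qed

end

lemma test_functions_dense:
  fixes D :: "'a::euclidean_space set"
  assumes D: "bounded D" "open D" and w: "square_integrable (lebesgue_on D) w"
    and orth: "\<And>\<psi> d\<psi>. C1c D \<psi> d\<psi> \<Longrightarrow> L2_inner (lebesgue_on D) w \<psi> = 0"
  shows "AE x in lebesgue_on D. w x = 0"
proof -
  have "AE x in lebesgue_on D. w x \<le> 0" by (rule w_le_zero[OF assms])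
  moreover have "AE x in lebesgue_on D. - w x \<le> 0"
    using orth by (intro w_le_zero[OF D square_integrable_minus[OF w]]) (simp add: L2_inner_def)
  ultimately show ?thesis by eventually_elim simp
qed

lemma H10_square_integrable:
  assumes "H10 D v dv"
  shows "square_integrable (lebesgue_on D) v" "square_integrable (lebesgue_on D) dv"
  using assms by (auto simp: H10_def L2_tendsto_def)

lemma eigenfunction_square_integrable:
  assumes "dirichlet_eigensystem D lam \<phi>" "k \<ge> 1"
  shows "square_integrable (lebesgue_on D) (\<phi> k)"
proof -
  have "dirichlet_eigenfunction D (lam k) (\<phi> k)" using assms by (simp add: dirichlet_eigensystem_def)
  then obtain dv where "H10 D (\<phi> k) dv" unfolding dirichlet_eigenfunction_def by blast
  then show ?thesis by (rule H10_square_integrable)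
qed

text \<open>
  \<open>V\<close> is the set of pairs \<open>(\<psi>, \<nabla>\<psi>)\<close> with a test function \<open>\<psi>\<close>, so that its closure is the graph of
  the weak gradient on \<open>H\<^sub>0\<^sup>1\<close>, to which \<open>eigenvector_orthogonal\<close> applies.
\<close>

proposition eigenfunctions_complete:
  fixes D :: "'a::euclidean_space set"
  assumes D: "bounded D" "open D" and eig: "dirichlet_eigensystem D lam \<phi>"
    and w: "square_integrable (lebesgue_on D) w"
    and orth: "\<And>k. k \<ge> 1 \<Longrightarrow> L2_inner (lebesgue_on D) w (\<phi> k) = 0"
  shows "AE x in lebesgue_on D. w x = 0"
proof (rule ccontr)
  assume neg: "\<not> ?thesis"
  have Dl: "D \<in> sets lebesgue" using D by auto
  let ?L = "lebesgue_on D"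
  define V where "V = {(ext_Lsq D \<psi>, ext_Lsq D d\<psi>) | \<psi> d\<psi>. C1c D \<psi> d\<psi>}"
  obtain \<psi>0 d\<psi>0 where test: "C1c D \<psi>0 d\<psi>0" "L2_inner ?L w \<psi>0 \<noteq> 0"
    using test_functions_dense[OF D w] neg by blast
  obtain C where C: "C > 0" "\<And>\<psi> d\<psi>. C1c D \<psi> d\<psi> \<Longrightarrow> (norm (ext_Lsq D \<psi>))\<^sup>2 \<le> C * (norm (ext_Lsq D d\<psi>))\<^sup>2"
    using poincare_inequality[OF D(1)] by blast
  interpret compact_form "closure V" C
  proof (rule compact_form_closure[OF _ C(1)])
    show "subspace V" unfolding V_def by (rule subspace_C1c[OF Dl])
    show "(norm v)\<^sup>2 \<le> C * (norm d)\<^sup>2" if "(v, d) \<in> V" for v d using that C(2) by (auto simp: V_def)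
    show "\<exists>E. finite E \<and> (\<forall>(v, d)\<in>V. (norm v)\<^sup>2 \<le> \<epsilon> * (norm d)\<^sup>2 + (\<Sum>e\<in>E. (v \<bullet> e)\<^sup>2))" if eps: "\<epsilon> > 0" for \<epsilon>
    proof -
      obtain E where E: "finite E" "\<forall>\<psi> d\<psi>. C1c D \<psi> d\<psi> \<longrightarrow>
          (norm (ext_Lsq D \<psi>))\<^sup>2 \<le> \<epsilon> * (norm (ext_Lsq D d\<psi>))\<^sup>2 + (\<Sum>e\<in>E. (ext_Lsq D \<psi> \<bullet> e)\<^sup>2)"
        using finite_rank_estimate[OF D eps] by blast
      then show ?thesis by (intro exI[of _ E]) (auto simp: V_def)
    qed
  qed
  have H10_closure: "(ext_Lsq D v, ext_Lsq D dv) \<in> closure V" if "H10 D v dv" for v dv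
  proof -
    obtain \<psi> d\<psi> where \<psi>: "\<And>n::nat. C1c D (\<psi> n) (d\<psi> n)" "L2_tendsto ?L \<psi> v" "L2_tendsto ?L d\<psi> dv"
      using \<open>H10 D v dv\<close> unfolding H10_def by blast
    have "(\<lambda>n. (ext_Lsq D (\<psi> n), ext_Lsq D (d\<psi> n))) \<longlonglongrightarrow> (ext_Lsq D v, ext_Lsq D dv)"
      by (intro tendsto_Pair ext_Lsq_tendsto[OF Dl] \<psi>)
    moreover have "(ext_Lsq D (\<psi> n), ext_Lsq D (d\<psi> n)) \<in> V" for n using \<psi>(1) by (auto simp: V_def)
    ultimately show ?thesis unfolding closure_sequential
      by (intro exI[of _ "\<lambda>n. (ext_Lsq D (\<psi> n), ext_Lsq D (d\<psi> n))"] conjI allI)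
  qed
  have closure_H10: "\<exists>v dv. H10 D v dv \<and> p = (ext_Lsq D v, ext_Lsq D dv)" if p: "p \<in> closure V" for p
  proof -
    obtain s where s: "\<And>n::nat. s n \<in> V" "s \<longlonglongrightarrow> p" using p unfolding closure_sequential by blast
    then have "\<exists>\<psi> d\<psi>. C1c D \<psi> d\<psi> \<and> s n = (ext_Lsq D \<psi>, ext_Lsq D d\<psi>)" for n
      using s(1)[of n] unfolding V_def by blast
    then obtain \<psi> d\<psi> where \<psi>: "\<And>n. C1c D (\<psi> n) (d\<psi> n)" "\<And>n. s n = (ext_Lsq D (\<psi> n), ext_Lsq D (d\<psi> n))"
      by metis
    have "(\<lambda>n. ext_Lsq D (\<psi> n)) \<longlonglongrightarrow> fst p" "(\<lambda>n. ext_Lsq D (d\<psi> n)) \<longlonglongrightarrow> snd p"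
      using tendsto_fst[OF s(2)] tendsto_snd[OF s(2)] by (simp_all add: \<psi>(2))
    note lims = this
    obtain v dv where "L2_tendsto ?L \<psi> v" "fst p = ext_Lsq D v" "L2_tendsto ?L d\<psi> dv" "snd p = ext_Lsq D dv"
    proof -
      obtain v where v: "L2_tendsto ?L \<psi> v" "fst p = ext_Lsq D v"
        by (rule ext_Lsq_limitE[OF Dl C1c_square_integrable(1)[OF \<psi>(1) Dl] lims(1)])
      obtain dv where dv: "L2_tendsto ?L d\<psi> dv" "snd p = ext_Lsq D dv"
        by (rule ext_Lsq_limitE[OF Dl C1c_square_integrable(2)[OF \<psi>(1) Dl] lims(2)])
      from v dv show thesis by (rule that)
    qed
    then have "H10 D v dv" "p = (ext_Lsq D v, ext_Lsq D dv)"
      unfolding H10_def using \<psi>(1) by (blast, simp add: prod_eq_iff)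
    then show ?thesis by blast
  qed
  define \<Phi> where "\<Phi> = (\<lambda>k. ext_Lsq D (\<phi> k)) ` {1..}"
  note H10_sq = H10_square_integrable and \<phi>_sq = eigenfunction_square_integrable[OF eig]
  have eigen: "\<exists>d \<mu>. (p, d) \<in> closure V \<and> (\<forall>(\<psi>, e)\<in>closure V. d \<bullet> e = \<mu> * (p \<bullet> \<psi>))" if "p \<in> \<Phi>" for p
  proof -
    obtain k where k: "k \<ge> 1" "p = ext_Lsq D (\<phi> k)" using \<open>p \<in> \<Phi>\<close> by (auto simp: \<Phi>_def)
    have "dirichlet_eigenfunction D (lam k) (\<phi> k)" using eig k(1) by (simp add: dirichlet_eigensystem_def)
    then obtain dv where dv: "H10 D (\<phi> k) dv"
      "\<And>\<psi> d\<psi>. C1c D \<psi> d\<psi> \<Longrightarrow> L2_inner ?L dv d\<psi> = lam k * L2_inner ?L (\<phi> k) \<psi>"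
      unfolding dirichlet_eigenfunction_def by blast
    let ?S = "{q. ext_Lsq D dv \<bullet> snd q = lam k * (p \<bullet> fst q)}"
    have "closure V \<subseteq> ?S"
    proof (rule closure_minimal)
      show "closed ?S" by (intro closed_Collect_eq continuous_intros)
      show "V \<subseteq> ?S"
        using dv(2) H10_sq[OF dv(1)] by (auto simp: V_def k(2) inner_ext_Lsq[OF Dl] C1c_square_integrable[OF _ Dl])
    qed
    then show ?thesis using H10_closure[OF dv(1)] k(2) by (intro exI[of _ "ext_Lsq D dv"] exI[of _ "lam k"]) auto
  qed
  have perp: "ext_Lsq D w \<bullet> p = 0" if "p \<in> \<Phi>" for p
    using that orth by (auto simp: \<Phi>_def inner_ext_Lsq[OF Dl w \<phi>_sq])
  have test_in: "(ext_Lsq D \<psi>0, ext_Lsq D d\<psi>0) \<in> closure V"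
    using closure_subset[of V] test(1) by (auto simp: V_def)
  have test_ne: "ext_Lsq D w \<bullet> ext_Lsq D \<psi>0 \<noteq> 0"
    using test by (simp add: inner_ext_Lsq[OF Dl w] C1c_square_integrable[OF _ Dl])
  have "\<exists>v d \<mu>. (v, d) \<in> closure V \<and> v \<noteq> 0 \<and> (\<forall>(\<psi>, e)\<in>closure V. d \<bullet> e = \<mu> * (v \<bullet> \<psi>)) \<and> (\<forall>\<phi>\<in>\<Phi>. v \<bullet> \<phi> = 0)"
    by (rule eigenvector_orthogonal[OF _ _ test_in test_ne]) (fact eigen, fact perp)
  then obtain v d \<mu> where v: "(v, d) \<in> closure V" "v \<noteq> 0"
      and eq: "\<forall>(\<psi>, e)\<in>closure V. d \<bullet> e = \<mu> * (v \<bullet> \<psi>)"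
        and v_perp: "\<forall>\<phi>\<in>\<Phi>. v \<bullet> \<phi> = 0"
    by (elim exE conjE)
  obtain v' dv' where v': "H10 D v' dv'" "v = ext_Lsq D v'" "d = ext_Lsq D dv'"
    using closure_H10[OF v(1)] by auto
  have "dirichlet_eigenfunction D \<mu> v'"
    unfolding dirichlet_eigenfunction_def
  proof (intro exI conjI allI impI)
    fix \<psi> d\<psi> assume \<psi>: "C1c D \<psi> d\<psi>"
    then have "(ext_Lsq D \<psi>, ext_Lsq D d\<psi>) \<in> closure V" using closure_subset[of V] by (auto simp: V_def)
    from bspec[OF eq this] show "L2_inner ?L dv' d\<psi> = \<mu> * L2_inner ?L v' \<psi>"
      using H10_sq[OF v'(1)] by (simp add: v' inner_ext_Lsq[OF Dl] C1c_square_integrable[OF \<psi> Dl])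
  qed (rule v'(1))
  moreover have "L2_inner ?L v' (\<phi> k) = 0" if "k \<ge> 1" for k
    using v_perp that H10_sq[OF v'(1)]
    by (auto simp: \<Phi>_def v' inner_ext_Lsq[OF Dl] \<phi>_sq)
  moreover have "\<forall>\<mu> v. dirichlet_eigenfunction D \<mu> v \<and> (\<forall>k\<ge>1. L2_inner ?L v (\<phi> k) = 0) \<longrightarrow> (AE x in ?L. v x = 0)"
    using eig unfolding dirichlet_eigensystem_def by (elim conjE)
  ultimately have "AE x in ?L. v' x = 0" by simp
  then have "v = 0" unfolding v'(2) using ext_Lsq_eq_0_iff[OF Dl H10_sq(1)[OF v'(1)]] by simp
  then show False using v(2) by simp
qed


section \<open>Wiener integrals of monotone functions\<close>

definition fbm_cov :: "real \<Rightarrow> real \<Rightarrow> real \<Rightarrow> real" where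
  "fbm_cov H t r = (t powr (2 * H) + r powr (2 * H) - \<bar>t - r\<bar> powr (2 * H)) / 2"

lemma gaussian_square_integrable:
  assumes "prob_space M" "gaussian_rv M X"
  shows "square_integrable M X"
proof -
  interpret prob_space M by fact
  have X: "X \<in> borel_measurable M" using assms(2) by (simp add: gaussian_rv_def)
  from assms(2) obtain m \<sigma> where "(\<sigma> = 0 \<and> (AE \<omega> in M. X \<omega> = m)) \<or>
      (\<sigma> > 0 \<and> distributed M lborel X (\<lambda>x. ennreal (normal_density m \<sigma> x)))"
    unfolding gaussian_rv_def by blast
  then have "integrable M (\<lambda>\<omega>. (X \<omega>)\<^sup>2)"
  proof
    assume "\<sigma> = 0 \<and> (AE \<omega> in M. X \<omega> = m)"
    then have "AE \<omega> in M. (X \<omega>)\<^sup>2 = m\<^sup>2" by auto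
    then show ?thesis using X by (subst integrable_cong_AE[where g="\<lambda>_. m\<^sup>2"]) auto
  next
    assume A: "\<sigma> > 0 \<and> distributed M lborel X (\<lambda>x. ennreal (normal_density m \<sigma> x))"
    then have \<sigma>: "\<sigma> > 0" by simp
    have "integrable lborel (\<lambda>x. normal_density m \<sigma> x * (x - m)\<^sup>2 + (2 * m) * (normal_density m \<sigma> x * (x - m)^1)
        + m\<^sup>2 * normal_density m \<sigma> x)"
      by (intro Bochner_Integration.integrable_add integrable_mult_right
          integrable_normal_moment[OF \<sigma>] integrable_normal_density[OF \<sigma>])
    moreover have "normal_density m \<sigma> x * (x - m)\<^sup>2 + (2 * m) * (normal_density m \<sigma> x * (x - m)^1)
        + m\<^sup>2 * normal_density m \<sigma> x = normal_density m \<sigma> x * x\<^sup>2" for x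
      by (simp add: power2_eq_square algebra_simps)
    ultimately have "integrable lborel (\<lambda>x. normal_density m \<sigma> x * x\<^sup>2)" by simp
    then show ?thesis using distributed_integrable[of M lborel X "normal_density m \<sigma>" "\<lambda>x. x\<^sup>2"] A by simp
  qed
  then show ?thesis using X by (simp add: square_integrable_def)
qed

lemma step_integral_Nil [simp]: "step_integral W [] \<omega> = 0"
  and step_integral_Cons [simp]: "step_integral W ((c, a, b) # p) \<omega> = c * (W b \<omega> - W a \<omega>) + step_integral W p \<omega>"
  by (simp_all add: step_integral_def)

lemma step_integral_append: "step_integral W (p @ q) \<omega> = step_integral W p \<omega> + step_integral W q \<omega>"
  by (induction p) (auto simp: step_integral_def)

lemma step_fun_append: "step_fun (p @ q) r = step_fun p r + step_fun q r"
  by (induction p) (auto simp: step_fun_def)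

definition step_neg :: "step \<Rightarrow> step" where "step_neg = map (\<lambda>(c, a, b). (- c, a, b))"

lemma step_integral_neg: "step_integral W (step_neg p) \<omega> = - step_integral W p \<omega>"
  by (induction p) (auto simp: step_integral_def step_neg_def)

lemma step_fun_neg: "step_fun (step_neg p) r = - step_fun p r"
  by (induction p) (auto simp: step_fun_def step_neg_def)

lemma step_on_Cons: "step_on t ((c, a, b) # p) \<longleftrightarrow> 0 \<le> a \<and> a \<le> b \<and> b \<le> t \<and> step_on t p"
  by (auto simp: step_on_def)

lemma step_on_append: "step_on t (p @ q) \<longleftrightarrow> step_on t p \<and> step_on t q"
  by (simp add: step_on_def ball_Un)

lemma step_on_neg: "step_on t p \<Longrightarrow> step_on t (step_neg p)"
  by (auto simp: step_on_def step_neg_def)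

text \<open>
  The common shape of \<open>step_integral\<close> and of the integral of a step function against a derivative
  \<open>F'\<close>; taking inner products with \<open>step_integral\<close> turns it into a \<open>step_sum\<close> of covariances.
\<close>

definition step_sum :: "step \<Rightarrow> (real \<Rightarrow> real) \<Rightarrow> real" where
  "step_sum p F = (\<Sum>(c, a, b)\<leftarrow>p. c * (F b - F a))"

lemma step_sum_Nil [simp]: "step_sum [] F = 0"
  and step_sum_Cons [simp]: "step_sum ((c, a, b) # p) F = c * (F b - F a) + step_sum p F"
  by (simp_all add: step_sum_def)

lemma step_fun_square_integrable: "square_integrable (lebesgue_on {0..t}) (step_fun p)"
proof (induction p)
  case Nil show ?case by (simp add: step_fun_def square_integrable_def)
next
  case (Cons x p)
  obtain c a b where x: "x = (c, a, b)" by (cases x)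
  have "square_integrable (lebesgue_on {0..t}) (\<lambda>r. indicat_real {a<..b} r)"
    unfolding square_integrable_def
  proof
    show m: "indicat_real {a<..b} \<in> borel_measurable (lebesgue_on {0..t})"
      by (intro measurable_restrict_space1 borel_measurable_indicator) simp
    show "integrable (lebesgue_on {0..t}) (\<lambda>r. (norm (indicat_real {a<..b} r))\<^sup>2)"
    proof (rule Bochner_Integration.integrable_bound[where f="\<lambda>_. 1::real"])
      show "integrable (lebesgue_on {0..t}) (\<lambda>_. 1::real)"
        by (simp add: integrable_restrict_space lmeasurable_interval)
      show "(\<lambda>r. (norm (indicat_real {a<..b} r))\<^sup>2) \<in> borel_measurable (lebesgue_on {0..t})"
        using m by measurable
    qed (auto simp: indicator_def)
  qed
  then have "square_integrable (lebesgue_on {0..t}) (\<lambda>r. c *\<^sub>R indicat_real {a<..b} r + step_fun p r)"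
    by (intro square_integrable_add square_integrable_scale Cons)
  then show ?case by (simp add: x step_fun_def)
qed

lemma continuous_square_integrable:
  fixes f :: "real \<Rightarrow> real"
  assumes "continuous_on {0..t} f"
  shows "square_integrable (lebesgue_on {0..t}) f"
proof -
  have "continuous_on {0..t} (\<lambda>x. (norm (f x))\<^sup>2)" using assms by (intro continuous_intros)
  then have "integrable (lebesgue_on {0..t}) (\<lambda>x. (norm (f x))\<^sup>2)"
    by (rule continuous_imp_integrable_real)
  moreover have "f \<in> borel_measurable (lebesgue_on {0..t})"
    using assms by (intro continuous_imp_measurable_on_sets_lebesgue) auto
  ultimately show ?thesis by (simp add: square_integrable_def)
qed

lemma step_fun_integral:
  assumes "step_on t p" and F: "\<And>x. (F has_real_derivative f x) (at x)" and f: "continuous_on UNIV f"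
  shows "L2_inner (lebesgue_on {0..t}) (step_fun p) f = step_sum p F"
  using assms(1)
proof (induction p)
  case Nil show ?case by (simp add: step_fun_def L2_inner_def)
next
  case (Cons x p)
  obtain c a b where x: "x = (c, a, b)" by (cases x)
  have ab: "0 \<le> a" "a \<le> b" "b \<le> t" and p: "step_on t p" using Cons.prems by (auto simp: x step_on_Cons)
  have one: "(\<integral>r. indicat_real {a<..b} r * f r \<partial>lebesgue_on {0..t}) = F b - F a"
    and int: "integrable (lebesgue_on {0..t}) (\<lambda>r. indicat_real {a<..b} r * f r)"
  proof -
    have fm: "f \<in> borel_measurable borel" using f by (rule borel_measurable_continuous_onI)
    have cont: "continuous_on {a..b} f" using f continuous_on_subset by blast
    have FTC: "has_bochner_integral lborel (\<lambda>x. f x * indicator {a..b} x) (F b - F a)"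
      using has_bochner_integral_FTC_Icc_real[of a b F f] ab F f
      by (auto simp: continuous_on_eq_continuous_at)
    then have L: "integrable lebesgue (\<lambda>x. f x * indicator {a..b} x)" "(\<integral>x. f x * indicator {a..b} x \<partial>lebesgue) = F b - F a"
      using fm by (auto simp: has_bochner_integral_iff integrable_completion integral_completion)
    have AE: "AE x in lebesgue. f x * indicator {a..b} x = indicator {0..t} x *\<^sub>R (indicat_real {a<..b} x * f x)"
    proof (rule AE_mp[OF _ AE_I2])
      show "AE x in lebesgue. x \<noteq> a" by (rule AE_completion) (rule AE_lborel_singleton)
    qed (use ab in \<open>auto simp: indicator_def\<close>)
    have m: "(\<lambda>x. indicator {0..t} x *\<^sub>R (indicat_real {a<..b} x * f x)) \<in> borel_measurable lebesgue"
      using fm by (intro measurable_completion) simp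
    have m': "(\<lambda>x. f x * indicator {a..b} x) \<in> borel_measurable lebesgue" using L(1) by auto
    show "integrable (lebesgue_on {0..t}) (\<lambda>r. indicat_real {a<..b} r * f r)"
      using L(1) integrable_cong_AE[OF m' m AE] by (subst integrable_restrict_space) auto
    show "(\<integral>r. indicat_real {a<..b} r * f r \<partial>lebesgue_on {0..t}) = F b - F a"
      using L(2) integral_cong_AE[OF m' m AE] by (subst integral_restrict_space) auto
  qed
  have fsq: "square_integrable (lebesgue_on {0..t}) f"
    by (rule continuous_square_integrable[OF continuous_on_subset[OF f]]) simp
  have "L2_inner (lebesgue_on {0..t}) (step_fun (x # p)) f
     = (\<integral>r. c * (indicat_real {a<..b} r * f r) + step_fun p r \<bullet> f r \<partial>lebesgue_on {0..t})"
    unfolding L2_inner_def by (intro Bochner_Integration.integral_cong refl) (simp add: x step_fun_def algebra_simps)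
  also have "\<dots> = c * (F b - F a) + step_sum p F"
    using int one square_integrable_inner[OF step_fun_square_integrable fsq, of p] Cons.IH[OF p]
    by (subst Bochner_Integration.integral_add) (auto simp: L2_inner_def)
  finally show ?case by (simp add: x)
qed


lemma step_sum_diff: "step_sum p (\<lambda>x. F x - G x) = step_sum p F - step_sum p G"
  by (induction p) (auto simp: algebra_simps)

lemma step_sum_tendsto_0:
  assumes "step_on t p" "\<And>x. 0 \<le> x \<Longrightarrow> x \<le> t \<Longrightarrow> (\<lambda>n. F n x) \<longlonglongrightarrow> 0"
  shows "(\<lambda>n. step_sum p (F n)) \<longlonglongrightarrow> 0"
  using assms(1)
proof (induction p)
  case (Cons x p)
  obtain c a b where x: "x = (c, a, b)" by (cases x)
  have "(\<lambda>n. c * (F n b - F n a) + step_sum p (F n)) \<longlonglongrightarrow> c * (0 - 0) + 0"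
    using Cons by (intro tendsto_intros assms(2)) (auto simp: x step_on_Cons)
  then show ?case by (simp add: x)
qed simp

lemma step_sum_cong:
  assumes "step_on t p" "\<And>x. 0 \<le> x \<Longrightarrow> x \<le> t \<Longrightarrow> F x = G x"
  shows "step_sum p F = step_sum p G"
  using assms(1) by (induction p) (auto simp: step_on_Cons assms(2))

lemma step_sum_has_integral:
  assumes "step_on t p" "\<And>y. 0 \<le> y \<Longrightarrow> y \<le> t \<Longrightarrow> (F y has_integral I y) S"
  shows "((\<lambda>x. step_sum p (\<lambda>y. F y x)) has_integral step_sum p I) S"
  using assms(1)
proof (induction p)
  case (Cons z p)
  obtain c a b where z: "z = (c, a, b)" by (cases z)
  have "((\<lambda>x. c * (F b x - F a x) + step_sum p (\<lambda>y. F y x)) has_integral c * (I b - I a) + step_sum p I) S"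
    using Cons by (intro has_integral_add has_integral_mult_right has_integral_diff assms(2)) (auto simp: z step_on_Cons)
  then show ?case by (simp add: z)
qed simp

text \<open>
  The covariance \<open>R(x, b)\<close> need not have a square-integrable derivative in \<open>x\<close> when \<open>H\<close> is small, but
  its averages over \<open>b\<close> are continuously differentiable in \<open>x\<close>, apart from the term \<open>x\<^bsup>2H\<^esup>\<close>, which does
  not depend on \<open>b\<close>.
\<close>

lemma fbm_cov_averages:
  assumes "H > 0"
  obtains G :: "real \<Rightarrow> real" where "\<And>x. (G has_real_derivative \<bar>x\<bar> powr (2 * H)) (at x)"
    and "\<And>x p q. 0 \<le> p \<Longrightarrow> p \<le> q \<Longrightarrow>
      (fbm_cov H x has_integral (x powr (2 * H) * (q - p) + (G q - G p) - (G (x - p) - G (x - q))) / 2) {p..q}"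
proof -
  have "continuous_on UNIV (\<lambda>x::real. \<bar>x\<bar> powr (2 * H))"
    using assms by (intro continuous_on_powr' continuous_intros) auto
  then have cont: "isCont (\<lambda>x::real. \<bar>x\<bar> powr (2 * H)) x" for x
    by (simp add: continuous_on_eq_continuous_at)
  then obtain G where G: "\<And>x::real. (G has_vector_derivative \<bar>x\<bar> powr (2 * H)) (at x)"
    using einterval_antiderivative[of "-\<infinity>" "\<infinity>" "\<lambda>x::real. \<bar>x\<bar> powr (2 * H)"] by auto
  show ?thesis
  proof (rule that)
    show DG: "(G has_real_derivative \<bar>x\<bar> powr (2 * H)) (at x)" for x
      using G[of x] by (simp add: has_real_derivative_iff_has_vector_derivative)
    show "(fbm_cov H x has_integral (x powr (2 * H) * (q - p) + (G q - G p) - (G (x - p) - G (x - q))) / 2) {p..q}"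
      if "0 \<le> p" "p \<le> q" for x p q
    proof -
      let ?A = "\<lambda>b. (x powr (2 * H) * b + G b + G (x - b)) / 2"
      have "(fbm_cov H x has_integral ?A q - ?A p) {p..q}"
      proof (rule fundamental_theorem_of_calculus)
        fix b assume b: "b \<in> {p..q}"
        have "((\<lambda>b. G (x - b)) has_real_derivative \<bar>x - b\<bar> powr (2 * H) * (- 1)) (at b within {p..q})"
          by (rule DERIV_chain2[of G, OF DG]) (auto intro!: derivative_eq_intros)
        then have "(?A has_real_derivative (x powr (2 * H) + \<bar>b\<bar> powr (2 * H) - \<bar>x - b\<bar> powr (2 * H)) / 2) (at b within {p..q})"
          by (auto intro!: derivative_eq_intros DG[THEN DERIV_subset])
        then show "(?A has_vector_derivative fbm_cov H x b) (at b within {p..q})"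
          using b that by (simp add: fbm_cov_def has_real_derivative_iff_has_vector_derivative)
      qed (use that in simp)
      moreover have "?A q - ?A p = (x powr (2 * H) * (q - p) + (G q - G p) - (G (x - p) - G (x - q))) / 2"
        unfolding diff_divide_distrib[symmetric] by (simp add: algebra_simps)
      ultimately show ?thesis by simp
    qed
  qed
qed

locale fbm =
  fixes M :: "'w measure" and W :: "real \<Rightarrow> 'w \<Rightarrow> real" and H :: real
  assumes prob: "prob_space M" and motion: "fractional_brownian_motion M H W" and H_pos: "0 < H"
begin

abbreviation "J \<equiv> step_integral W"

lemma W_square_integrable: assumes "t \<ge> 0" shows "square_integrable M (W t)"
proof -
  have "\<forall>S c. finite S \<and> S \<subseteq> {0..} \<longrightarrow> gaussian_rv M (\<lambda>\<omega>. \<Sum>t\<in>S. c t * W t \<omega>)"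
    using motion by (simp add: fractional_brownian_motion_def)
  from this[rule_format, of "{t}" "\<lambda>_. 1"] have "gaussian_rv M (W t)" using assms by simp
  then show ?thesis by (rule gaussian_square_integrable[OF prob])
qed

lemma W_covariance: "t \<ge> 0 \<Longrightarrow> r \<ge> 0 \<Longrightarrow> L2_inner M (W t) (W r) = fbm_cov H t r"
  using motion by (simp add: fractional_brownian_motion_def L2_inner_def fbm_cov_def)

lemma J_square_integrable: "step_on t p \<Longrightarrow> square_integrable M (J p)"
proof (induction p)
  case Nil show ?case using square_integrable_zero by (simp add: step_integral_def[abs_def])
next
  case (Cons x p)
  obtain c a b where x: "x = (c, a, b)" by (cases x)
  have "square_integrable M (\<lambda>\<omega>. c *\<^sub>R (W b \<omega> - W a \<omega>) + J p \<omega>)"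
    using Cons by (intro square_integrable_add square_integrable_scale square_integrable_diff W_square_integrable)
      (auto simp: x step_on_Cons)
  moreover have "J (x # p) = (\<lambda>\<omega>. c *\<^sub>R (W b \<omega> - W a \<omega>) + J p \<omega>)" by (auto simp: x)
  ultimately show ?case by simp
qed

lemma J_inner:
  assumes Z: "square_integrable M Z" and "step_on t p"
  shows "L2_inner M (J p) Z = step_sum p (\<lambda>x. L2_inner M (W x) Z)"
  using assms(2)
proof (induction p)
  case Nil show ?case by (simp add: L2_inner_def)
next
  case (Cons x p)
  obtain c a b where x: "x = (c, a, b)" by (cases x)
  have ab: "0 \<le> a" "0 \<le> b" and p: "step_on t p" using Cons.prems by (auto simp: x step_on_Cons)
  have "L2_inner M (J (x # p)) Z = L2_inner M (\<lambda>\<omega>. c *\<^sub>R (W b \<omega> - W a \<omega>) + J p \<omega>) Z"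
    by (simp add: x L2_inner_def)
  also have "\<dots> = L2_inner M (\<lambda>\<omega>. c *\<^sub>R (W b \<omega> - W a \<omega>)) Z + L2_inner M (J p) Z"
    using ab p Z by (intro L2_inner_add_left square_integrable_scale square_integrable_diff
        W_square_integrable J_square_integrable)
  also have "L2_inner M (\<lambda>\<omega>. c *\<^sub>R (W b \<omega> - W a \<omega>)) Z = c * (L2_inner M (W b) Z - L2_inner M (W a) Z)"
    unfolding L2_inner_scale_left
    using ab Z by (subst L2_inner_diff_left) (auto intro: W_square_integrable)
  finally show ?case using Cons.IH[OF p] by (simp add: x)
qed

lemma J_inner_W:
  assumes "step_on t p" "b \<ge> 0"
  shows "L2_inner M (J p) (W b) = step_sum p (\<lambda>x. fbm_cov H x b)"
  using assms by (subst J_inner[OF W_square_integrable[OF assms(2)] assms(1)])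
    (rule step_sum_cong[OF assms(1)], simp add: W_covariance)

lemma W_increment_norm:
  assumes "t \<ge> 0" "r \<ge> 0"
  shows "L2_norm M (\<lambda>\<omega>. W t \<omega> - W r \<omega>) = \<bar>t - r\<bar> powr H"
proof -
  note sq = W_square_integrable[OF assms(1)] W_square_integrable[OF assms(2)]
  have "L2_inner M (\<lambda>\<omega>. W t \<omega> - W r \<omega>) (\<lambda>\<omega>. W t \<omega> - W r \<omega>) = \<bar>t - r\<bar> powr (2 * H)"
    unfolding L2_inner_diff_left[OF sq square_integrable_diff[OF sq]] L2_inner_diff_right[OF sq sq(1)]
      L2_inner_diff_right[OF sq sq(2)]
    using assms by (simp add: W_covariance fbm_cov_def abs_minus_commute field_simps)
  also have "\<dots> = (\<bar>t - r\<bar> powr H)\<^sup>2" by (simp add: power2_eq_square flip: powr_add)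
  finally show ?thesis by (simp add: L2_norm_def)
qed

text \<open>
  The integral is closable for every Hurst index: if step functions tend to zero in \<open>L\<^sup>2\<close> while
  their integrals stay bounded, the integrals tend weakly to zero on the span of the process. Let
  \<open>F\<^sub>n(b)\<close> be the correlation of the \<open>n\<close>-th integral with \<open>W\<^sub>b\<close>. It is Hoelder continuous uniformly in
  \<open>n\<close>, and \<open>F\<^sub>n(0) = 0\<close>. The difference of its averages over \<open>[b - d, b]\<close>
    and \<open>[0, d]\<close> is the \<open>L\<^sup>2\<close>
  inner product of the step function with a fixed continuous function, because the terms \<open>x\<^bsup>2H\<^esup>\<close> of
  \<open>fbm_cov_averages\<close> cancel, and hence tends to zero. So \<open>limsup |F\<^sub>n(b)| \<le> 2 B d\<^sup>H\<close>
    for all small \<open>d > 0\<close>.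
\<close>

lemma weak_null_W:
  assumes p: "\<And>n. step_on T (p n)"
    and null: "(\<lambda>n. L2_norm (lebesgue_on {0..T}) (step_fun (p n))) \<longlonglongrightarrow> 0"
    and bound: "\<And>n. L2_norm M (J (p n)) \<le> B"
    and b: "0 \<le> b" "b \<le> T"
  shows "(\<lambda>n. L2_inner M (J (p n)) (W b)) \<longlonglongrightarrow> 0"
proof -
  have B: "B \<ge> 0" using bound[of 0] L2_norm_nonneg order_trans by blast
  define F where "F n x = L2_inner M (J (p n)) (W x)" for n x
  have F_step: "F n x = step_sum (p n) (\<lambda>y. fbm_cov H y x)" if "x \<ge> 0" for n x
    unfolding F_def by (rule J_inner_W[OF p that])
  have F_holder: "\<bar>F n x - F n y\<bar> \<le> B * \<bar>x - y\<bar> powr H" if "x \<ge> 0" "y \<ge> 0" for n x y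
  proof -
    note sq = W_square_integrable[OF that(1)] W_square_integrable[OF that(2)] J_square_integrable[OF p]
    have "F n x - F n y = L2_inner M (J (p n)) (\<lambda>\<omega>. W x \<omega> - W y \<omega>)"
      unfolding F_def by (rule L2_inner_diff_right[symmetric]) (rule sq)+
    also have "\<bar>\<dots>\<bar> \<le> L2_norm M (J (p n)) * L2_norm M (\<lambda>\<omega>. W x \<omega> - W y \<omega>)"
      by (rule L2_Cauchy_Schwarz) (intro sq square_integrable_diff)+
    also have "\<dots> \<le> B * \<bar>x - y\<bar> powr H"
      unfolding W_increment_norm[OF that] by (intro mult_right_mono bound) auto
    finally show ?thesis .
  qed
  have F0: "F n 0 = 0" for n
  proof -
    have "F n 0 = step_sum (p n) (\<lambda>x. 0)"
      unfolding F_def by (subst J_inner_W[OF p]) (auto intro!: step_sum_cong[OF p] simp: fbm_cov_def)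
    moreover have "step_sum q (\<lambda>x. 0) = 0" for q by (induction q) auto
    ultimately show ?thesis by simp
  qed
  obtain G where DG: "\<And>x. (G has_real_derivative \<bar>x\<bar> powr (2 * H)) (at x)"
    and avg: "\<And>x p q. 0 \<le> p \<Longrightarrow> p \<le> q \<Longrightarrow>
      (fbm_cov H x has_integral (x powr (2 * H) * (q - p) + (G q - G p) - (G (x - p) - G (x - q))) / 2) {p..q}"
    using fbm_cov_averages[OF H_pos] by blast
  have main: "\<exists>A. A \<longlonglongrightarrow> 0 \<and> (\<forall>n. d * \<bar>F n b\<bar> \<le> \<bar>A n\<bar> + 2 * (B * d powr H * d))" if d: "0 < d" "d \<le> b" for d
  proof -
    define I where "I p q x = (x powr (2 * H) * (q - p) + (G q - G p) - (G (x - p) - G (x - q))) / 2" for p q x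
    define \<Psi> where "\<Psi> x = I (b - d) b x - I 0 d x" for x
    define \<psi> where "\<psi> x = (- (\<bar>x - (b - d)\<bar> powr (2 * H)) + \<bar>x - b\<bar> powr (2 * H) + \<bar>x\<bar> powr (2 * H) - \<bar>x - d\<bar> powr (2 * H)) / 2" for x
    have \<Psi>: "(\<Psi> has_real_derivative \<psi> x) (at x)" for x
    proof -
      have shift: "((\<lambda>x. G (x - c)) has_real_derivative \<bar>x - c\<bar> powr (2 * H) * 1) (at x)" for c
        by (rule DERIV_chain2[of G, OF DG]) (auto intro!: derivative_eq_intros)
      have "\<Psi> = (\<lambda>x. ((G b - G (b - d)) - (G d - G 0) - G (x - (b - d)) + G (x - b) + G x - G (x - d)) / 2)"
        unfolding \<Psi>_def I_def by (auto simp: field_simps)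
      moreover have "((\<lambda>x. ((G b - G (b - d)) - (G d - G 0) - G (x - (b - d)) + G (x - b) + G x - G (x - d)) / 2)
          has_real_derivative \<psi> x) (at x)"
        unfolding \<psi>_def
        by (rule DERIV_cdivide) (rule derivative_eq_intros refl DG shift[of "b - d"] shift[of b] shift[of d] | simp)+
      ultimately show ?thesis by simp
    qed
    have \<psi>_cont: "continuous_on UNIV \<psi>"
      unfolding \<psi>_def using H_pos
      by (intro continuous_on_divide continuous_on_add continuous_on_diff continuous_on_minus continuous_on_powr'
          continuous_on_rabs continuous_on_id continuous_on_const) auto
    have \<psi>_sq: "square_integrable (lebesgue_on {0..T}) \<psi>"
      by (rule continuous_square_integrable[OF continuous_on_subset[OF \<psi>_cont]]) simp
    define A where "A n = step_sum (p n) \<Psi>" for n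
    have "A \<longlonglongrightarrow> 0"
    proof (rule Lim_null_comparison)
      show "\<forall>\<^sub>F n in sequentially. norm (A n) \<le> L2_norm (lebesgue_on {0..T}) (step_fun (p n)) * L2_norm (lebesgue_on {0..T}) \<psi>"
        unfolding A_def step_fun_integral[OF p \<Psi> \<psi>_cont, symmetric] real_norm_def
        by (intro always_eventually allI L2_Cauchy_Schwarz step_fun_square_integrable \<psi>_sq)
      show "(\<lambda>n. L2_norm (lebesgue_on {0..T}) (step_fun (p n)) * L2_norm (lebesgue_on {0..T}) \<psi>) \<longlonglongrightarrow> 0"
        using tendsto_mult[OF null tendsto_const] by simp
    qed
    moreover have "d * \<bar>F n b\<bar> \<le> \<bar>A n\<bar> + 2 * (B * d powr H * d)" for n
    proof -
      have Fint: "(F n has_integral step_sum (p n) (I l r)) {l..r}" if "0 \<le> l" "l \<le> r" for l r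
      proof -
        have "((\<lambda>x. step_sum (p n) (\<lambda>y. fbm_cov H y x)) has_integral step_sum (p n) (I l r)) {l..r}"
          unfolding I_def by (rule step_sum_has_integral[OF p]) (rule avg[OF that])
        then show ?thesis by (rule has_integral_eq[rotated]) (use that in \<open>auto simp: F_step\<close>)
      qed
      have 1: "\<bar>step_sum (p n) (I 0 d)\<bar> \<le> B * d powr H * d"
      proof -
        have "norm (step_sum (p n) (I 0 d)) \<le> (B * d powr H) * measure lborel {0..d}"
        proof (rule has_integral_bound_real[OF _ finite.emptyI])
          show "(F n has_integral step_sum (p n) (I 0 d)) {0..d}" using d by (intro Fint) auto
          show "norm (F n x) \<le> B * d powr H" if "x \<in> {0..d} - {}" for x
          proof -
            have "norm (F n x) \<le> B * x powr H" using F_holder[of x 0 n] F0[of n] that by simp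
            also have "\<dots> \<le> B * d powr H" using that B H_pos by (intro mult_left_mono powr_mono2) auto
            finally show ?thesis .
          qed
        qed (use B in simp)
        then show ?thesis using d by simp
      qed
      have 2: "\<bar>d * F n b - step_sum (p n) (I (b - d) b)\<bar> \<le> B * d powr H * d"
      proof -
        have "norm (d * F n b - step_sum (p n) (I (b - d) b)) \<le> (B * d powr H) * measure lborel {b-d..b}"
        proof (rule has_integral_bound_real[OF _ finite.emptyI])
          have "((\<lambda>x. F n b) has_integral measure lborel {b-d..b} *\<^sub>R F n b) {b-d..b}"
            by (rule has_integral_const_real)
          then have "((\<lambda>x. F n b - F n x) has_integral measure lborel {b-d..b} *\<^sub>R F n b - step_sum (p n) (I (b - d) b)) {b-d..b}"
            using d by (intro has_integral_diff Fint) auto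
          then show "((\<lambda>x. F n b - F n x) has_integral d * F n b - step_sum (p n) (I (b - d) b)) {b-d..b}"
            using d by simp
          show "norm (F n b - F n x) \<le> B * d powr H" if "x \<in> {b-d..b} - {}" for x
          proof -
            have "norm (F n b - F n x) \<le> B * \<bar>b - x\<bar> powr H" using F_holder[of b x n] that b d by simp
            also have "\<dots> \<le> B * d powr H" using that B H_pos by (intro mult_left_mono powr_mono2) auto
            finally show ?thesis .
          qed
        qed (use B in simp)
        then show ?thesis using d by simp
      qed
      have "A n = step_sum (p n) (I (b - d) b) - step_sum (p n) (I 0 d)"
        unfolding A_def \<Psi>_def by (rule step_sum_diff)
      then have "\<bar>d * F n b\<bar> \<le> \<bar>A n\<bar> + 2 * (B * d powr H * d)" using 1 2 by linarith
      then show ?thesis using d by (simp add: abs_mult)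
    qed
    ultimately show ?thesis by blast
  qed
  show ?thesis
  proof (cases "b = 0")
    case True
    then show ?thesis using F0 by (simp add: F_def)
  next
    case False
    then have b0: "b > 0" using b by simp
    show ?thesis
    proof (rule LIMSEQ_I)
      fix e :: real assume e: "e > 0"
      have "((\<lambda>d. 2 * B * d powr H) \<longlongrightarrow> 2 * B * 0 powr H) (at_right 0)"
        by (intro tendsto_intros tendsto_powr' ) (use H_pos in \<open>auto simp: eventually_at_right_less intro: eventually_mono[OF eventually_at_right_less]\<close>)
      then have "\<forall>\<^sub>F d in at_right 0. 2 * B * d powr H < e / 2"
        by (rule order_tendstoD(2)) (use e in simp)
      moreover have "\<forall>\<^sub>F d in at_right (0::real). 0 < d \<and> d < b"
        using eventually_at_right_less[of 0] eventually_at_right_real[OF b0] by (auto elim: eventually_elim2)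
      ultimately have "\<forall>\<^sub>F d in at_right (0::real). 2 * B * d powr H < e / 2 \<and> 0 < d \<and> d < b"
        by (rule eventually_conj)
      then obtain d where d: "2 * B * d powr H < e / 2" "0 < d" "d < b"
        using eventually_happens'[of "at_right (0::real)"] trivial_limit_at_right_real by blast
      obtain A where A: "A \<longlonglongrightarrow> 0" "\<And>n. d * \<bar>F n b\<bar> \<le> \<bar>A n\<bar> + 2 * (B * d powr H * d)"
        using main[of d] d by auto
      obtain N where N: "\<And>n. n \<ge> N \<Longrightarrow> \<bar>A n\<bar> < d * (e / 2)"
        using LIMSEQ_D[OF A(1), of "d * (e / 2)"] d e by auto
      have "norm (L2_inner M (J (p n)) (W b) - 0) < e" if "n \<ge> N" for n
      proof -
        have "d * \<bar>F n b\<bar> < d * (e / 2) + d * (2 * B * d powr H)"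
          using A(2)[of n] N[OF that] by (simp add: mult_ac)
        also have "\<dots> < d * (e / 2) + d * (e / 2)" using d by (intro add_strict_left_mono mult_strict_left_mono) auto
        also have "\<dots> = d * e" by simp
        finally show ?thesis using d by (simp add: F_def)
      qed
      then show "\<exists>no. \<forall>n\<ge>no. norm (L2_inner M (J (p n)) (W b) - 0) < e" by blast
    qed
  qed
qed


lemma weak_null_closure:
  assumes p: "\<And>n. step_on T (p n)"
    and null: "(\<lambda>n. L2_norm (lebesgue_on {0..T}) (step_fun (p n))) \<longlonglongrightarrow> 0"
    and bound: "\<And>n. L2_norm M (J (p n)) \<le> B"
    and q: "\<And>n. step_on T (q n)" and Z: "L2_tendsto M (\<lambda>n. J (q n)) Z"
  shows "(\<lambda>n. L2_inner M (J (p n)) Z) \<longlonglongrightarrow> 0"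
proof (rule LIMSEQ_I)
  fix e :: real assume e: "e > 0"
  have B: "B \<ge> 0" using bound[of 0] L2_norm_nonneg order_trans by blast
  have Zsq: "square_integrable M Z" and lim: "(\<lambda>n. L2_norm M (\<lambda>x. J (q n) x - Z x)) \<longlonglongrightarrow> 0"
    using Z by (auto simp: L2_tendsto_def)
  have "(\<lambda>n. B * L2_norm M (\<lambda>x. J (q n) x - Z x)) \<longlonglongrightarrow> 0"
    using tendsto_mult[OF tendsto_const lim, of B] by simp
  from LIMSEQ_D[OF this, of "e / 2"] e obtain m where "norm (B * L2_norm M (\<lambda>x. J (q m) x - Z x) - 0) < e / 2"
    by auto
  then have m: "B * L2_norm M (\<lambda>x. J (q m) x - Z x) < e / 2" by (simp only: diff_0_right real_norm_def abs_less_iff)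
  have "(\<lambda>n. step_sum (q m) (\<lambda>x. L2_inner M (W x) (J (p n)))) \<longlonglongrightarrow> 0"
    unfolding L2_inner_commute[of M "W _"]
    by (rule step_sum_tendsto_0[OF q]) (rule weak_null_W[OF p null bound])
  then have "(\<lambda>n. L2_inner M (J (p n)) (J (q m))) \<longlonglongrightarrow> 0"
    by (simp add: J_inner[OF J_square_integrable[OF p] q, symmetric] L2_inner_commute[of M "J (q m)"])
  from LIMSEQ_D[OF this, of "e / 2"] obtain N where
    N: "\<And>n. n \<ge> N \<Longrightarrow> \<bar>L2_inner M (J (p n)) (J (q m))\<bar> < e / 2" using e by auto
  have "norm (L2_inner M (J (p n)) Z - 0) < e" if "n \<ge> N" for n
  proof -
    note sq = J_square_integrable[OF p, of n] J_square_integrable[OF q, of m] Zsq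
    have "L2_inner M (J (p n)) (J (q m)) - L2_inner M (J (p n)) Z = L2_inner M (J (p n)) (\<lambda>x. J (q m) x - Z x)"
      by (rule L2_inner_diff_right[symmetric]) (rule sq)+
    moreover have "\<bar>L2_inner M (J (p n)) (\<lambda>x. J (q m) x - Z x)\<bar> \<le> L2_norm M (J (p n)) * L2_norm M (\<lambda>x. J (q m) x - Z x)"
      by (rule L2_Cauchy_Schwarz) (intro sq square_integrable_diff)+
    moreover have "\<dots> \<le> B * L2_norm M (\<lambda>x. J (q m) x - Z x)"
      by (intro mult_right_mono bound L2_norm_nonneg)
    ultimately have "\<bar>L2_inner M (J (p n)) (J (q m)) - L2_inner M (J (p n)) Z\<bar> < e / 2" using m by linarith
    then show ?thesis using N[OF that] unfolding real_norm_def diff_0_right by linarith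
  qed
  then show "\<exists>no. \<forall>n\<ge>no. norm (L2_inner M (J (p n)) Z - 0) < e" by blast
qed

lemma J_inner_J:
  assumes p: "step_on T p" and q: "step_on T q"
  shows "L2_inner M (J p) (J q) = step_sum p (\<lambda>x. step_sum q (\<lambda>y. fbm_cov H y x))"
  unfolding J_inner[OF J_square_integrable[OF q] p]
proof (rule step_sum_cong[OF p])
  fix x :: real assume "0 \<le> x"
  then show "L2_inner M (W x) (J q) = step_sum q (\<lambda>y. fbm_cov H y x)"
    by (subst L2_inner_commute) (rule J_inner_W[OF q])
qed

end

text \<open>
  The step function with the values of \<open>v\<close> at the left end points of the uniform grid. Summation by
  parts (\<open>step_sum_grid_parts\<close>) writes it as the combination of the indicators of \<open>(T i / n, T]\<close> with
  the increments of \<open>v\<close> as coefficients, which are nonnegative for monotone \<open>v\<close>.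
\<close>

definition grid_step :: "(real \<Rightarrow> real) \<Rightarrow> real \<Rightarrow> nat \<Rightarrow> step" where
  "grid_step v T n = map (\<lambda>i. (v (T * real i / real n), T * real i / real n, T * real (Suc i) / real n)) [0..<n]"

definition grid_weight :: "(real \<Rightarrow> real) \<Rightarrow> real \<Rightarrow> nat \<Rightarrow> nat \<Rightarrow> real" where
  "grid_weight v T n i = (if i = 0 then v 0 else v (T * real i / real n) - v (T * real (i - 1) / real n))"

lemma grid_le:
  assumes "T \<ge> 0" "i \<le> n" shows "T * real i / real n \<le> T"
proof (cases "n = 0")
  case False
  have "T * real i \<le> T * real n" using assms by (intro mult_left_mono) auto
  then show ?thesis using False by (simp add: divide_le_eq)
qed (use assms in simp)

lemma grid_step_on:
  assumes "T \<ge> 0" shows "step_on T (grid_step v T n)"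
proof -
  have "T * real i / real n \<le> T * real (Suc i) / real n" for i
    using assms by (intro divide_right_mono mult_left_mono) auto
  moreover have "T * real (Suc i) / real n \<le> T" if "i < n" for i
    using grid_le[OF assms, of "Suc i" n] that by simp
  ultimately show ?thesis
    using assms by (auto simp: step_on_def grid_step_def simp del: of_nat_Suc)
qed

lemma step_sum_grid: "step_sum (grid_step v T n) F = (\<Sum>i<n. v (T * real i / real n) * (F (T * real (Suc i) / real n) - F (T * real i / real n)))"
  by (simp add: step_sum_def grid_step_def o_def sum_list_sum_nth atLeast0LessThan case_prod_unfold)

lemma step_sum_grid_parts:
  assumes n: "n > 0"
  shows "step_sum (grid_step v T n) F = (\<Sum>i<n. grid_weight v T n i * (F T - F (T * real i / real n)))"
proof -
  have "(\<Sum>i<m. a i * (b (Suc i) - b i)) = (\<Sum>i<m. (if i = 0 then a 0 else a i - a (i - 1)) * (b m - b i))"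
    for a b :: "nat \<Rightarrow> real" and m
  proof (induction m)
    case (Suc m)
    have tel: "(\<Sum>i<Suc m. (if i = 0 then a 0 else a i - a (i - 1))) = a m" for m
      by (induction m) auto
    have "(\<Sum>i<Suc m. (if i = 0 then a 0 else a i - a (i - 1)) * (b (Suc m) - b i))
        = (\<Sum>i<Suc m. (if i = 0 then a 0 else a i - a (i - 1)) * (b m - b i))
          + (\<Sum>i<Suc m. (if i = 0 then a 0 else a i - a (i - 1)) * (b (Suc m) - b m))"
      unfolding sum.distrib[symmetric] by (intro sum.cong refl) (simp add: algebra_simps)
    also have "(\<Sum>i<Suc m. (if i = 0 then a 0 else a i - a (i - 1)) * (b (Suc m) - b m)) = a m * (b (Suc m) - b m)"
      unfolding sum_distrib_right[symmetric] tel ..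
    finally show ?case using Suc by simp
  qed simp
  from this[of "\<lambda>i. v (T * real i / real n)" "\<lambda>i. F (T * real i / real n)" n]
  show ?thesis using n unfolding step_sum_grid grid_weight_def
    by (simp add: of_nat_diff Suc_le_eq cong: sum.cong if_cong)
qed

lemma grid_weight_sum:
  assumes "n > 0" shows "(\<Sum>i<n. grid_weight v T n i) = v (T * real (n - 1) / real n)"
proof -
  have "(\<Sum>i<Suc m. grid_weight v T n i) = v (T * real m / real n)" for m
    by (induction m) (auto simp: grid_weight_def)
  from this[of "n - 1"] show ?thesis using assms by (simp add: of_nat_diff Suc_le_eq)
qed

lemma grid_weight_nonneg:
  assumes "T \<ge> 0" "v 0 \<ge> 0" and mono: "mono_on {0..T} v" and "i < n"
  shows "grid_weight v T n i \<ge> 0"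
proof (cases "i = 0")
  case False
  have "v (T * real (i - 1) / real n) \<le> v (T * real i / real n)"
  proof (rule mono_onD[OF mono])
    show "T * real (i - 1) / real n \<le> T * real i / real n"
      using assms(1) by (intro divide_right_mono mult_left_mono) auto
  qed (use assms(1,4) grid_le[of T i n] grid_le[of T "i - 1" n] in auto)
  then show ?thesis using False by (simp add: grid_weight_def)
qed (use assms in \<open>simp add: grid_weight_def\<close>)

lemma step_fun_grid:
  assumes T: "T > 0" and n: "n > 0" and r: "0 < r" "r \<le> T"
  obtains i where "i < n" "T * real i / real n < r" "r \<le> T * real (Suc i) / real n" "step_fun (grid_step v T n) r = v (T * real i / real n)"
proof -
  define i where "i = nat (\<lceil>r * real n / T\<rceil> - 1)"
  have pos: "r * real n / T > 0" using assms by simp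
  have c: "\<lceil>r * real n / T\<rceil> \<ge> 1" using pos by (simp add: one_le_ceiling)
  have i: "real i = of_int \<lceil>r * real n / T\<rceil> - 1" unfolding i_def using c by simp
  have lo: "real i < r * real n / T" unfolding i by linarith
  have hi: "r * real n / T \<le> real i + 1" unfolding i by linarith
  have rn: "r * real n / T \<le> n"
    using mult_right_mono[OF r(2), of "real n"] T by (simp add: divide_le_eq mult.commute)
  have "i < n" using lo rn by linarith
  have l: "T * real i / real n < r" using lo T n by (simp add: field_simps)
  have h: "r \<le> T * real (Suc i) / real n" using hi T n by (simp add: field_simps)
  have "step_fun (grid_step v T n) r = (\<Sum>j<n. v (T * real j / real n) * indicat_real {T * real j / real n<..T * real (Suc j) / real n} r)"
    by (simp add: step_fun_def grid_step_def o_def sum_list_sum_nth atLeast0LessThan case_prod_unfold)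
  also have "\<dots> = (\<Sum>j<n. if j = i then v (T * real i / real n) else 0)"
  proof (rule sum.cong[OF refl])
    fix j assume "j \<in> {..<n}"
    show "v (T * real j / real n) * indicat_real {T * real j / real n<..T * real (Suc j) / real n} r = (if j = i then v (T * real i / real n) else 0)"
    proof (cases "j = i")
      case True then show ?thesis using l h by (simp add: indicator_def)
    next
      case False
      have "\<not> (T * real j / real n < r \<and> r \<le> T * real (Suc j) / real n)"
      proof
        assume A: "T * real j / real n < r \<and> r \<le> T * real (Suc j) / real n"
        then have "real j < r * real n / T" "r * real n / T \<le> real j + 1" using T n by (auto simp: field_simps)
        then have "real j < real i + 1" "real i < real j + 1" using lo hi by linarith+
        then show False using False by linarith
      qed
      then show ?thesis using False by (simp add: indicator_def)
    qed
  qed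
  also have "\<dots> = v (T * real i / real n)" using \<open>i < n\<close> by simp
  finally show ?thesis using that \<open>i < n\<close> l h by blast
qed

lemma grid_step_tendsto:
  assumes T: "T > 0" and cont: "continuous_on {0..T} v"
  shows "L2_tendsto (lebesgue_on {0..T}) (\<lambda>n. step_fun (grid_step v T (Suc n))) v"
proof -
  let ?L = "lebesgue_on {0..T}"
  let ?s = "\<lambda>n. step_fun (grid_step v T (Suc n))"
  have vsq: "square_integrable ?L v" using cont by (rule continuous_square_integrable)
  have uc: "uniformly_continuous_on {0..T} v" using cont by (rule compact_uniformly_continuous) simp
  have space: "space ?L = {0..T}" by simp
  have "(\<lambda>n. L2_norm ?L (\<lambda>x. ?s n x - v x)) \<longlonglongrightarrow> 0"
  proof (rule LIMSEQ_I)
    fix e :: real assume e: "e > 0"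
    define \<eta> where "\<eta> = e / (2 * sqrt T)"
    have \<eta>: "\<eta> > 0" using e T by (simp add: \<eta>_def)
    obtain d where d: "d > 0" "\<And>x y. x \<in> {0..T} \<Longrightarrow> y \<in> {0..T} \<Longrightarrow> dist y x < d \<Longrightarrow> dist (v y) (v x) < \<eta>"
      using uc \<eta> unfolding uniformly_continuous_on_def by metis
    obtain N where N: "T / real (Suc N) < d"
      using nat_approx_posE[of "d / T"] d T by (auto simp: field_simps)
    have "norm (L2_norm ?L (\<lambda>x. ?s n x - v x) - 0) < e" if "n \<ge> N" for n
    proof -
      have mesh: "T / real (Suc n) < d"
      proof -
        have "T / real (Suc n) \<le> T / real (Suc N)" using that T by (intro divide_left_mono) auto
        then show ?thesis using N by simp
      qed
      have pw: "\<bar>?s n x - v x\<bar> \<le> \<eta>" if x: "0 < x" "x \<le> T" for x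
      proof -
        obtain i where i: "i < Suc n" "T * real i / real (Suc n) < x" "x \<le> T * real (Suc i) / real (Suc n)" "?s n x = v (T * real i / real (Suc n))"
          using step_fun_grid[OF T zero_less_Suc x, where v=v] by blast
        have "0 \<le> T * real i / real (Suc n)" using T by simp
        moreover have "x - T * real i / real (Suc n) \<le> T / real (Suc n)"
        proof -
          have "T * real (Suc i) / real (Suc n) = T * real i / real (Suc n) + T / real (Suc n)"
            by (simp add: distrib_left add_divide_distrib)
          then show ?thesis using i(3) by linarith
        qed
        ultimately have "dist (v (T * real i / real (Suc n))) (v x) < \<eta>"
          using i(2) x mesh by (intro d(2)) (auto simp: dist_real_def)
        then show ?thesis unfolding i(4) by (simp add: dist_real_def)
      qed
      have dsq: "square_integrable ?L (\<lambda>x. ?s n x - v x)"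
        by (rule square_integrable_diff[OF step_fun_square_integrable vsq])
      have "L2_inner ?L (\<lambda>x. ?s n x - v x) (\<lambda>x. ?s n x - v x) \<le> (\<integral>x. \<eta>\<^sup>2 \<partial>?L)"
        unfolding L2_inner_def
      proof (rule integral_mono_AE[OF square_integrable_inner[OF dsq dsq]])
        show "integrable ?L (\<lambda>x. \<eta>\<^sup>2)" by (rule continuous_imp_integrable_real) simp
        have "AE x in lebesgue. x \<noteq> 0" by (rule AE_completion) (rule AE_lborel_singleton)
        then have "AE x in ?L. x \<noteq> 0" by (subst AE_restrict_space_iff) auto
        moreover have "AE x in ?L. x \<in> {0..T}" by (rule AE_I2) simp
        ultimately show "AE x in ?L. (?s n x - v x) \<bullet> (?s n x - v x) \<le> \<eta>\<^sup>2"
        proof eventually_elim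
          case (elim x)
          then have "\<bar>?s n x - v x\<bar> \<le> \<eta>" by (intro pw) auto
          then have "\<bar>?s n x - v x\<bar>\<^sup>2 \<le> \<eta>\<^sup>2" by (intro power_mono) auto
          then show ?case by (simp add: power2_eq_square)
        qed
      qed
      also have "\<dots> = T * \<eta>\<^sup>2" using T by (simp add: measure_restrict_space)
      also have "\<dots> = (e / 2)\<^sup>2"
      proof -
        have "\<eta>\<^sup>2 = (e / 2)\<^sup>2 / T" unfolding \<eta>_def power_divide power_mult_distrib using T by simp
        then show ?thesis using T by simp
      qed
      finally have "(L2_norm ?L (\<lambda>x. ?s n x - v x))\<^sup>2 \<le> (e / 2)\<^sup>2" by (simp add: L2_norm_sq)
      then have "L2_norm ?L (\<lambda>x. ?s n x - v x) \<le> e / 2" by (rule power2_le_imp_le) (use e in simp)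
      then show ?thesis using e L2_norm_nonneg[of ?L "\<lambda>x. ?s n x - v x"] by simp
    qed
    then show "\<exists>no. \<forall>n\<ge>no. norm (L2_norm ?L (\<lambda>x. ?s n x - v x) - 0) < e" by blast
  qed
  then show ?thesis unfolding L2_tendsto_def using vsq step_fun_square_integrable by blast
qed


context fbm
begin

text \<open>
  The covariance of \<open>W\<^sub>T - W\<^sub>a\<close> and \<open>W\<^sub>T - W\<^sub>b\<close>.
\<close>

definition incr_cov :: "real \<Rightarrow> real \<Rightarrow> real \<Rightarrow> real" where
  "incr_cov T a b = ((T - a) powr (2 * H) + (T - b) powr (2 * H) - \<bar>a - b\<bar> powr (2 * H)) / 2"

lemma incr_cov_nonneg:
  assumes "a \<le> T" "b \<le> T" shows "incr_cov T a b \<ge> 0"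
proof -
  have "\<bar>a - b\<bar> powr (2 * H) \<le> max (T - a) (T - b) powr (2 * H)"
    using assms H_pos by (intro powr_mono2) auto
  also have "\<dots> \<le> (T - a) powr (2 * H) + (T - b) powr (2 * H)" by (auto simp: max_def)
  finally show ?thesis by (simp add: incr_cov_def)
qed

lemma incr_cov_le:
  assumes "0 \<le> a" "a \<le> T" "0 \<le> b" "b \<le> T" shows "incr_cov T a b \<le> T powr (2 * H)"
proof -
  have "(T - a) powr (2 * H) \<le> T powr (2 * H)" "(T - b) powr (2 * H) \<le> T powr (2 * H)"
    using assms H_pos by (auto intro!: powr_mono2)
  moreover have "\<bar>a - b\<bar> powr (2 * H) \<ge> 0" by simp
  ultimately have "(T - a) powr (2 * H) + (T - b) powr (2 * H) - \<bar>a - b\<bar> powr (2 * H) \<le> 2 * T powr (2 * H)"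
    by linarith
  then show ?thesis by (simp add: incr_cov_def)
qed

lemma grid_inner:
  assumes T: "T \<ge> 0" and "n > 0" "m > 0"
  shows "L2_inner M (J (grid_step v T n)) (J (grid_step w T m))
    = (\<Sum>i<n. \<Sum>j<m. grid_weight v T n i * grid_weight w T m j * incr_cov T (T * real i / real n) (T * real j / real m))"
proof -
  have alg: "(fbm_cov H T T - fbm_cov H b T) - (fbm_cov H T a - fbm_cov H b a) = incr_cov T a b"
    if "a \<le> T" "b \<le> T" for a b
    using that by (simp add: fbm_cov_def incr_cov_def field_simps abs_minus_commute)
  have "L2_inner M (J (grid_step v T n)) (J (grid_step w T m))
     = (\<Sum>i<n. \<Sum>j<m. grid_weight v T n i * grid_weight w T m j *
         ((fbm_cov H T T - fbm_cov H (T * real j / real m) T)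
           - (fbm_cov H T (T * real i / real n) - fbm_cov H (T * real j / real m) (T * real i / real n))))"
    unfolding J_inner_J[OF grid_step_on[OF T] grid_step_on[OF T]] step_sum_grid_parts[OF assms(2)] step_sum_grid_parts[OF assms(3)]
    by (simp add: sum_subtractf[symmetric] sum_distrib_left right_diff_distrib mult.assoc)
  also have "\<dots> = (\<Sum>i<n. \<Sum>j<m. grid_weight v T n i * grid_weight w T m j * incr_cov T (T * real i / real n) (T * real j / real m))"
    by (intro sum.cong refl) (subst alg, auto intro!: grid_le[OF T])
  finally show ?thesis .
qed

lemma grid_inner_ge:
  assumes T: "T > 0" and n: "n > 0" "m > 0"
    and v: "v 0 \<ge> 0" "mono_on {0..T} v"
    and w: "w 0 \<ge> 0" "mono_on {0..T} w"
  shows "v 0 * w 0 * T powr (2 * H) \<le> L2_inner M (J (grid_step v T n)) (J (grid_step w T m))"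
proof -
  have T0: "T \<ge> 0" using T by simp
  let ?f = "\<lambda>i j. grid_weight v T n i * grid_weight w T m j * incr_cov T (T * real i / real n) (T * real j / real m)"
  have nonneg: "?f i j \<ge> 0" if "i < n" "j < m" for i j
    using that by (intro mult_nonneg_nonneg grid_weight_nonneg[OF T0 v] grid_weight_nonneg[OF T0 w]
        incr_cov_nonneg grid_le[OF T0]) auto
  have "v 0 * w 0 * T powr (2 * H) = ?f 0 0" by (simp add: grid_weight_def incr_cov_def)
  also have "\<dots> \<le> (\<Sum>j<m. ?f 0 j)"
    by (rule member_le_sum) (use n nonneg[OF n(1)] in \<open>simp_all del: of_nat_0\<close>)
  also have "\<dots> \<le> (\<Sum>i<n. \<Sum>j<m. ?f i j)"
    using n nonneg by (intro member_le_sum[of 0 "{..<n}" "\<lambda>i. \<Sum>j<m. ?f i j"]) (auto intro!: sum_nonneg)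
  finally show ?thesis unfolding grid_inner[OF T0 n] .
qed

lemma grid_norm_le:
  assumes T: "T > 0" and n: "n > 0"
    and v: "v 0 \<ge> 0" "mono_on {0..T} v"
  shows "L2_norm M (J (grid_step v T n)) \<le> v T * T powr H"
proof (rule power2_le_imp_le)
  have T0: "T \<ge> 0" using T by simp
  have v0: "v x \<ge> 0" if "0 \<le> x" "x \<le> T" for x
    using v(1) mono_onD[OF v(2), of 0 x] that by simp
  let ?S = "\<Sum>i<n. grid_weight v T n i"
  have S: "0 \<le> ?S" "?S \<le> v T"
    using grid_weight_nonneg[OF T0 v] grid_le[OF T0, of "n - 1" n] n T
    by (auto intro!: sum_nonneg) (auto simp: grid_weight_sum[OF n] intro!: mono_onD[OF v(2)])
  have "(L2_norm M (J (grid_step v T n)))\<^sup>2 =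
     (\<Sum>i<n. \<Sum>j<n. grid_weight v T n i * grid_weight v T n j * incr_cov T (T * real i / real n) (T * real j / real n))"
    unfolding L2_norm_sq by (rule grid_inner[OF T0 n n])
  also have "\<dots> \<le> (\<Sum>i<n. \<Sum>j<n. grid_weight v T n i * grid_weight v T n j * T powr (2 * H))"
    using T by (intro sum_mono mult_left_mono mult_nonneg_nonneg incr_cov_le grid_weight_nonneg[OF T0 v]) (auto intro!: grid_le)
  also have "\<dots> = ?S * ?S * T powr (2 * H)"
    by (subst sum_product) (simp add: sum_distrib_right)
  also have "\<dots> \<le> v T * v T * T powr (2 * H)" using S by (intro mult_right_mono mult_mono) auto
  also have "\<dots> = (v T * T powr H)\<^sup>2" by (simp add: power2_eq_square mult_ac flip: powr_add)
  finally show "(L2_norm M (J (grid_step v T n)))\<^sup>2 \<le> (v T * T powr H)\<^sup>2" .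
  show "0 \<le> v T * T powr H" using v0[of T] T by simp
qed

text \<open>
  The integrals of the grid approximations of \<open>v\<close> converge weakly to any Wiener integral \<open>X\<close> of \<open>v\<close>:
  the differences of the two approximating sequences satisfy the hypotheses of \<open>weak_null_W\<close>,
  monotonicity of \<open>v\<close> providing the bound.
\<close>

lemma grid_weak_limit:
  assumes T: "T > 0"
    and v: "v 0 \<ge> 0" "mono_on {0..T} v" "continuous_on {0..T} v"
    and p: "\<And>n. step_on T (p n)" "L2_tendsto (lebesgue_on {0..T}) (\<lambda>n. step_fun (p n)) v"
      "L2_tendsto M (\<lambda>n. J (p n)) X"
    and q: "\<And>n. step_on T (q n)" and Z: "L2_tendsto M (\<lambda>n. J (q n)) Z"
  shows "(\<lambda>n. L2_inner M (J (grid_step v T (Suc n))) Z) \<longlonglongrightarrow> L2_inner M X Z"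
proof -
  have T0: "T \<ge> 0" using T by simp
  let ?L = "lebesgue_on {0..T}"
  let ?g = "\<lambda>n. grid_step v T (Suc n)"
  let ?d = "\<lambda>n. ?g n @ step_neg (p n)"
  have d_on: "step_on T (?d n)" for n by (simp add: step_on_append grid_step_on[OF T0] step_on_neg p)
  have g: "L2_tendsto ?L (\<lambda>n. step_fun (?g n)) v" by (rule grid_step_tendsto[OF T v(3)])
  have J_d: "J (?d n) = (\<lambda>\<omega>. J (?g n) \<omega> + - J (p n) \<omega>)" for n
    by (auto simp: step_integral_append step_integral_neg)
  note gsq = J_square_integrable[OF grid_step_on[OF T0, of v]] and psq = J_square_integrable[OF p(1)]
  obtain B where B: "\<And>n. L2_norm M (J (p n)) \<le> B" using L2_tendsto_bounded[OF p(3)] by blast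
  have bound: "L2_norm M (J (?d n)) \<le> v T * T powr H + B" for n
    unfolding J_d using L2_norm_triangle[OF gsq[of "Suc n"] square_integrable_minus[OF psq[of n]]]
      B[of n] grid_norm_le[OF T zero_less_Suc v(1,2), of n] by (simp add: L2_norm_minus)
  have null: "(\<lambda>n. L2_norm ?L (step_fun (?d n))) \<longlonglongrightarrow> 0"
  proof (rule Lim_null_comparison)
    have vsq: "square_integrable ?L v" using v(3) by (rule continuous_square_integrable)
    have "step_fun (?d n) = (\<lambda>r. (step_fun (?g n) r - v r) + (v r - step_fun (p n) r))" for n
      by (auto simp: step_fun_append step_fun_neg)
    then have "L2_norm ?L (step_fun (?d n)) \<le> L2_norm ?L (\<lambda>r. step_fun (?g n) r - v r) + L2_norm ?L (\<lambda>r. step_fun (p n) r - v r)" for n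
      using L2_norm_triangle[OF square_integrable_diff[OF step_fun_square_integrable vsq]
          square_integrable_diff[OF vsq step_fun_square_integrable], of "?g n" "p n"]
      by (simp add: L2_norm_diff_commute[of _ "step_fun (p n)"])
    then show "\<forall>\<^sub>F n in sequentially. norm (L2_norm ?L (step_fun (?d n)))
        \<le> L2_norm ?L (\<lambda>r. step_fun (?g n) r - v r) + L2_norm ?L (\<lambda>r. step_fun (p n) r - v r)"
      by (simp add: L2_norm_nonneg)
    show "(\<lambda>n. L2_norm ?L (\<lambda>r. step_fun (?g n) r - v r) + L2_norm ?L (\<lambda>r. step_fun (p n) r - v r)) \<longlonglongrightarrow> 0"
      using g p(2) by (auto simp: L2_tendsto_def intro!: tendsto_add_zero)
  qed
  have Zsq: "square_integrable M Z" using Z by (simp add: L2_tendsto_def)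
  have "(\<lambda>n. L2_inner M (J (?d n)) Z + L2_inner M (J (p n)) Z) \<longlonglongrightarrow> 0 + L2_inner M X Z"
    by (intro tendsto_add weak_null_closure[OF d_on null bound q Z] L2_tendsto_inner[OF p(3) Zsq])
  moreover have "L2_inner M (J (?d n)) Z + L2_inner M (J (p n)) Z = L2_inner M (J (?g n)) Z" for n
    unfolding J_d using L2_inner_diff_left[OF gsq psq Zsq, of "Suc n" n] by simp
  ultimately show ?thesis by simp
qed

text \<open>
  For two grid approximations the inner product is a double sum of nonnegative terms, among which the
  term of the two left end points is \<open>v(0) w(0) T\<^bsup>2H\<^esup>\<close>. This lower bound survives the two successive weak
  limits.
\<close>

lemma wiener_inner_pos:
  assumes T: "T > 0"
    and v: "v 0 > 0" "mono_on {0..T} v" "continuous_on {0..T} v"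
    and w: "w 0 > 0" "mono_on {0..T} w" "continuous_on {0..T} w"
    and X: "has_wiener_integral M W T v X" and Y: "has_wiener_integral M W T w Y"
  shows "L2_inner M X Y > 0"
proof -
  have T0: "T \<ge> 0" and v0: "v 0 \<ge> 0" and w0: "w 0 \<ge> 0" using T v(1) w(1) by auto
  obtain p where p: "\<And>n. step_on T (p n)" "L2_tendsto (lebesgue_on {0..T}) (\<lambda>n. step_fun (p n)) v"
      "L2_tendsto M (\<lambda>n. J (p n)) X" using X unfolding has_wiener_integral_def by blast
  obtain q where q: "\<And>n. step_on T (q n)" "L2_tendsto (lebesgue_on {0..T}) (\<lambda>n. step_fun (q n)) w"
      "L2_tendsto M (\<lambda>n. J (q n)) Y" using Y unfolding has_wiener_integral_def by blast
  define \<kappa> where "\<kappa> = v 0 * w 0 * T powr (2 * H)"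
  have "\<kappa> \<le> L2_inner M (J (grid_step v T (Suc n))) Y" for n
  proof -
    let ?g = "grid_step v T (Suc n)"
    have "L2_tendsto M (\<lambda>_::nat. J ?g) (J ?g)"
      using J_square_integrable[OF grid_step_on[OF T0]] by (simp add: L2_tendsto_def L2_norm_def L2_inner_def)
    from grid_weak_limit[OF T w0 w(2,3) q grid_step_on[OF T0] this]
    have "(\<lambda>m. L2_inner M (J (grid_step w T (Suc m))) (J ?g)) \<longlonglongrightarrow> L2_inner M Y (J ?g)" .
    moreover have "\<kappa> \<le> L2_inner M (J (grid_step w T (Suc m))) (J ?g)" for m
      unfolding \<kappa>_def by (subst L2_inner_commute) (rule grid_inner_ge[OF T _ _ v0 v(2) w0 w(2)], auto)
    ultimately have "\<kappa> \<le> L2_inner M Y (J ?g)" by (intro LIMSEQ_le_const) auto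
    then show ?thesis by (simp add: L2_inner_commute)
  qed
  then have "\<kappa> \<le> L2_inner M X Y"
    using grid_weak_limit[OF T v0 v(2,3) p q(1,3)] by (intro LIMSEQ_le_const) auto
  moreover have "\<kappa> > 0" unfolding \<kappa>_def using v(1) w(1) T by simp
  ultimately show ?thesis by linarith
qed

lemma wiener_mean_zero:
  assumes X: "has_wiener_integral M W T v X"
  shows "(\<integral>\<omega>. X \<omega> \<partial>M) = 0"
proof -
  interpret prob_space M by (rule prob)
  obtain p where p: "\<And>n. step_on T (p n)" "L2_tendsto M (\<lambda>n. J (p n)) X"
    using X unfolding has_wiener_integral_def by blast
  have one: "square_integrable M (\<lambda>_. 1::real)" by (simp add: square_integrable_def)
  have W0: "L2_inner M (W x) (\<lambda>_. 1) = 0" if "x \<ge> 0" for x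
    using motion that by (simp add: fractional_brownian_motion_def L2_inner_def)
  have "L2_inner M (J (p n)) (\<lambda>_. 1) = 0" for n
  proof -
    have "L2_inner M (J (p n)) (\<lambda>_. 1) = step_sum (p n) (\<lambda>x. 0)"
      unfolding J_inner[OF one p(1)] by (rule step_sum_cong[OF p(1)]) (rule W0)
    also have "step_sum r (\<lambda>x. 0) = 0" for r by (induction r) auto
    finally show ?thesis .
  qed
  then have "L2_inner M X (\<lambda>_. 1) = 0"
    using L2_tendsto_inner[OF p(2) one] by (simp add: LIMSEQ_const_iff)
  then show ?thesis by (simp add: L2_inner_def)
qed

end

context fbm
begin

text \<open>
  Different versions of the Wiener integrals have the same covariances, since both are the weak limit
  of the same grid approximations.
\<close>

lemma wiener_inner_unique:
  assumes T: "T > 0"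
    and v: "v 0 \<ge> 0" "mono_on {0..T} v" "continuous_on {0..T} v"
    and w: "w 0 \<ge> 0" "mono_on {0..T} w" "continuous_on {0..T} w"
    and X: "has_wiener_integral M W T v X" "has_wiener_integral M W T v X'"
    and Y: "has_wiener_integral M W T w Y" "has_wiener_integral M W T w Y'"
  shows "L2_inner M X Y = L2_inner M X' Y'"
proof -
  have same: "L2_inner M A Z = L2_inner M A' Z"
    if x: "x 0 \<ge> 0" "mono_on {0..T} x" "continuous_on {0..T} x"
      "has_wiener_integral M W T x A" "has_wiener_integral M W T x A'" "has_wiener_integral M W T z Z"
    for x z A A' Z
  proof -
    have lim: "(\<lambda>n. L2_inner M (J (grid_step x T (Suc n))) Z) \<longlonglongrightarrow> L2_inner M B Z"
      if B: "has_wiener_integral M W T x B" for B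
    proof -
      obtain p where p: "\<And>n. step_on T (p n)" "L2_tendsto (lebesgue_on {0..T}) (\<lambda>n. step_fun (p n)) x"
          "L2_tendsto M (\<lambda>n. J (p n)) B" using B unfolding has_wiener_integral_def by blast
      obtain q where q: "\<And>n. step_on T (q n)" "L2_tendsto M (\<lambda>n. J (q n)) Z"
        using x(6) unfolding has_wiener_integral_def by blast
      show ?thesis by (rule grid_weak_limit[OF T x(1,2,3) p q])
    qed
    show ?thesis by (rule LIMSEQ_unique[OF lim[OF x(4)] lim[OF x(5)]])
  qed
  have "L2_inner M X Y = L2_inner M X' Y" by (rule same[OF v X Y(1)])
  also have "\<dots> = L2_inner M Y X'" by (rule L2_inner_commute)
  also have "\<dots> = L2_inner M Y' X'" by (rule same[OF w Y X(2)])
  also have "\<dots> = L2_inner M X' Y'" by (rule L2_inner_commute)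
  finally show ?thesis .
qed

end


section \<open>Identification of the sources\<close>

text \<open>
  The coefficients of the solution are known only up to null sets; completeness of the probability
  space makes them measurable.
\<close>

lemma complete_measure_AE_eq_measurable:
  fixes f g :: "'w \<Rightarrow> real"
  assumes M: "complete_measure M" and f: "f \<in> borel_measurable M" and eq: "AE x in M. f x = g x"
  shows "g \<in> borel_measurable M"
proof (rule measurableI)
  fix A :: "real set" assume A: "A \<in> sets borel"
  obtain N where N: "N \<in> null_sets M" "{x \<in> space M. f x \<noteq> g x} \<subseteq> N"
    using eq by (auto elim!: AE_E simp: null_sets_def)
  have sub: "B \<in> sets M" if "B \<subseteq> N" for B
    using complete_measure.complete[OF M that N(1)] .
  have "g -` A \<inter> space M = ((f -` A \<inter> space M) - N) \<union> (g -` A \<inter> space M \<inter> N)"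
    using N(2) by auto
  moreover have "f -` A \<inter> space M \<in> sets M" using f A by (rule measurable_sets)
  moreover have "N \<in> sets M" using N(1) by auto
  moreover have "g -` A \<inter> space M \<inter> N \<in> sets M" by (rule sub) auto
  ultimately show "g -` A \<inter> space M \<in> sets M" by (metis sets.Diff sets.Un)
qed simp

text \<open>
  The integrand \<open>v\<^sub>k\<close> of the mild solution, with \<open>c = \<lambda>\<^sub>k\<^sup>s\<close>.
\<close>

definition relaxation :: "real \<Rightarrow> real \<Rightarrow> real \<Rightarrow> real \<Rightarrow> real" where
  "relaxation \<alpha> c T r = mittag_leffler \<alpha> 1 (- c * (T - r) powr \<alpha>)"

lemma relaxation_properties:
  assumes \<alpha>: "0 < \<alpha>" "\<alpha> < 1" and c: "c \<ge> 0" and T: "T > 0"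
  shows relaxation_pos: "\<And>r. relaxation \<alpha> c T r > 0"
    and relaxation_mono: "mono_on {0..T} (relaxation \<alpha> c T)"
    and relaxation_continuous: "continuous_on {0..T} (relaxation \<alpha> c T)"
proof -
  show "relaxation \<alpha> c T r > 0" for r
    unfolding relaxation_def using mittag_leffler_pos[OF \<alpha>, of "c * (T - r) powr \<alpha>"] c by simp
  show "mono_on {0..T} (relaxation \<alpha> c T)"
  proof (rule mono_onI)
    fix r s assume "r \<in> {0..T}" "s \<in> {0..T}" "r \<le> s"
    then have "c * (T - s) powr \<alpha> \<le> c * (T - r) powr \<alpha>"
      using c \<alpha> by (intro mult_left_mono powr_mono2) auto
    then show "relaxation \<alpha> c T r \<le> relaxation \<alpha> c T s"
      unfolding relaxation_def using mittag_leffler_antimono[OF \<alpha>, of "c * (T - s) powr \<alpha>" "c * (T - r) powr \<alpha>"] c by simp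
  qed
  show "continuous_on {0..T} (relaxation \<alpha> c T)"
    unfolding relaxation_def using \<alpha>
    by (intro continuous_on_compose2[OF mittag_leffler_continuous[OF \<alpha>]] continuous_on_mult continuous_on_powr'
        continuous_on_diff continuous_on_const continuous_on_id) auto
qed

lemma weighted_integral_pos:
  assumes T: "T > 0" and h: "ess_bounded_on {0..T} h" and C: "C > 0" "AE t in lebesgue_on {0<..<T}. h t \<ge> C"
    and v: "v 0 > 0" "mono_on {0..T} v" "continuous_on {0..T} v"
  shows "(\<integral>r. v r * h r \<partial>lebesgue_on {0..T}) > 0"
proof -
  let ?L = "lebesgue_on {0..T}"
  have hm [measurable]: "h \<in> borel_measurable ?L" using h by (simp add: ess_bounded_on_def)
  obtain B where B: "AE t in ?L. \<bar>h t\<bar> \<le> B" using h by (auto simp: ess_bounded_on_def)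
  have vm [measurable]: "v \<in> borel_measurable ?L"
    using v(3) by (intro continuous_imp_measurable_on_sets_lebesgue) auto
  have v0: "v 0 \<le> v r" "v r \<le> v T" if "r \<in> {0..T}" for r
    using mono_onD[OF v(2), of 0 r] mono_onD[OF v(2), of r T] that by auto
  have int: "integrable ?L (\<lambda>r. v r * h r)"
  proof (rule Bochner_Integration.integrable_bound[where f="\<lambda>_. v T * B"])
    show "integrable ?L (\<lambda>_. v T * B)" by (rule continuous_imp_integrable_real) simp
    show "(\<lambda>r. v r * h r) \<in> borel_measurable ?L" by measurable
    have "AE r in ?L. r \<in> {0..T}" by (rule AE_I2) simp
    with B show "AE r in ?L. norm (v r * h r) \<le> norm (v T * B)"
    proof eventually_elim
      case (elim r)
      have "\<bar>v r\<bar> \<le> \<bar>v T\<bar>" using v0[OF elim(2)] v(1) by linarith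
      moreover have "\<bar>h r\<bar> \<le> \<bar>B\<bar>" using elim(1) by linarith
      ultimately show ?case by (auto simp: abs_mult intro!: mult_mono)
    qed
  qed
  have lower: "AE r in ?L. v 0 * C \<le> v r * h r"
  proof -
    have "AE r in lebesgue. r \<in> {0<..<T} \<longrightarrow> h r \<ge> C"
      using C(2) by (subst (asm) AE_restrict_space_iff) auto
    moreover have "AE r in lebesgue. r \<noteq> 0" "AE r in lebesgue. r \<noteq> T"
      by (auto intro!: AE_completion AE_lborel_singleton)
    ultimately have "AE r in lebesgue. r \<in> {0..T} \<longrightarrow> v 0 * C \<le> v r * h r"
    proof eventually_elim
      case (elim r)
      show ?case
      proof
        assume r: "r \<in> {0..T}"
        then have "h r \<ge> C" using elim by auto
        then show "v 0 * C \<le> v r * h r" using v0[OF r] v(1) C(1) by (intro mult_mono) auto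
      qed
    qed
    then show ?thesis by (subst AE_restrict_space_iff) auto
  qed
  have "0 < T * (v 0 * C)" using T v(1) C(1) by simp
  also have "\<dots> = (\<integral>r. v 0 * C \<partial>?L)" using T by (simp add: measure_restrict_space)
  also have "\<dots> \<le> (\<integral>r. v r * h r \<partial>?L)"
    by (rule integral_mono_AE[OF _ int lower]) (rule continuous_imp_integrable_real, simp)
  finally show ?thesis .
qed

text \<open>
  The diagonal products give \<open>|a\<^sub>k| = |b\<^sub>k|\<close>; the products with a fixed nonzero \<open>a\<^sub>k\<close> fix all signs
  relative to the sign of that entry.
\<close>

lemma rank_one_determined:
  fixes a b :: "'k \<Rightarrow> real"
  assumes "\<And>k l. k \<in> K \<Longrightarrow> l \<in> K \<Longrightarrow> a k * a l = b k * b l" "k0 \<in> K" "a k0 \<noteq> 0"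
  obtains \<sigma> :: real where "\<bar>\<sigma>\<bar> = 1" "\<And>k. k \<in> K \<Longrightarrow> b k = \<sigma> * a k"
proof -
  have sq: "(a k0)\<^sup>2 = (b k0)\<^sup>2" using assms(1)[OF assms(2,2)] by (simp add: power2_eq_square)
  then have ab: "\<bar>a k0\<bar> = \<bar>b k0\<bar>" by (auto simp: power2_eq_iff)
  define \<sigma> where "\<sigma> = b k0 / a k0"
  have "\<bar>\<sigma>\<bar> = 1" using ab assms(3) by (simp add: \<sigma>_def abs_divide)
  moreover have "b k = \<sigma> * a k" if "k \<in> K" for k
  proof -
    have "b k0 * (b k0 * b k) = b k0 * (a k0 * a k)" using assms(1)[OF assms(2) that] by simp
    moreover have "b k0 * (b k0 * b k) = (a k0)\<^sup>2 * b k" unfolding sq by (simp add: power2_eq_square)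
    ultimately have "a k0 * (a k0 * b k) = a k0 * (b k0 * a k)" by (simp add: power2_eq_square mult_ac)
    then show ?thesis using assms(3) by (simp add: \<sigma>_def field_simps)
  qed
  ultimately show ?thesis by (rule that)
qed

lemma covariance_AE_affine:
  assumes M: "prob_space M" "complete_measure M"
    and X: "square_integrable M X" "(\<integral>\<omega>. X \<omega> \<partial>M) = 0"
      and Y: "square_integrable M Y" "(\<integral>\<omega>. Y \<omega> \<partial>M) = 0"
    and U: "AE \<omega> in M. U \<omega> = m + a * X \<omega>" and V: "AE \<omega> in M. V \<omega> = n + b * Y \<omega>"
  shows mean_AE_affine: "(\<integral>\<omega>. U \<omega> \<partial>M) = m" and "covariance M U V = a * b * L2_inner M X Y"
proof -
  interpret prob_space M by (rule M)
  have one: "square_integrable M (\<lambda>_. 1::real)" by (simp add: square_integrable_def)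
  have int: "integrable M X" "integrable M Y"
    using square_integrable_inner[OF X(1) one] square_integrable_inner[OF Y(1) one] by auto
  then have Xm [measurable]: "X \<in> borel_measurable M" and Ym [measurable]: "Y \<in> borel_measurable M" by auto
  have Um [measurable]: "U \<in> borel_measurable M"
    by (rule complete_measure_AE_eq_measurable[OF M(2), where f="\<lambda>\<omega>. m + a * X \<omega>"]) (use U in auto)
  have Vm [measurable]: "V \<in> borel_measurable M"
    by (rule complete_measure_AE_eq_measurable[OF M(2), where f="\<lambda>\<omega>. n + b * Y \<omega>"]) (use V in auto)
  have EU: "(\<integral>\<omega>. U \<omega> \<partial>M) = m"
  proof -
    have "(\<integral>\<omega>. U \<omega> \<partial>M) = (\<integral>\<omega>. m + a * X \<omega> \<partial>M)"
      by (rule integral_cong_AE) (use U in auto)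
    then show ?thesis using int X by (simp add: prob_space)
  qed
  have EV: "(\<integral>\<omega>. V \<omega> \<partial>M) = n"
  proof -
    have "(\<integral>\<omega>. V \<omega> \<partial>M) = (\<integral>\<omega>. n + b * Y \<omega> \<partial>M)"
      by (rule integral_cong_AE) (use V in auto)
    then show ?thesis using int Y by (simp add: prob_space)
  qed
  show "(\<integral>\<omega>. U \<omega> \<partial>M) = m" by (rule EU)
  have "covariance M U V = (\<integral>\<omega>. (a * b) * (X \<omega> * Y \<omega>) \<partial>M)"
    unfolding covariance_def EU EV
  proof (rule integral_cong_AE)
    show "AE \<omega> in M. (U \<omega> - m) * (V \<omega> - n) = a * b * (X \<omega> * Y \<omega>)"
      using U V by eventually_elim simp
  qed auto
  then show "covariance M U V = a * b * L2_inner M X Y" by (simp add: L2_inner_def)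
qed


theorem theorem4p1:
  fixes M :: "'w measure"
    and W :: "real \<Rightarrow> 'w \<Rightarrow> real"
    and D :: "'a::euclidean_space set"
    and lam :: "nat \<Rightarrow> real"
    and \<phi> :: "nat \<Rightarrow> 'a \<Rightarrow> real"
    and T \<alpha> s H C\<^sub>h :: real
    and h :: "real \<Rightarrow> real"
    and f g f' g' :: "'a \<Rightarrow> real"
    and u u' :: "real \<Rightarrow> 'w \<Rightarrow> 'a \<Rightarrow> real"
  assumes "prob_space M" and "complete_measure M"
    and "T > 0" and "0 < \<alpha>" and "\<alpha> < 1" and "0 < s" and "s < 1" and "0 < H" and "H < 1"
    and "bounded_lipschitz_domain D"
    and "dirichlet_eigensystem D lam \<phi>"
    and "fractional_brownian_motion M H W"
    and "ess_bounded_on {0..T} h"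
    and "C\<^sub>h > 0" and "AE t in lebesgue_on {0<..<T}. h t \<ge> C\<^sub>h"
    and "square_integrable (lebesgue_on D) f" and "square_integrable (lebesgue_on D) g"
    and "L2_norm (lebesgue_on D) g \<noteq> 0"
    and "square_integrable (lebesgue_on D) f'" and "square_integrable (lebesgue_on D) g'"
    and "L2_norm (lebesgue_on D) g' \<noteq> 0"
    and "mild_solution M W D lam \<phi> T \<alpha> s h f g u"
    and "mild_solution M W D lam \<phi> T \<alpha> s h f' g' u'"
    and "\<forall>k\<ge>1. (\<integral>\<omega>. eig_coeff D \<phi> u k T \<omega> \<partial>M) = (\<integral>\<omega>. eig_coeff D \<phi> u' k T \<omega> \<partial>M)"
    and "\<forall>k\<ge>1. \<forall>l\<ge>1. covariance M (eig_coeff D \<phi> u k T) (eig_coeff D \<phi> u l T)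
                       = covariance M (eig_coeff D \<phi> u' k T) (eig_coeff D \<phi> u' l T)"
  shows "(AE x in lebesgue_on D. f x = f' x) \<and> (AE x in lebesgue_on D. \<bar>g x\<bar> = \<bar>g' x\<bar>)"
proof -
  note M = assms(1,2) and T = assms(3) and \<alpha> = assms(4,5) and eig = assms(11) and h = assms(13,14,15)
  note fsq = assms(16,19) and gsq = assms(17,20)
  have D: "bounded D" "open D" using assms(10) by (auto simp: bounded_lipschitz_domain_def)
  let ?L = "lebesgue_on D"
  interpret fbm M W H by (rule fbm.intro[OF assms(1,12,8)])
  define v where "v k = relaxation \<alpha> (lam k powr s) T" for k
  have v: "v k 0 > 0" "mono_on {0..T} (v k)" "continuous_on {0..T} (v k)" for k
    unfolding v_def by (auto intro!: relaxation_pos relaxation_mono relaxation_continuous \<alpha> T)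
  have v_eq: "(\<lambda>r. mittag_leffler \<alpha> 1 (- (lam k powr s) * (T - r) powr \<alpha>)) = v k" for k
    by (simp add: v_def relaxation_def fun_eq_iff)
  define m where "m k = (\<integral>r. v k r * h r \<partial>lebesgue_on {0..T})" for k
  have m_pos: "m k > 0" for k
    unfolding m_def by (rule weighted_integral_pos[OF T assms(13) h(2,3) v])
  have data: "\<exists>I. has_wiener_integral M W T (v k) I \<and>
      (AE \<omega> in M. eig_coeff D \<phi> u k T \<omega> = L2_inner ?L f (\<phi> k) * m k + L2_inner ?L g (\<phi> k) * I \<omega>)"
    if "mild_solution M W D lam \<phi> T \<alpha> s h f g u" "k \<ge> 1" for f g u k
  proof -
    have "T \<in> {0..T}" using T by simp
    from that(1)[unfolded mild_solution_def, rule_format, OF this, THEN conjunct2, rule_format, OF that(2)]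
    show ?thesis unfolding v_eq m_def by (simp only: v_eq[symmetric])
  qed
  have sq: "square_integrable M I" if "has_wiener_integral M W T w I" for w I
    using that by (auto simp: has_wiener_integral_def L2_tendsto_def)
  have ex: "\<exists>I. \<forall>k\<ge>1. has_wiener_integral M W T (v k) (I k) \<and>
      (AE \<omega> in M. eig_coeff D \<phi> u k T \<omega> = L2_inner ?L f (\<phi> k) * m k + L2_inner ?L g (\<phi> k) * I k \<omega>)"
    if "mild_solution M W D lam \<phi> T \<alpha> s h f g u" for f g u
    using data[OF that] by metis
  obtain I where I: "\<And>k. k \<ge> 1 \<Longrightarrow> has_wiener_integral M W T (v k) (I k)"
    "\<And>k. k \<ge> 1 \<Longrightarrow> AE \<omega> in M. eig_coeff D \<phi> u k T \<omega> = L2_inner ?L f (\<phi> k) * m k + L2_inner ?L g (\<phi> k) * I k \<omega>"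
    using ex[OF assms(22)] by blast
  obtain I' where I': "\<And>k. k \<ge> 1 \<Longrightarrow> has_wiener_integral M W T (v k) (I' k)"
    "\<And>k. k \<ge> 1 \<Longrightarrow> AE \<omega> in M. eig_coeff D \<phi> u' k T \<omega> = L2_inner ?L f' (\<phi> k) * m k + L2_inner ?L g' (\<phi> k) * I' k \<omega>"
    using ex[OF assms(23)] by blast
  note moments = covariance_AE_affine[OF M sq[OF I(1)] wiener_mean_zero[OF I(1)] sq[OF I(1)] wiener_mean_zero[OF I(1)] I(2) I(2)]
  note moments' = covariance_AE_affine[OF M sq[OF I'(1)] wiener_mean_zero[OF I'(1)] sq[OF I'(1)] wiener_mean_zero[OF I'(1)] I'(2) I'(2)]
  note phi_sq = eigenfunction_square_integrable[OF eig]
  have f_coeff: "L2_inner ?L f (\<phi> k) = L2_inner ?L f' (\<phi> k)" if k: "k \<ge> 1" for k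
  proof -
    have "L2_inner ?L f (\<phi> k) * m k = L2_inner ?L f' (\<phi> k) * m k"
      unfolding moments(1)[OF k k k k k k, symmetric] moments'(1)[OF k k k k k k, symmetric]
      using assms(24) k by blast
    then show ?thesis using m_pos[of k] by simp
  qed
  have g_coeff: "L2_inner ?L g (\<phi> k) * L2_inner ?L g (\<phi> l) = L2_inner ?L g' (\<phi> k) * L2_inner ?L g' (\<phi> l)"
    if k: "k \<ge> 1" and l: "l \<ge> 1" for k l
  proof -
    have v0: "v k 0 \<ge> 0" "v l 0 \<ge> 0" using v(1) by (auto intro: less_imp_le)
    have eq: "L2_inner M (I k) (I l) = L2_inner M (I' k) (I' l)"
      by (rule wiener_inner_unique[OF T v0(1) v(2,3) v0(2) v(2,3) I(1)[OF k] I'(1)[OF k] I(1)[OF l] I'(1)[OF l]])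
    have "L2_inner M (I k) (I l) > 0" by (rule wiener_inner_pos[OF T v v I(1)[OF k] I(1)[OF l]])
    then show ?thesis
      using assms(25) k l moments(2)[OF k k l l k l] moments'(2)[OF k k l l k l] eq by simp
  qed
  have "AE x in ?L. f x - f' x = 0"
  proof (rule eigenfunctions_complete[OF D eig square_integrable_diff[OF fsq]])
    fix k :: nat assume k: "k \<ge> 1"
    show "L2_inner ?L (\<lambda>x. f x - f' x) (\<phi> k) = 0"
      using f_coeff[OF k] by (simp add: L2_inner_diff_left[OF fsq phi_sq[OF k]])
  qed
  then have "AE x in ?L. f x = f' x" by simp
  moreover have "AE x in ?L. \<bar>g x\<bar> = \<bar>g' x\<bar>"
  proof -
    have "\<exists>k\<ge>1. L2_inner ?L g (\<phi> k) \<noteq> 0"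
    proof (rule ccontr)
      assume "\<not> ?thesis"
      then have "AE x in ?L. g x = 0" by (intro eigenfunctions_complete[OF D eig gsq(1)]) auto
      then have "L2_norm ?L g = 0" using L2_inner_self_eq_0[OF gsq(1)] by (simp add: L2_norm_def)
      then show False using assms(18) by simp
    qed
    then obtain k0 where "k0 \<in> {1..}" "L2_inner ?L g (\<phi> k0) \<noteq> 0" by auto
    from rank_one_determined[of "{1..}" "\<lambda>k. L2_inner ?L g (\<phi> k)" "\<lambda>k. L2_inner ?L g' (\<phi> k)", OF _ this]
    obtain \<sigma> where \<sigma>: "\<bar>\<sigma>\<bar> = 1" "\<And>k. k \<in> {1..} \<Longrightarrow> L2_inner ?L g' (\<phi> k) = \<sigma> * L2_inner ?L g (\<phi> k)"
      using g_coeff by auto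
    have \<sigma>g: "square_integrable ?L (\<lambda>x. \<sigma> *\<^sub>R g x)" by (rule square_integrable_scale[OF gsq(1)])
    have "AE x in ?L. g' x - \<sigma> *\<^sub>R g x = 0"
    proof (rule eigenfunctions_complete[OF D eig square_integrable_diff[OF gsq(2) \<sigma>g]])
      fix k :: nat assume k: "k \<ge> 1"
      show "L2_inner ?L (\<lambda>x. g' x - \<sigma> *\<^sub>R g x) (\<phi> k) = 0"
        unfolding L2_inner_diff_left[OF gsq(2) \<sigma>g phi_sq[OF k]] L2_inner_scale_left using \<sigma>(2)[of k] k by simp
    qed
    then show ?thesis
    proof eventually_elim
      case (elim x)
      then have "g' x = \<sigma> * g x" by simp
      then show ?case using \<sigma>(1) by (simp add: abs_mult)
    qed
  qed
  ultimately show ?thesis by blast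
qed

end
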